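(* Let $\mathbb{F}_q$ be the finite field of even order $q$. Let $G(n,q)=\mathrm{SL}_2(\mathbb{F}_q[t]/(t^n))$. Let $\epsilon>0$. There exists an absolute constant $C>0$ such that for all $n\in\mathbb{N}$, $$\mathrm{diam}^+\big(G(n,q)\big)=O_{q,\epsilon}\big(\log^{C+\epsilon}|G(n,q)|\big).$$ Moreover there exists an absolute constant $C'>0$ such that the directed navigation problem for $G(n,q)$ is solvable for this bound in time $$O_{q,\epsilon}\big(\log^{C'+\epsilon}|G(n,q)|\big).$$
   Context: For a finite group $G$ and a generating set $S\subseteq G$, $B^+_S(n)$ is the set of elements of $G$ expressible as positive words (no inverses of generators) of length at most $n$ in $S$; $\mathrm{diam}^+(G,S)=\min\{n\in\mathbb{N}: B^+_S(n)=G\}$; and $\mathrm{diam}^+(G)$ is the maximum of $\mathrm{diam}^+(G,S)$ over all generating subsets $S$ of $G$. Directed navigation problem: let $(G_n)_n$ be a sequence of finite groups and let $l_n,t_n\in\mathbb{N}$ with $\mathrm{diam}^+(G_n)\le l_n$ for all $n$. The directed navigation problem for $G_n$ is solvable for the bound $\mathrm{diam}^+(G_n)\le l_n$ in time $t_n$ if there is a deterministic algorithm which, given an index $n$, a generating set $S_n\subseteq G_n$ and an element $g\in G_n$, outputs in time at most $t_n$ a positive word $w$ in $S_n$ of length at most $l_n$ which is equal to $g$ in $G_n$. The notation $O_{q,\epsilon}(\cdot)$ means that the implied constant depends only on $q$ and $\epsilon$. *)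

theory Defs
  imports Complex_Main "HOL-Library.List_Lexorder" "HOL-Algebra.UnivPoly"
    "HOL-Algebra.QuotRing" "HOL-Algebra.Generated_Groups"
begin

section \<open>Directed diameters\<close>

definition word_value :: "('g, 'm) monoid_scheme \<Rightarrow> 'g list \<Rightarrow> 'g" where
  "word_value G w = foldr (\<otimes>\<^bsub>G\<^esub>) w \<one>\<^bsub>G\<^esub>"

definition pos_ball :: "('g, 'm) monoid_scheme \<Rightarrow> 'g set \<Rightarrow> nat \<Rightarrow> 'g set" where
  "pos_ball G S n = {word_value G w | w. set w \<subseteq> S \<and> length w \<le> n}"

definition generating_set :: "('g, 'm) monoid_scheme \<Rightarrow> 'g set \<Rightarrow> bool" where
  "generating_set G S \<longleftrightarrow> S \<subseteq> carrier G \<and> generate G S = carrier G"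

definition diam_pos_wrt :: "('g, 'm) monoid_scheme \<Rightarrow> 'g set \<Rightarrow> nat" where
  "diam_pos_wrt G S = (LEAST n. pos_ball G S n = carrier G)"

definition diam_pos :: "('g, 'm) monoid_scheme \<Rightarrow> nat" where
  "diam_pos G = Max {diam_pos_wrt G S | S. generating_set G S}"


section \<open>The groups \<open>SL\<^sub>2(F[t]/(t\<^sup>n))\<close>\<close>

text \<open>The quadruple \<open>(a, b, c, d)\<close> is the matrix with rows \<open>(a, b)\<close> and \<open>(c, d)\<close>.\<close>

definition SL2 :: "('a, 'm) ring_scheme \<Rightarrow> ('a \<times> 'a \<times> 'a \<times> 'a) monoid" where
  "SL2 R = \<lparr>
     carrier = {(a, b, c, d). a \<in> carrier R \<and> b \<in> carrier R \<and> c \<in> carrier R \<and> d \<in> carrier R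
                  \<and> a \<otimes>\<^bsub>R\<^esub> d \<ominus>\<^bsub>R\<^esub> b \<otimes>\<^bsub>R\<^esub> c = \<one>\<^bsub>R\<^esub>},
     mult = (\<lambda>(a, b, c, d) (a', b', c', d').
        (a \<otimes>\<^bsub>R\<^esub> a' \<oplus>\<^bsub>R\<^esub> b \<otimes>\<^bsub>R\<^esub> c', a \<otimes>\<^bsub>R\<^esub> b' \<oplus>\<^bsub>R\<^esub> b \<otimes>\<^bsub>R\<^esub> d',
         c \<otimes>\<^bsub>R\<^esub> a' \<oplus>\<^bsub>R\<^esub> d \<otimes>\<^bsub>R\<^esub> c', c \<otimes>\<^bsub>R\<^esub> b' \<oplus>\<^bsub>R\<^esub> d \<otimes>\<^bsub>R\<^esub> d')),
     one = (\<one>\<^bsub>R\<^esub>, \<zero>\<^bsub>R\<^esub>, \<zero>\<^bsub>R\<^esub>, \<one>\<^bsub>R\<^esub>)\<rparr>"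

definition trunc_ideal :: "('a, 'm) ring_scheme \<Rightarrow> nat \<Rightarrow> (nat \<Rightarrow> 'a) set" where
  "trunc_ideal F n = PIdl\<^bsub>UP F\<^esub> (monom (UP F) \<one>\<^bsub>F\<^esub> n)"

definition trunc_poly_ring :: "('a, 'm) ring_scheme \<Rightarrow> nat \<Rightarrow> (nat \<Rightarrow> 'a) set ring" where
  "trunc_poly_ring F n = UP F Quot trunc_ideal F n"

type_synonym 'a trunc_mat =
  "(nat \<Rightarrow> 'a) set \<times> (nat \<Rightarrow> 'a) set \<times> (nat \<Rightarrow> 'a) set \<times> (nat \<Rightarrow> 'a) set"

definition SL2_trunc :: "('a, 'm) ring_scheme \<Rightarrow> nat \<Rightarrow> 'a trunc_mat monoid" where
  "SL2_trunc F n = SL2 (trunc_poly_ring F n)"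

lemma SL2_group:
  fixes R (structure)
  assumes "cring R"
  shows "group (SL2 R)"
proof -
  interpret cring R by fact
  have canc: "x \<oplus> y \<ominus> x = y" if "x \<in> carrier R" "y \<in> carrier R" for x y
    using that by (simp add: a_minus_def a_comm[of x y] a_assoc r_neg)
  show ?thesis
  proof (rule groupI)
    fix x y assume "x \<in> carrier (SL2 R)" "y \<in> carrier (SL2 R)"
    then obtain a b c d a' b' c' d' where xy: "x = (a, b, c, d)" "y = (a', b', c', d')"
      and carr: "a \<in> carrier R" "b \<in> carrier R" "c \<in> carrier R" "d \<in> carrier R"
        "a' \<in> carrier R" "b' \<in> carrier R" "c' \<in> carrier R" "d' \<in> carrier R"
      and det: "a \<otimes> d \<ominus> b \<otimes> c = \<one>" "a' \<otimes> d' \<ominus> b' \<otimes> c' = \<one>"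
      by (auto simp: SL2_def)
    define m where "m = a \<otimes> a' \<otimes> (c \<otimes> b') \<oplus> b \<otimes> c' \<otimes> (d \<otimes> d')"
    have m: "m \<in> carrier R" using carr by (simp add: m_def)
    have "(a \<otimes> a' \<oplus> b \<otimes> c') \<otimes> (c \<otimes> b' \<oplus> d \<otimes> d') \<ominus>
          (a \<otimes> b' \<oplus> b \<otimes> d') \<otimes> (c \<otimes> a' \<oplus> d \<otimes> c') 
       = m \<oplus> (a \<otimes> d \<ominus> b \<otimes> c) \<otimes> (a' \<otimes> d' \<ominus> b' \<otimes> c') \<ominus> m"
      using carr by (simp add: m_def a_minus_def l_distr r_distr l_minus r_minus minus_add m_ac a_ac)
    then have "(a \<otimes> a' \<oplus> b \<otimes> c') \<otimes> (c \<otimes> b' \<oplus> d \<otimes> d') \<ominus>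
        (a \<otimes> b' \<oplus> b \<otimes> d') \<otimes> (c \<otimes> a' \<oplus> d \<otimes> c')
        = (a \<otimes> d \<ominus> b \<otimes> c) \<otimes> (a' \<otimes> d' \<ominus> b' \<otimes> c')"
      using m carr by (simp add: canc)
    then show "x \<otimes>\<^bsub>SL2 R\<^esub> y \<in> carrier (SL2 R)"
      using carr det by (simp add: SL2_def xy)
  next
    show "\<one>\<^bsub>SL2 R\<^esub> \<in> carrier (SL2 R)"
      by (simp add: SL2_def a_minus_def)
  next
    fix x y z assume "x \<in> carrier (SL2 R)" "y \<in> carrier (SL2 R)" "z \<in> carrier (SL2 R)"
    then obtain a b c d a' b' c' d' a'' b'' c'' d''
      where "x = (a, b, c, d)" "y = (a', b', c', d')" "z = (a'', b'', c'', d'')"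
        "a \<in> carrier R" "b \<in> carrier R" "c \<in> carrier R" "d \<in> carrier R"
        "a' \<in> carrier R" "b' \<in> carrier R" "c' \<in> carrier R" "d' \<in> carrier R"
        "a'' \<in> carrier R" "b'' \<in> carrier R" "c'' \<in> carrier R" "d'' \<in> carrier R"
      by (auto simp: SL2_def)
    then show "x \<otimes>\<^bsub>SL2 R\<^esub> y \<otimes>\<^bsub>SL2 R\<^esub> z = x \<otimes>\<^bsub>SL2 R\<^esub> (y \<otimes>\<^bsub>SL2 R\<^esub> z)"
      by (simp add: SL2_def l_distr r_distr m_assoc a_ac)
  next
    fix x assume "x \<in> carrier (SL2 R)"
    then show "\<one>\<^bsub>SL2 R\<^esub> \<otimes>\<^bsub>SL2 R\<^esub> x = x"
      by (auto simp: SL2_def)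
  next
    fix x assume "x \<in> carrier (SL2 R)"
    then obtain a b c d where x: "x = (a, b, c, d)"
      and carr: "a \<in> carrier R" "b \<in> carrier R" "c \<in> carrier R" "d \<in> carrier R"
      and det: "a \<otimes> d \<ominus> b \<otimes> c = \<one>"
      by (auto simp: SL2_def)
    have "d \<otimes> a \<ominus> (\<ominus> b) \<otimes> (\<ominus> c) = a \<otimes> d \<ominus> b \<otimes> c"
      using carr by (simp add: a_minus_def l_minus r_minus m_comm a_comm r_neg)
    moreover have "d \<otimes> a \<oplus> (\<ominus> b) \<otimes> c = a \<otimes> d \<ominus> b \<otimes> c"
      using carr by (simp add: a_minus_def l_minus r_minus m_comm a_comm r_neg)
    moreover have "(\<ominus> c) \<otimes> b \<oplus> a \<otimes> d = a \<otimes> d \<ominus> b \<otimes> c"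
      using carr by (simp add: a_minus_def l_minus r_minus m_comm a_comm r_neg)
    moreover have "d \<otimes> b \<oplus> (\<ominus> b) \<otimes> d = \<zero>"
      using carr by (simp add: a_minus_def l_minus r_minus m_comm a_comm r_neg)
    moreover have "(\<ominus> c) \<otimes> a \<oplus> a \<otimes> c = \<zero>"
      using carr by (simp add: a_minus_def l_minus r_minus m_comm a_comm r_neg)
    ultimately have "(d, \<ominus> b, \<ominus> c, a) \<in> carrier (SL2 R) \<and>
        (d, \<ominus> b, \<ominus> c, a) \<otimes>\<^bsub>SL2 R\<^esub> x = \<one>\<^bsub>SL2 R\<^esub>"
      using carr det by (simp add: SL2_def x)
    then show "\<exists>y\<in>carrier (SL2 R). y \<otimes>\<^bsub>SL2 R\<^esub> x = \<one>\<^bsub>SL2 R\<^esub>" by blast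
  qed
qed


section \<open>Deterministic algorithms and their running time\<close>

text \<open>
  Programs run on a deterministic random access machine with finitely many registers and arrays
  holding natural numbers. Every elementary instruction and every test takes one time step. The
  only arithmetic is addition and truncated subtraction, so that \<open>k\<close> steps lengthen the binary
  representation of the numbers involved by \<open>O(k)\<close> bits only; hence unit-cost time is polynomially
  related to logarithmic-cost time and to Turing machine time.
  In \<open>Read r a s\<close> and \<open>Write a r s\<close> the name of the array is \<open>a\<close>, and \<open>s\<close> respectively \<open>r\<close> is the
  register holding the address.
\<close>

datatype program =
    Skip
  | Const nat nat
  | Add nat nat nat
  | Sub nat nat nat
  | Read nat nat nat
  | Write nat nat nat
  | Seq program program
  | IfLess nat nat program program
  | WhileLess nat nat program

type_synonym machine_state = "(nat \<Rightarrow> nat) \<times> (nat \<Rightarrow> nat \<Rightarrow> nat)"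

text \<open>\<open>exec P s k s'\<close>: started in state \<open>s\<close>, the program \<open>P\<close> halts after \<open>k\<close> steps in state \<open>s'\<close>.\<close>

inductive exec :: "program \<Rightarrow> machine_state \<Rightarrow> nat \<Rightarrow> machine_state \<Rightarrow> bool" where
  Skip: "exec Skip s 1 s"
| Const: "exec (Const r c) (\<rho>, \<mu>) 1 (\<rho>(r := c), \<mu>)"
| Add: "exec (Add r u v) (\<rho>, \<mu>) 1 (\<rho>(r := \<rho> u + \<rho> v), \<mu>)"
| Sub: "exec (Sub r u v) (\<rho>, \<mu>) 1 (\<rho>(r := \<rho> u - \<rho> v), \<mu>)"
| Read: "exec (Read r a u) (\<rho>, \<mu>) 1 (\<rho>(r := \<mu> a (\<rho> u)), \<mu>)"
| Write: "exec (Write a r u) (\<rho>, \<mu>) 1 (\<rho>, \<mu>(a := (\<mu> a)(\<rho> r := \<rho> u)))"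
| Seq: "exec P s k s' \<Longrightarrow> exec Q s' m s'' \<Longrightarrow> exec (Seq P Q) s (k + m) s''"
| IfTrue: "fst s u < fst s v \<Longrightarrow> exec P s k s' \<Longrightarrow> exec (IfLess u v P Q) s (k + 1) s'"
| IfFalse: "\<not> fst s u < fst s v \<Longrightarrow> exec Q s k s' \<Longrightarrow> exec (IfLess u v P Q) s (k + 1) s'"
| WhileFalse: "\<not> fst s u < fst s v \<Longrightarrow> exec (WhileLess u v P) s 1 s"
| WhileTrue: "fst s u < fst s v \<Longrightarrow> exec P s k s' \<Longrightarrow> exec (WhileLess u v P) s' m s''
    \<Longrightarrow> exec (WhileLess u v P) s (k + m + 1) s''"

inductive_cases exec_basicE:
  "exec Skip s k s'" "exec (Const r c) s k s'" "exec (Add r u v) s k s'"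
  "exec (Sub r u v) s k s'" "exec (Read r a u) s k s'" "exec (Write a r u) s k s'"
inductive_cases exec_SeqE: "exec (Seq P Q) s k s'"
inductive_cases exec_IfE: "exec (IfLess u v P Q) s k s'"
inductive_cases exec_WhileE: "exec (WhileLess u v P) s k s'"

lemma exec_deterministic:
  "exec P s k s' \<Longrightarrow> exec P s m s'' \<Longrightarrow> k = m \<and> s' = s''"
proof (induction arbitrary: m s'' rule: exec.induct)
  case Seq
  from Seq.prems show ?case by (rule exec_SeqE) (metis Seq.IH)
next
  case IfTrue
  from IfTrue.prems show ?case by (rule exec_IfE) (metis IfTrue.IH IfTrue.hyps Suc_eq_plus1)+
next
  case IfFalse
  from IfFalse.prems show ?case by (rule exec_IfE) (metis IfFalse.IH IfFalse.hyps Suc_eq_plus1)+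
next
  case (WhileFalse s u v P)
  from WhileFalse.prems show ?case by (rule exec_WhileE) (use WhileFalse.hyps in auto)
next
  case WhileTrue
  from WhileTrue.prems show ?case by (rule exec_WhileE) (metis WhileTrue.IH WhileTrue.hyps Suc_eq_plus1)+
qed (erule exec_basicE; simp)+

text \<open>The input is in array \<open>0\<close> and the output in array \<open>1\<close>, both starting at address \<open>0\<close>.\<close>

definition initial_state :: "nat list \<Rightarrow> machine_state" where
  "initial_state xs =
     (\<lambda>r. 0, \<lambda>a i. if a = 0 \<and> i < length xs then xs ! i else 0)"

definition has_output :: "machine_state \<Rightarrow> nat list \<Rightarrow> bool" where
  "has_output s ys \<longleftrightarrow> (\<forall>i < length ys. snd s 1 i = ys ! i)"

definition list_code :: "nat list list \<Rightarrow> nat list" where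
  "list_code xss = length xss # concat xss"


section \<open>The directed navigation problem\<close>

text \<open>
  Group elements are presented to the machine through an encoding \<open>enc n\<close> of \<open>G n\<close> by lists of
  numbers. A set of group elements is presented as the lexicographically sorted list of the codes
  of its elements. The order matters: a generating set can have about \<open>\<bar>G\<bar>\<close> elements, of which a
  particular one may be indispensable, and in an arbitrarily ordered list this element cannot be
  found in time polylogarithmic in \<open>\<bar>G\<bar>\<close>. The output is the sequence of the letters of the word.
\<close>

definition navigation_input ::
    "(nat \<Rightarrow> 'g \<Rightarrow> nat list) \<Rightarrow> nat \<Rightarrow> 'g set \<Rightarrow> 'g \<Rightarrow> nat list" where
  "navigation_input enc n S g = n # enc n g @ list_code (sorted_list_of_set (enc n ` S))"

definition directed_navigation_solvable ::
    "(nat \<Rightarrow> 'g monoid) \<Rightarrow> (nat \<Rightarrow> 'g \<Rightarrow> nat list) \<Rightarrow> (nat \<Rightarrow> nat) \<Rightarrow> (nat \<Rightarrow> nat) \<Rightarrow> bool" where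
  "directed_navigation_solvable G enc l T \<longleftrightarrow>
     (\<exists>P. \<forall>n \<ge> 1. \<forall>S g. generating_set (G n) S \<and> g \<in> carrier (G n) \<longrightarrow>
        (\<exists>k s w. exec P (initial_state (navigation_input enc n S g)) k s \<and> k \<le> T n \<and>
           set w \<subseteq> S \<and> length w \<le> l n \<and> word_value (G n) w = g \<and>
           has_output s (list_code (map (enc n) w))))"

text \<open>
  A class in \<open>F[t]/(t\<^sup>n)\<close> is determined by its coefficients at \<open>t\<^sup>0, \<dots>, t\<^sup>n\<^sup>-\<^sup>1\<close>, which do not depend
  on the representative. A matrix is encoded as a polynomial in \<open>t\<close> with matrix coefficients, lowest
  coefficient first. The field elements are themselves natural numbers here: up to isomorphism
  every finite field of order \<open>q\<close> has carrier \<open>{..<q}\<close>.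
\<close>

definition trunc_coeff :: "('a, 'm) ring_scheme \<Rightarrow> (nat \<Rightarrow> 'a) set \<Rightarrow> nat \<Rightarrow> 'a" where
  "trunc_coeff F A i = coeff (UP F) (SOME p. p \<in> A) i"

definition trunc_mat_code :: "(nat, 'm) ring_scheme \<Rightarrow> nat \<Rightarrow> nat trunc_mat \<Rightarrow> nat list" where
  "trunc_mat_code F n = (\<lambda>(a, b, c, d).
     concat (map (\<lambda>i. [trunc_coeff F a i, trunc_coeff F b i, trunc_coeff F c i, trunc_coeff F d i])
       [0..<n]))"

lemma trunc_coeff_rcos:
  assumes "cring F" "p \<in> carrier (UP F)" "i < n"
  shows "trunc_coeff F (trunc_ideal F n +>\<^bsub>UP F\<^esub> p) i = coeff (UP F) p i"
proof -
  interpret UP_cring F "UP F" by (simp_all add: UP_cring_def assms(1))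
  let ?I = "trunc_ideal F n"
  have cm: "monom (UP F) \<one>\<^bsub>F\<^esub> n \<in> carrier (UP F)" by simp
  have id: "ideal ?I (UP F)" unfolding trunc_ideal_def by (rule P.cgenideal_ideal[OF cm])
  define x where "x = (SOME x. x \<in> ?I +>\<^bsub>UP F\<^esub> p)"
  interpret I: ideal ?I "UP F" by (rule id)
  have "\<zero>\<^bsub>UP F\<^esub> \<oplus>\<^bsub>UP F\<^esub> p \<in> ?I +>\<^bsub>UP F\<^esub> p"
    unfolding a_r_coset_def' using I.zero_closed by blast
  then have "p \<in> ?I +>\<^bsub>UP F\<^esub> p" using assms(2) by simp
  then have "x \<in> ?I +>\<^bsub>UP F\<^esub> p" 
    unfolding x_def by (rule someI[of "\<lambda>x. x \<in> ?I +>\<^bsub>UP F\<^esub> p"])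
  then obtain y where y: "y \<in> carrier (UP F)"
      "x = y \<otimes>\<^bsub>UP F\<^esub> monom (UP F) \<one>\<^bsub>F\<^esub> n \<oplus>\<^bsub>UP F\<^esub> p"
    unfolding a_r_coset_def' trunc_ideal_def cgenideal_def by blast
  have "coeff (UP F) (y \<otimes>\<^bsub>UP F\<^esub> monom (UP F) \<one>\<^bsub>F\<^esub> n) i
      = (\<Oplus>\<^bsub>F\<^esub>j\<in>{..i}. \<zero>\<^bsub>F\<^esub>)"
    unfolding coeff_mult[OF y(1) cm]
    by (rule R.finsum_cong') (use assms(3) y(1) in \<open>auto simp: coeff_monom\<close>)
  then have "coeff (UP F) x i = coeff (UP F) p i"
    using y assms(2) cm by (simp add: R.finsum_zero)
  then show ?thesis by (simp add: trunc_coeff_def x_def)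
qed

end

theory Submission
  imports Defs "HOL-Algebra.Sylow" "HOL-Algebra.Multiplicative_Group" "HOL-Library.Countable"
begin

text \<open>
  Work in characteristic 2 with the ring of \<open>2 \<times> 2\<close> matrices over \<open>F[t]/(t\<^sup>n)\<close>. If \<open>y\<close> has leading term
  \<open>1 + t\<^sup>j X\<close> and \<open>h = 1 + t\<^sup>i + t\<^sup>2\<^sup>i E\<close> modulo \<open>t\<^sup>2\<^sup>i\<^sup>+\<^sup>1\<close>, where \<open>X E + E X = X\<close>, then the scalar part of
  \<open>h\<close> does not contribute and the commutator of \<open>y\<close> and \<open>h\<close> has leading term \<open>1 + t\<^sup>j\<^sup>+\<^sup>2\<^sup>i X\<close>. For idempotent \<open>E\<close>
  the square of \<open>h\<close> has the same shape with \<open>2i\<close> in place of \<open>i\<close>, since \<open>(c + B)\<^sup>2 = c\<^sup>2 + B\<^sup>2\<close> for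
  central \<open>c\<close>. So starting from words for \<open>h\<close> with \<open>i = 1\<close> and for \<open>y\<close> with \<open>j\<close> equal to 1 or 2, all prescribed
  modulo \<open>t\<^sup>3\<close> only, the commutators of \<open>y\<close> with \<open>h\<^sup>2\<^sup>^\<^sup>p\<close> for the binary digits \<open>p\<close> of \<open>m\<close> give words of
  length polynomial in \<open>m\<close> with leading term \<open>1 + t\<^sup>j\<^sup>+\<^sup>2\<^sup>m X\<close>. Three choices of \<open>X\<close>
  span the trace zero matrices, and multiplying by such words removes the coefficients of the target one
  level at a time. Inverses cost a factor \<open>2 n\<close> at most, because \<open>x\<close> to the power \<open>2\<^sup>K \<ge> n\<close> is trivial for every \<open>x\<close>
  congruent to 1 modulo \<open>t\<close>.

  The words modulo \<open>t\<^sup>3\<close> depend only on the set of classes of the generators, of which there are boundedly many: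
  the program finds this set by binary search in the sorted input, branches over all possibilities,
  and has the words built in.
\<close>

section \<open>Leading terms and commutators in characteristic two\<close>

text \<open>The obstacle is that in characteristic 2 the trace zero matrices form a nilpotent Lie
  algebra: all their brackets are scalar. Commutators of elements with noncentral leading
  coefficients therefore produce scalar directions only, and the usual climb through the levels
  stops at once. The element \<open>h\<close> escapes because its leading coefficient is scalar:
  \<open>1 + t^i\<close> has determinant \<open>1 + t^(2i)\<close>, and restoring determinant 1
  forces a correction \<open>t^(2i) E\<close> with \<open>E\<close> of trace 1. Bracketing with such
  an \<open>E\<close>, which lies outside the Lie algebra, can fix a direction \<open>X\<close>. The
  level then grows by the even number \<open>2i\<close>, so both starting levels 1 and 2 are
  required, and \<open>t^3\<close> is the first modulus that shows \<open>E\<close> for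
  \<open>i = 1\<close>.

  The machine neither multiplies nor knows the field. Everything that depends on \<open>q\<close>
  alone (field tables, classes, short words) is therefore placed in the control flow as a finite
  table, while everything that depends on \<open>n\<close> is computed by counting, copying and
  doubling.\<close>

locale filtered_ring = ring R for R (structure) +
  fixes s
  assumes s_closed [simp]: "s \<in> carrier R"
    and s_central: "x \<in> carrier R \<Longrightarrow> x \<otimes> s = s \<otimes> x"
    and char2: "x \<in> carrier R \<Longrightarrow> x \<oplus> x = \<zero>"
begin

text \<open>Congruence modulo the ideal of \<open>s [^] k\<close>: in characteristic 2 the sum is
  the difference, and because \<open>s\<close> is central multiples on one side suffice.\<close>

definition cong_s :: "nat \<Rightarrow> 'a \<Rightarrow> 'a \<Rightarrow> bool" where
  "cong_s k x y \<longleftrightarrow> x \<in> carrier R \<and> y \<in> carrier R \<and> (\<exists>w\<in>carrier R. x \<oplus> y = s [^] k \<otimes> w)"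

abbreviation leading :: "nat \<Rightarrow> 'a \<Rightarrow> 'a \<Rightarrow> bool" where
  "leading k a x \<equiv> cong_s (Suc k) x (\<one> \<oplus> s [^] k \<otimes> a)"

text \<open>All coefficients strictly between \<open>i\<close> and \<open>2 * i\<close> vanish, so
  \<open>e\<close> is the first coefficient that is allowed to be noncentral.\<close>

abbreviation almost_scalar :: "nat \<Rightarrow> 'a \<Rightarrow> 'a \<Rightarrow> bool" where
  "almost_scalar i e h \<equiv> cong_s (Suc (2 * i)) h (\<one> \<oplus> s [^] i \<oplus> s [^] (2 * i) \<otimes> e)"

section \<open>Congruences modulo powers of a central element\<close>

lemma cong_carrier: "cong_s k x y \<Longrightarrow> x \<in> carrier R" "cong_s k x y \<Longrightarrow> y \<in> carrier R"
  by (auto simp: cong_s_def)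

lemma s_pow_central: "x \<in> carrier R \<Longrightarrow> x \<otimes> s [^] (k::nat) = s [^] k \<otimes> x"
proof (induction k)
  case (Suc k)
  then show ?case
    by (metis m_assoc nat_pow_Suc nat_pow_closed s_central s_closed)
qed simp

lemma add_cancel2: "x \<in> carrier R \<Longrightarrow> y \<in> carrier R \<Longrightarrow> x \<oplus> (x \<oplus> y) = y"
  by (metis a_assoc char2 l_zero)

lemma cong_refl: "x \<in> carrier R \<Longrightarrow> cong_s k x x"
  unfolding cong_s_def by (metis char2 nat_pow_closed r_null s_closed zero_closed)

lemma cong_sym: "cong_s k x y \<Longrightarrow> cong_s k y x"
  unfolding cong_s_def by (metis a_comm)

lemma cong_add:
  assumes "cong_s k x x'" "cong_s k y y'" shows "cong_s k (x \<oplus> y) (x' \<oplus> y')"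
proof -
  from assms obtain v w where c: "x \<in> carrier R" "x' \<in> carrier R" "y \<in> carrier R" "y' \<in> carrier R"
    and vw: "v \<in> carrier R" "w \<in> carrier R" "x \<oplus> x' = s [^] k \<otimes> v" "y \<oplus> y' = s [^] k \<otimes> w"
    unfolding cong_s_def by auto
  have "(x \<oplus> y) \<oplus> (x' \<oplus> y') = (x \<oplus> x') \<oplus> (y \<oplus> y')" using c by (simp add: a_ac)
  also have "\<dots> = s [^] k \<otimes> (v \<oplus> w)" using vw by (simp add: r_distr)
  finally show ?thesis unfolding cong_s_def using c vw by blast
qed

lemma cong_trans:
  assumes "cong_s k x y" "cong_s k y z" shows "cong_s k x z"
proof -
  from assms obtain v w where c: "x \<in> carrier R" "y \<in> carrier R" "z \<in> carrier R"
    and vw: "v \<in> carrier R" "w \<in> carrier R" "x \<oplus> y = s [^] k \<otimes> v" "y \<oplus> z = s [^] k \<otimes> w"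
    unfolding cong_s_def by auto
  have "x \<oplus> z = (x \<oplus> y) \<oplus> (y \<oplus> z)" using c by (simp add: a_assoc add_cancel2)
  also have "\<dots> = s [^] k \<otimes> (v \<oplus> w)" using vw by (simp add: r_distr)
  finally show ?thesis unfolding cong_s_def using c vw by blast
qed

lemma cong_mono:
  assumes "cong_s k x y" "j \<le> k" shows "cong_s j x y"
proof -
  from assms obtain w where c: "x \<in> carrier R" "y \<in> carrier R" "w \<in> carrier R" "x \<oplus> y = s [^] k \<otimes> w"
    unfolding cong_s_def by auto
  have "s [^] k = s [^] j \<otimes> s [^] (k - j)" using assms(2) by (simp add: nat_pow_mult)
  then have "x \<oplus> y = s [^] j \<otimes> (s [^] (k - j) \<otimes> w)" using c by (simp add: m_assoc)
  then show ?thesis unfolding cong_s_def using c(1-3) by (intro conjI bexI[of _ "s [^] (k - j) \<otimes> w"]) auto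
qed

lemma cong_zero_iff: "cong_s k x \<zero> \<longleftrightarrow> (\<exists>w\<in>carrier R. x = s [^] k \<otimes> w)"
  unfolding cong_s_def by auto

lemma cong_iff_zero: "x \<in> carrier R \<Longrightarrow> y \<in> carrier R \<Longrightarrow> cong_s k x y \<longleftrightarrow> cong_s k (x \<oplus> y) \<zero>"
  unfolding cong_s_def by auto

lemma cong_zero_mult:
  assumes "cong_s j x \<zero>" "cong_s k y \<zero>" shows "cong_s (j + k) (x \<otimes> y) \<zero>"
proof -
  from assms obtain v w where c: "v \<in> carrier R" "w \<in> carrier R" "x = s [^] j \<otimes> v" "y = s [^] k \<otimes> w"
    unfolding cong_zero_iff by auto
  have "x \<otimes> y = s [^] j \<otimes> (v \<otimes> s [^] k) \<otimes> w" using c by (simp add: m_assoc)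
  also have "\<dots> = (s [^] j \<otimes> s [^] k) \<otimes> (v \<otimes> w)" using c by (simp add: s_pow_central[of v] m_assoc)
  finally show ?thesis unfolding cong_zero_iff using c by (intro bexI[of _ "v \<otimes> w"]) (auto simp: nat_pow_mult)
qed

lemma cong_0: "x \<in> carrier R \<Longrightarrow> y \<in> carrier R \<Longrightarrow> cong_s 0 x y"
  unfolding cong_s_def by auto

text \<open>Precision is relative, as for power series: factors of order \<open>j\<close> and
  \<open>k\<close>, each known to \<open>d\<close> further digits, have a product known to
  \<open>d\<close> digits beyond \<open>j + k\<close>. Plain \<open>cong_mult\<close> would lose the
  orders. Splitting the difference as \<open>x \<otimes> (y \<oplus> y') \<oplus> (x \<oplus> x')
  \<otimes> y'\<close> shows that only the orders of \<open>x\<close> and \<open>y'\<close>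
  enter.\<close>

lemma cong_mult_lead:
  assumes "cong_s (j + d) x x'" "cong_s (k + d) y y'" "cong_s j x \<zero>" "cong_s k y' \<zero>"
  shows "cong_s (j + k + d) (x \<otimes> y) (x' \<otimes> y')"
proof -
  have c: "x \<in> carrier R" "x' \<in> carrier R" "y \<in> carrier R" "y' \<in> carrier R"
    using assms by (auto dest: cong_carrier)
  have "x \<otimes> y \<oplus> x' \<otimes> y' = x \<otimes> (y \<oplus> y') \<oplus> (x \<oplus> x') \<otimes> y'"
    using c by (simp add: l_distr r_distr a_assoc add_cancel2)
  moreover have "cong_s (j + (k + d)) (x \<otimes> (y \<oplus> y')) \<zero>"
    using assms c by (intro cong_zero_mult) (auto simp: cong_iff_zero[symmetric])
  then have "cong_s (j + k + d) (x \<otimes> (y \<oplus> y')) \<zero>" by (simp add: ac_simps)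
  moreover have "cong_s ((j + d) + k) ((x \<oplus> x') \<otimes> y') \<zero>"
    using assms c by (intro cong_zero_mult) (auto simp: cong_iff_zero[symmetric])
  then have "cong_s (j + k + d) ((x \<oplus> x') \<otimes> y') \<zero>" by (simp add: ac_simps)
  ultimately show ?thesis
    using c cong_add[of "j + k + d" "x \<otimes> (y \<oplus> y')" \<zero> "(x \<oplus> x') \<otimes> y'" \<zero>] cong_iff_zero[of "x \<otimes> y" "x' \<otimes> y'"] by simp
qed

lemma cong_mult:
  assumes "cong_s k x x'" "cong_s k y y'" shows "cong_s k (x \<otimes> y) (x' \<otimes> y')"
  using cong_mult_lead[of 0 k x x' 0 y y'] assms cong_0 by (auto dest: cong_carrier)

lemma cong_s_pow_zero: "x \<in> carrier R \<Longrightarrow> j \<le> k \<Longrightarrow> cong_s j (s [^] k \<otimes> x) \<zero>"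
  by (rule cong_mono[of k]) (auto simp: cong_zero_iff)

lemma cong_add_left: "cong_s k (x \<oplus> y) (x \<oplus> z) \<Longrightarrow> x \<in> carrier R \<Longrightarrow> y \<in> carrier R \<Longrightarrow> z \<in> carrier R \<Longrightarrow> cong_s k y z"
  using cong_add[OF cong_refl[of x k], of "x \<oplus> y" "x \<oplus> z"] by (simp add: add_cancel2)

section \<open>Products, squares and commutators of leading terms\<close>

lemma leading_cong_one: "leading k a x \<Longrightarrow> a \<in> carrier R \<Longrightarrow> cong_s k x \<one>"
  by (rule cong_trans[where y = "\<one> \<oplus> s [^] k \<otimes> a"])
    (use cong_mono[of "Suc k" x _ k] cong_add[OF cong_refl[OF one_closed] cong_s_pow_zero[of a k k]] in auto)

text \<open>The cross term has order \<open>2 * k\<close>, which exceeds \<open>k\<close> because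
  \<open>1 \<le> k\<close>.\<close>

lemma leading_mult:
  assumes "leading k a x" "leading k b y" "1 \<le> k" "a \<in> carrier R" "b \<in> carrier R"
  shows "leading k (a \<oplus> b) (x \<otimes> y)"
proof -
  let ?a = "s [^] k \<otimes> a" and ?b = "s [^] k \<otimes> b"
  have "cong_s (Suc k) (?a \<otimes> ?b) \<zero>"
    using cong_zero_mult[of k ?a k ?b] assms by (auto intro: cong_mono simp: cong_s_pow_zero)
  then have "cong_s (Suc k) ((\<one> \<oplus> (?a \<oplus> ?b)) \<oplus> ?a \<otimes> ?b) ((\<one> \<oplus> (?a \<oplus> ?b)) \<oplus> \<zero>)"
    using assms by (intro cong_add cong_refl) auto
  moreover have "(\<one> \<oplus> ?a) \<otimes> (\<one> \<oplus> ?b) = (\<one> \<oplus> (?a \<oplus> ?b)) \<oplus> ?a \<otimes> ?b"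
    using assms by (simp add: l_distr r_distr a_ac)
  ultimately have "cong_s (Suc k) ((\<one> \<oplus> ?a) \<otimes> (\<one> \<oplus> ?b)) (\<one> \<oplus> s [^] k \<otimes> (a \<oplus> b))"
    using assms by (simp add: r_distr)
  then show ?thesis using cong_mult[OF assms(1,2)] cong_trans by blast
qed

text \<open>The part \<open>B\<close> is known to one digit beyond its order \<open>2 * i\<close>,
  hence \<open>B \<otimes> B\<close> to one digit beyond \<open>4 * i\<close>, which is the
  precision the next stage demands. Idempotence of \<open>e\<close> keeps the coefficient, and with
  it the direction fixed by later commutators, unchanged.\<close>

lemma almost_scalar_square:
  assumes h: "almost_scalar i e h" and e: "e \<in> carrier R" "e \<otimes> e = e" and i: "1 \<le> i"
  shows "almost_scalar (2 * i) e (h \<otimes> h)"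
proof -
  define c where "c = \<one> \<oplus> s [^] i"
  define B where "B = c \<oplus> h"
  let ?E = "s [^] (2 * i) \<otimes> e"
  have cc: "c \<in> carrier R" "h \<in> carrier R" "B \<in> carrier R" "?E \<in> carrier R"
    using h e by (auto simp: c_def B_def dest: cong_carrier)
  have hB: "h = c \<oplus> B" using cc by (simp add: B_def add_cancel2)
  have BE: "cong_s (2 * i + 1) B ?E"
    using h cc unfolding hB c_def[symmetric] by (rule_tac cong_add_left[of _ c]) auto
  have E0: "cong_s (2 * i) ?E \<zero>" using e by (simp add: cong_s_pow_zero)
  have B0: "cong_s (2 * i) B \<zero>" using BE E0 cong_trans cong_mono by (metis le_add1)
  have cB: "B \<otimes> c = c \<otimes> B" using cc by (simp add: c_def l_distr r_distr s_pow_central[of B])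
  have "h \<otimes> h = c \<otimes> c \<oplus> B \<otimes> B"
    using cc by (simp add: hB l_distr r_distr cB a_assoc add_cancel2)
  moreover have "c \<otimes> c = \<one> \<oplus> s [^] (2 * i)"
    by (simp add: c_def l_distr r_distr a_assoc add_cancel2 nat_pow_mult mult_2)
  moreover have "?E \<otimes> ?E = s [^] (2 * (2 * i)) \<otimes> e"
  proof -
    have "?E \<otimes> ?E = s [^] (2 * i) \<otimes> (e \<otimes> s [^] (2 * i)) \<otimes> e" using e by (simp add: m_assoc)
    also have "\<dots> = (s [^] (2 * i) \<otimes> s [^] (2 * i)) \<otimes> (e \<otimes> e)" using e(1) by (simp add: s_pow_central[of e] m_assoc)
    finally show ?thesis using e by (simp add: nat_pow_mult mult_2)
  qed
  moreover have "cong_s (Suc (2 * (2 * i))) (B \<otimes> B) (?E \<otimes> ?E)"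
    using cong_mult_lead[OF BE BE B0 E0] by (simp add: mult_2)
  ultimately show ?thesis using cong_add[OF cong_refl] by simp
qed

text \<open>Central summands drop out of \<open>y \<otimes> h \<oplus> h \<otimes> y\<close>, so the
  orders \<open>j\<close> and \<open>2 * i\<close> of \<open>A\<close> and \<open>B\<close> count
  and not the order \<open>i\<close> of the scalar part. The inverses are variables of their own
  because they will be values of positive words.\<close>

lemma leading_commutator:
  assumes y: "leading j a y" and h: "almost_scalar i e h" and ae: "a \<in> carrier R" "e \<in> carrier R"
    and com: "a \<otimes> e \<oplus> e \<otimes> a = a" and ij: "1 \<le> i" "1 \<le> j"
    and inv: "y' \<in> carrier R" "h' \<in> carrier R" "y \<otimes> y' = \<one>" "y' \<otimes> y = \<one>" "h \<otimes> h' = \<one>" "h' \<otimes> h = \<one>"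
  shows "leading (j + 2 * i) a (y \<otimes> h \<otimes> (y' \<otimes> h'))"
proof -
  define c where "c = \<one> \<oplus> s [^] i"
  define B where "B = c \<oplus> h"
  define A where "A = \<one> \<oplus> y"
  let ?E = "s [^] (2 * i) \<otimes> e" and ?A = "s [^] j \<otimes> a"
  have cc: "c \<in> carrier R" "h \<in> carrier R" "y \<in> carrier R" "B \<in> carrier R" "A \<in> carrier R"
      "?E \<in> carrier R" "?A \<in> carrier R"
    using y h ae by (auto simp: c_def B_def A_def dest: cong_carrier)
  have hB: "h = c \<oplus> B" "y = \<one> \<oplus> A" using cc by (simp_all add: B_def A_def add_cancel2)
  have BE: "cong_s (2 * i + 1) B ?E"
    using h cc unfolding hB c_def[symmetric] by (rule_tac cong_add_left[of _ c]) auto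
  have AA: "cong_s (j + 1) A ?A"
    using y cc unfolding hB by (rule_tac cong_add_left[of _ \<one>]) auto
  have E0: "cong_s (2 * i) ?E \<zero>" "cong_s j ?A \<zero>" using ae by (simp_all add: cong_s_pow_zero)
  have B0: "cong_s (2 * i) B \<zero>" using BE E0 cong_trans cong_mono by (metis le_add1)
  have A0: "cong_s j A \<zero>" using AA E0 cong_trans cong_mono by (metis le_add1)
  have cA: "A \<otimes> c = c \<otimes> A" using cc by (simp add: c_def l_distr r_distr s_pow_central[of A])
  have "y \<otimes> h \<oplus> h \<otimes> y = A \<otimes> B \<oplus> B \<otimes> A"
  proof -
    have "y \<otimes> h \<oplus> h \<otimes> y = (c \<oplus> c) \<oplus> (B \<oplus> B) \<oplus> (A \<otimes> c \<oplus> c \<otimes> A) \<oplus> (A \<otimes> B \<oplus> B \<otimes> A)"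
      unfolding hB using cc by (simp add: l_distr r_distr a_ac)
    then show ?thesis using cc by (simp add: char2 cA)
  qed
  moreover have "cong_s (Suc (j + 2 * i)) (A \<otimes> B) (?A \<otimes> ?E)"
    using cong_mult_lead[OF AA BE A0 E0(1)] by simp
  moreover have "cong_s (Suc (j + 2 * i)) (B \<otimes> A) (?E \<otimes> ?A)"
    using cong_mult_lead[OF BE AA B0 E0(2)] by (simp add: add.commute)
  moreover have "?A \<otimes> ?E \<oplus> ?E \<otimes> ?A = s [^] (j + 2 * i) \<otimes> a"
  proof -
    have "?A \<otimes> ?E = s [^] j \<otimes> (a \<otimes> s [^] (2 * i)) \<otimes> e" using ae by (simp add: m_assoc)
    also have "\<dots> = s [^] (j + 2 * i) \<otimes> (a \<otimes> e)"
      using ae by (simp add: s_pow_central[of a] nat_pow_mult[symmetric] m_assoc)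
    finally have 1: "?A \<otimes> ?E = s [^] (j + 2 * i) \<otimes> (a \<otimes> e)" .
    have "?E \<otimes> ?A = s [^] (2 * i) \<otimes> (e \<otimes> s [^] j) \<otimes> a" using ae by (simp add: m_assoc)
    also have "\<dots> = s [^] (2 * i + j) \<otimes> (e \<otimes> a)"
      using ae by (simp add: s_pow_central[of e] nat_pow_mult[symmetric] m_assoc)
    finally have 2: "?E \<otimes> ?A = s [^] (j + 2 * i) \<otimes> (e \<otimes> a)" by (simp add: add.commute)
    show ?thesis unfolding 1 2 using ae com by (simp add: r_distr[symmetric])
  qed
  ultimately have d: "cong_s (Suc (j + 2 * i)) (y \<otimes> h \<oplus> h \<otimes> y) (s [^] (j + 2 * i) \<otimes> a)"
    using cong_add by metis
  have d0: "cong_s (j + 2 * i) (s [^] (j + 2 * i) \<otimes> a) \<zero>" using ae by (simp add: cong_s_pow_zero)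
  have y1: "cong_s 1 y \<one>" using leading_cong_one[OF y ae(1)] cong_mono ij(2) by blast
  have h1: "cong_s 1 h \<one>"
  proof -
    have "cong_s 1 (\<one> \<oplus> s [^] i \<otimes> \<one> \<oplus> ?E) (\<one> \<oplus> \<zero> \<oplus> \<zero>)"
      using ij ae by (intro cong_add cong_refl cong_s_pow_zero) auto
    then have "cong_s 1 (\<one> \<oplus> s [^] i \<oplus> ?E) \<one>" by simp
    then show ?thesis using cong_mono[OF h, of 1] cong_trans by auto
  qed
  have y'1: "cong_s 1 y' \<one>" using cong_mult[OF cong_refl[of y'] y1] inv cong_sym by fastforce
  have h'1: "cong_s 1 h' \<one>" using cong_mult[OF cong_refl[of h'] h1] inv cong_sym by fastforce
  have yh1: "cong_s (0 + 1) (y' \<otimes> h') \<one>" using cong_mult[OF y'1 h'1] by simp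
  let ?v = "y' \<otimes> h'" and ?d = "y \<otimes> h \<oplus> h \<otimes> y"
  have "h \<otimes> y \<otimes> ?v = h \<otimes> (y \<otimes> y') \<otimes> h'" using inv(1,2) cc(2,3) by (simp add: m_assoc)
  then have "h \<otimes> y \<otimes> ?v = \<one>" using inv cc by simp
  then have "?d \<otimes> ?v = y \<otimes> h \<otimes> ?v \<oplus> \<one>"
    using inv(1,2) cc(2,3) by (simp add: l_distr)
  \<comment> \<open>The commutator is 1 plus \<open>?d \<otimes> ?v\<close>. Here \<open>?v\<close>
    is known modulo \<open>s\<close> only, which is enough: a factor congruent to 1 preserves the
    leading coefficient of \<open>?d\<close>.\<close>
  then have eq: "y \<otimes> h \<otimes> ?v = \<one> \<oplus> ?d \<otimes> ?v"
    using inv(1,2) cc(2,3) by (simp add: a_comm add_cancel2)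
  have dd: "cong_s (j + 2 * i) ?d \<zero>"
    using cong_trans[OF cong_mono[OF d, of "j + 2 * i"] d0] by simp
  have "cong_s (j + 2 * i + 1) ?d (s [^] (j + 2 * i) \<otimes> a)" using d by simp
  from cong_mult_lead[OF this yh1 dd cong_0]
  have "cong_s (Suc (j + 2 * i)) (?d \<otimes> ?v) (s [^] (j + 2 * i) \<otimes> a)"
    using ae by simp
  then show ?thesis unfolding eq by (intro cong_add cong_refl) auto
qed

text \<open>Since \<open>(x + 1)^2 = x^2 + 1\<close> in characteristic 2, each squaring doubles the
  order of \<open>x + 1\<close>.\<close>

lemma pow_two_power:
  assumes x: "cong_s 1 x \<one>"
  shows "cong_s (2 ^ K) (x [^] (2 ^ K :: nat)) \<one>"
proof (induction K)
  case 0
  then show ?case using x cong_carrier[OF x] by simp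
next
  case (Suc K)
  define y where "y = x [^] (2 ^ K :: nat)"
  have c: "x \<in> carrier R" "y \<in> carrier R" using cong_carrier[OF x] by (simp_all add: y_def)
  have y: "cong_s (2 ^ K) (y \<oplus> \<one>) \<zero>"
    using Suc c by (simp add: cong_iff_zero[symmetric] y_def)
  have "cong_s (2 ^ Suc K) ((y \<oplus> \<one>) \<otimes> (y \<oplus> \<one>)) \<zero>"
    using cong_zero_mult[OF y y] by (simp add: mult_2)
  moreover have "(y \<oplus> \<one>) \<otimes> (y \<oplus> \<one>) = y \<otimes> y \<oplus> (y \<oplus> y) \<oplus> \<one>"
    using c by (simp add: l_distr r_distr a_ac)
  moreover have "y \<otimes> y = x [^] (2 ^ Suc K :: nat)"
    using c by (simp add: y_def nat_pow_mult mult_2)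
  ultimately show ?case using c by (simp add: char2 cong_iff_zero[symmetric])
qed

end

section \<open>Matrices over truncated polynomials\<close>

text \<open>The full matrix ring around \<open>SL2 R\<close>: leading terms are sums, and sums leave
  the group. Sharing multiplication and unit with \<open>SL2 R\<close> lets the same product be read
  in either structure.\<close>

definition mat2 :: "('a, 'm) ring_scheme \<Rightarrow> ('a \<times> 'a \<times> 'a \<times> 'a) ring" where
  "mat2 R = \<lparr>carrier = carrier R \<times> carrier R \<times> carrier R \<times> carrier R,
     monoid.mult = monoid.mult (SL2 R), monoid.one = monoid.one (SL2 R),
     zero = (\<zero>\<^bsub>R\<^esub>, \<zero>\<^bsub>R\<^esub>, \<zero>\<^bsub>R\<^esub>, \<zero>\<^bsub>R\<^esub>),
     add = (\<lambda>(a, b, c, d) (a', b', c', d').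
       (a \<oplus>\<^bsub>R\<^esub> a', b \<oplus>\<^bsub>R\<^esub> b', c \<oplus>\<^bsub>R\<^esub> c', d \<oplus>\<^bsub>R\<^esub> d'))\<rparr>"

lemma mat2_simps [simp]:
  "carrier (mat2 R) = carrier R \<times> carrier R \<times> carrier R \<times> carrier R"
  "\<one>\<^bsub>mat2 R\<^esub> = (\<one>\<^bsub>R\<^esub>, \<zero>\<^bsub>R\<^esub>, \<zero>\<^bsub>R\<^esub>, \<one>\<^bsub>R\<^esub>)"
  "\<zero>\<^bsub>mat2 R\<^esub> = (\<zero>\<^bsub>R\<^esub>, \<zero>\<^bsub>R\<^esub>, \<zero>\<^bsub>R\<^esub>, \<zero>\<^bsub>R\<^esub>)"
  "(a, b, c, d) \<oplus>\<^bsub>mat2 R\<^esub> (a', b', c', d') =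
    (a \<oplus>\<^bsub>R\<^esub> a', b \<oplus>\<^bsub>R\<^esub> b', c \<oplus>\<^bsub>R\<^esub> c', d \<oplus>\<^bsub>R\<^esub> d')"
  "(a, b, c, d) \<otimes>\<^bsub>mat2 R\<^esub> (a', b', c', d') =
    (a \<otimes>\<^bsub>R\<^esub> a' \<oplus>\<^bsub>R\<^esub> b \<otimes>\<^bsub>R\<^esub> c', a \<otimes>\<^bsub>R\<^esub> b' \<oplus>\<^bsub>R\<^esub> b \<otimes>\<^bsub>R\<^esub> d',
     c \<otimes>\<^bsub>R\<^esub> a' \<oplus>\<^bsub>R\<^esub> d \<otimes>\<^bsub>R\<^esub> c', c \<otimes>\<^bsub>R\<^esub> b' \<oplus>\<^bsub>R\<^esub> d \<otimes>\<^bsub>R\<^esub> d')"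
  by (simp_all add: mat2_def SL2_def)

lemma SL2_mult_one: "monoid.mult (SL2 R) = monoid.mult (mat2 R)" "monoid.one (SL2 R) = monoid.one (mat2 R)"
  by (simp_all add: mat2_def)

lemma mat2_ring:
  fixes R (structure)
  assumes "cring R" shows "ring (mat2 R)"
proof -
  interpret cring R by fact
  show ?thesis
  proof (rule ringI)
    show "abelian_group (mat2 R)"
    proof (rule abelian_groupI)
      fix x assume "x \<in> carrier (mat2 R)"
      then obtain a b c d where x: "x = (a, b, c, d)" "a \<in> carrier R" "b \<in> carrier R" "c \<in> carrier R" "d \<in> carrier R"
        by auto
      then show "\<exists>y\<in>carrier (mat2 R). y \<oplus>\<^bsub>mat2 R\<^esub> x = \<zero>\<^bsub>mat2 R\<^esub>"
        by (intro bexI[of _ "(\<ominus> a, \<ominus> b, \<ominus> c, \<ominus> d)"]) (auto simp: l_neg)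
    qed (auto simp: a_ac)
    show "Group.monoid (mat2 R)"
      by (rule monoidI) (auto simp: l_distr r_distr m_assoc a_ac)
  qed (auto simp: l_distr r_distr a_ac)
qed

section \<open>Coefficients of truncated polynomials\<close>

locale trunc_field = field F for F (structure) +
  fixes n :: nat
  assumes n_pos: "1 \<le> n" and charF: "x \<in> carrier F \<Longrightarrow> x \<oplus> x = \<zero>"
begin

abbreviation TR where "TR \<equiv> trunc_poly_ring F n"
abbreviation tc where "tc \<equiv> trunc_coeff F"
abbreviation cls where "cls \<equiv> a_r_coset (UP F) (trunc_ideal F n)"

lemmas F_finsum_cong = finsum_cong' and F_finsum_zero = finsum_zero
  and F_finsum_singleton = finsum_singleton and F_r_neg = r_neg

lemma UPF: "UP_cring F"
  by (simp add: UP_cring_def is_cring)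

lemma trunc_ideal_ideal: "ideal (trunc_ideal F n) (UP F)"
proof -
  interpret UP_cring F "UP F" by (rule UPF)
  show ?thesis unfolding trunc_ideal_def by (rule P.cgenideal_ideal) simp
qed

lemma TR_cring: "cring TR"
proof -
  interpret UP_cring F "UP F" by (rule UPF)
  show ?thesis unfolding trunc_poly_ring_def
    by (rule ideal.quotient_is_cring[OF trunc_ideal_ideal]) (rule UP_cring)
qed

sublocale TR: cring TR by (rule TR_cring)

lemma cls_hom: "cls \<in> ring_hom (UP F) TR"
  unfolding trunc_poly_ring_def by (rule ideal.rcos_ring_hom[OF trunc_ideal_ideal])

lemma TR_E:
  assumes "A \<in> carrier TR" obtains p where "p \<in> carrier (UP F)" "A = cls p"
  using assms by (auto simp: trunc_poly_ring_def FactRing_def A_RCOSETS_def')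

lemma cls_closed: "p \<in> carrier (UP F) \<Longrightarrow> cls p \<in> carrier TR"
  using cls_hom by (rule ring_hom_closed)

lemma tc_cls: "p \<in> carrier (UP F) \<Longrightarrow> i < n \<Longrightarrow> tc (cls p) i = coeff (UP F) p i"
  by (rule trunc_coeff_rcos) (rule is_cring)

lemma tc_closed [simp]: "A \<in> carrier TR \<Longrightarrow> i < n \<Longrightarrow> tc A i \<in> carrier F"
proof -
  interpret UP_cring F "UP F" by (rule UPF)
  show "A \<in> carrier TR \<Longrightarrow> i < n \<Longrightarrow> tc A i \<in> carrier F"
    by (elim TR_E) (simp add: tc_cls)
qed

lemma tc_add [simp]:
  assumes "A \<in> carrier TR" "B \<in> carrier TR" "i < n"
  shows "tc (A \<oplus>\<^bsub>TR\<^esub> B) i = tc A i \<oplus> tc B i"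
proof -
  interpret UP_cring F "UP F" by (rule UPF)
  from assms obtain p r where p: "p \<in> carrier (UP F)" "A = cls p" "r \<in> carrier (UP F)" "B = cls r"
    by (metis TR_E)
  then have "A \<oplus>\<^bsub>TR\<^esub> B = cls (p \<oplus>\<^bsub>UP F\<^esub> r)" using ring_hom_add[OF cls_hom] by simp
  then show ?thesis using p assms(3) by (simp add: tc_cls)
qed

lemma tc_mult:
  assumes "A \<in> carrier TR" "B \<in> carrier TR" "i < n"
  shows "tc (A \<otimes>\<^bsub>TR\<^esub> B) i = (\<Oplus>j\<in>{..i}. tc A j \<otimes> tc B (i - j))"
proof -
  interpret UP_cring F "UP F" by (rule UPF)
  from assms obtain p r where p: "p \<in> carrier (UP F)" "A = cls p" "r \<in> carrier (UP F)" "B = cls r"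
    by (metis TR_E)
  then have "A \<otimes>\<^bsub>TR\<^esub> B = cls (p \<otimes>\<^bsub>UP F\<^esub> r)" using ring_hom_mult[OF cls_hom] by simp
  then have "tc (A \<otimes>\<^bsub>TR\<^esub> B) i = (\<Oplus>j\<in>{..i}. coeff (UP F) p j \<otimes> coeff (UP F) r (i - j))"
    using p assms(3) by (simp add: tc_cls)
  also have "\<dots> = (\<Oplus>j\<in>{..i}. tc A j \<otimes> tc B (i - j))"
    by (rule F_finsum_cong) (use p assms(3) in \<open>auto simp: tc_cls\<close>)
  finally show ?thesis .
qed

lemma tc_zero [simp]: "i < n \<Longrightarrow> tc \<zero>\<^bsub>TR\<^esub> i = \<zero>"
proof -
  interpret UP_cring F "UP F" by (rule UPF)
  have "cls \<zero>\<^bsub>UP F\<^esub> = \<zero>\<^bsub>TR\<^esub>"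
    using ring_hom_zero[OF cls_hom] P.ring_axioms TR.ring_axioms by blast
  then show "i < n \<Longrightarrow> tc \<zero>\<^bsub>TR\<^esub> i = \<zero>" by (metis tc_cls P.zero_closed coeff_zero)
qed

lemma tc_one: "i < n \<Longrightarrow> tc \<one>\<^bsub>TR\<^esub> i = (if i = 0 then \<one> else \<zero>)"
proof -
  interpret UP_cring F "UP F" by (rule UPF)
  have "cls \<one>\<^bsub>UP F\<^esub> = \<one>\<^bsub>TR\<^esub>" using ring_hom_one[OF cls_hom] .
  then show "i < n \<Longrightarrow> tc \<one>\<^bsub>TR\<^esub> i = (if i = 0 then \<one> else \<zero>)" by (metis tc_cls P.one_closed coeff_one)
qed

text \<open>A polynomial without coefficients below \<open>n\<close> is a multiple of the
  \<open>n\<close>-th power of the variable, so representatives agreeing below \<open>n\<close>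
  differ by an element of the ideal.\<close>

lemma tc_inject:
  assumes "A \<in> carrier TR" "B \<in> carrier TR" "\<And>i. i < n \<Longrightarrow> tc A i = tc B i"
  shows "A = B"
proof -
  interpret UP_cring F "UP F" by (rule UPF)
  interpret I: ideal "trunc_ideal F n" "UP F" by (rule trunc_ideal_ideal)
  from assms obtain p r where p: "p \<in> carrier (UP F)" "A = cls p" "r \<in> carrier (UP F)" "B = cls r"
    by (metis TR_E)
  define d where "d = p \<ominus>\<^bsub>UP F\<^esub> r"
  have d: "d \<in> carrier (UP F)" using p by (simp add: d_def)
  have d0: "coeff (UP F) d i = \<zero>" if "i < n" for i
  proof -
    have "coeff (UP F) p i = coeff (UP F) r i" using assms(3)[OF that] p that by (simp add: tc_cls)
    then show ?thesis using p by (simp add: d_def a_minus_def F_r_neg)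
  qed
  \<comment> \<open>The quotient of \<open>d\<close> by the \<open>n\<close>-th power of the
    variable: coefficients shifted down by \<open>n\<close>.\<close>
  define s where "s = (\<lambda>i. coeff (UP F) d (i + n))"
  have "d \<in> up F" using d by (simp add: UP_def)
  then obtain m where "bound \<zero> m d" using bound_upD by blast
  then have m: "bound \<zero> m (coeff (UP F) d)" using \<open>d \<in> up F\<close> by (simp add: UP_def)
  have s: "s \<in> up F"
    unfolding s_def by (rule mem_upI) (use d bound.bound[OF m] in \<open>auto intro!: exI[of _ m]\<close>)
  then have s': "s \<in> carrier (UP F)" by (simp add: UP_def)
  have cs: "coeff (UP F) s i = coeff (UP F) d (i + n)" for i
    using s by (simp add: UP_def s_def)
  have "s \<otimes>\<^bsub>UP F\<^esub> monom (UP F) \<one> n = d"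
  proof (rule up_eqI)
    fix i
    have "coeff (UP F) (s \<otimes>\<^bsub>UP F\<^esub> monom (UP F) \<one> n) i = (\<Oplus>j\<in>{..i}. coeff (UP F) s j \<otimes> (if n = i - j then \<one> else \<zero>))"
      using s' by simp
    also have "\<dots> = (\<Oplus>j\<in>{..i}. if i - n = j \<and> n \<le> i then coeff (UP F) s j else \<zero>)"
      by (rule F_finsum_cong) (use s' d0 in \<open>auto\<close>)
    also have "\<dots> = coeff (UP F) d i"
    proof (cases "n \<le> i")
      case True
      then have "(\<Oplus>j\<in>{..i}. if i - n = j \<and> n \<le> i then coeff (UP F) s j else \<zero>) = (\<Oplus>j\<in>{..i}. if i - n = j then coeff (UP F) s j else \<zero>)"
        by simp
      also have "\<dots> = coeff (UP F) s (i - n)"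
        by (rule F_finsum_singleton) (use s' in auto)
      finally show ?thesis using True by (simp add: cs)
    next
      case False
      then show ?thesis using d0 by (simp add: F_finsum_zero)
    qed
    finally show "coeff (UP F) (s \<otimes>\<^bsub>UP F\<^esub> monom (UP F) \<one> n) i = coeff (UP F) d i" .
  qed (use s' d in auto)
  then have "d \<in> trunc_ideal F n" unfolding trunc_ideal_def cgenideal_def using s' by auto
  then have "p \<in> cls r"
    unfolding d_def a_minus_def using p I.a_rcos_module by simp
  then show ?thesis using p I.a_repr_independence'[of p r] by simp
qed

definition tpoly :: "(nat \<Rightarrow> 'a) \<Rightarrow> (nat \<Rightarrow> 'a) set" where
  "tpoly f = cls (\<lambda>i. if i < n then f i else \<zero>)"

lemma tpoly:
  assumes "\<And>i. i < n \<Longrightarrow> f i \<in> carrier F"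
  shows "tpoly f \<in> carrier TR" "i < n \<Longrightarrow> tc (tpoly f) i = f i"
proof -
  let ?p = "\<lambda>i. if i < n then f i else \<zero>"
  have u: "?p \<in> up F" by (rule mem_upI) (use assms in \<open>auto intro!: exI[of _ n]\<close>)
  then have c: "?p \<in> carrier (UP F)" by (simp add: UP_def)
  show "tpoly f \<in> carrier TR" unfolding tpoly_def by (rule cls_closed[OF c])
  show "tc (tpoly f) i = f i" if "i < n"
    unfolding tpoly_def using tc_cls[OF c that] u that by (simp add: UP_def)
qed

text \<open>The class of \<open>t\<close>; it is the zero class when \<open>n = 1\<close>.\<close>

definition var where "var = tpoly (\<lambda>i. if i = 1 then \<one> else \<zero>)"

lemma var_closed [simp]: "var \<in> carrier TR"
  unfolding var_def by (rule tpoly) auto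

lemma tc_var_mult:
  assumes "A \<in> carrier TR" "i < n"
  shows "tc (var \<otimes>\<^bsub>TR\<^esub> A) i = (if i = 0 then \<zero> else tc A (i - 1))"
proof -
  have "tc (var \<otimes>\<^bsub>TR\<^esub> A) i = (\<Oplus>j\<in>{..i}. if 1 = j then tc A (i - j) else \<zero>)"
    unfolding tc_mult[OF var_closed assms]
    by (rule finsum_cong') (use assms in \<open>auto simp: var_def tpoly(2)\<close>)
  also have "\<dots> = (if i = 0 then \<zero> else tc A (i - 1))"
  proof (cases "i = 0")
    case False
    then show ?thesis using finsum_singleton[of 1 "{..i}" "\<lambda>j. tc A (i - j)"] assms by auto
  qed simp
  finally show ?thesis .
qed

lemma tc_var_pow_mult:
  assumes "A \<in> carrier TR" "i < n"
  shows "tc (var [^]\<^bsub>TR\<^esub> (k::nat) \<otimes>\<^bsub>TR\<^esub> A) i = (if i < k then \<zero> else tc A (i - k))"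
  using assms
proof (induction k arbitrary: i)
  case (Suc k)
  have "var [^]\<^bsub>TR\<^esub> Suc k \<otimes>\<^bsub>TR\<^esub> A = var \<otimes>\<^bsub>TR\<^esub> (var [^]\<^bsub>TR\<^esub> k \<otimes>\<^bsub>TR\<^esub> A)"
    using Suc.prems by (simp add: TR.m_ac)
  then show ?case using Suc by (auto simp: tc_var_mult)
qed simp

text \<open>The cofactor is the shifted coefficient sequence, filled up with zeros where the
  truncation has erased the coefficients of \<open>A\<close>.\<close>

lemma var_pow_factor:
  assumes "A \<in> carrier TR" "\<And>i. i < k \<Longrightarrow> i < n \<Longrightarrow> tc A i = \<zero>"
  obtains B where "B \<in> carrier TR" "A = var [^]\<^bsub>TR\<^esub> (k::nat) \<otimes>\<^bsub>TR\<^esub> B"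
proof -
  define f where "f = (\<lambda>i. if i + k < n then tc A (i + k) else \<zero>)"
  have f: "f i \<in> carrier F" if "i < n" for i using assms(1) by (auto simp: f_def)
  have "A = var [^]\<^bsub>TR\<^esub> k \<otimes>\<^bsub>TR\<^esub> tpoly f"
  proof (rule tc_inject)
    fix i assume i: "i < n"
    show "tc A i = tc (var [^]\<^bsub>TR\<^esub> k \<otimes>\<^bsub>TR\<^esub> tpoly f) i"
    proof (cases "i < k")
      case False
      then have "tc (tpoly f) (i - k) = f (i - k)" using i by (intro tpoly(2) f) auto
      then show ?thesis using False i tpoly(1)[OF f] by (simp add: tc_var_pow_mult f_def)
    qed (use i assms tpoly(1)[OF f] in \<open>simp add: tc_var_pow_mult\<close>)
  qed (use assms tpoly(1)[OF f] in simp_all)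
  moreover have "tpoly f \<in> carrier TR" by (rule tpoly(1), rule f)
  ultimately show ?thesis using that by metis
qed

section \<open>Matrices as a filtered ring and their coefficients\<close>

abbreviation SLn where "SLn \<equiv> SL2_trunc F n"
abbreviation MR where "MR \<equiv> mat2 TR"

definition svar where "svar = (var, \<zero>\<^bsub>TR\<^esub>, \<zero>\<^bsub>TR\<^esub>, var)"

lemma TR_char2: "x \<in> carrier TR \<Longrightarrow> x \<oplus>\<^bsub>TR\<^esub> x = \<zero>\<^bsub>TR\<^esub>"
  by (rule tc_inject) (auto simp: charF)

lemma TR_minus: "x \<in> carrier TR \<Longrightarrow> \<ominus>\<^bsub>TR\<^esub> x = x"
  using TR_char2 TR.minus_equality by blast

lemma MR_filtered: "filtered_ring MR svar"
proof -
  interpret M: ring MR by (rule mat2_ring[OF TR_cring])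
  show ?thesis
    by unfold_locales (auto simp: svar_def TR_char2 TR.m_comm)
qed

sublocale M: filtered_ring MR svar by (rule MR_filtered)

lemma SLn_group: "group SLn"
  unfolding SL2_trunc_def by (rule SL2_group[OF TR_cring])

sublocale SL: group SLn by (rule SLn_group)

lemma SLn_mult [simp]: "monoid.mult SLn = monoid.mult MR" "monoid.one SLn = monoid.one MR"
  by (simp_all add: SL2_trunc_def SL2_mult_one)

lemma SLn_carrier_iff: "(a, b, c, d) \<in> carrier SLn \<longleftrightarrow> a \<in> carrier TR \<and> b \<in> carrier TR \<and> c \<in> carrier TR \<and> d \<in> carrier TR
   \<and> a \<otimes>\<^bsub>TR\<^esub> d \<oplus>\<^bsub>TR\<^esub> b \<otimes>\<^bsub>TR\<^esub> c = \<one>\<^bsub>TR\<^esub>"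
    by (simp add: SL2_trunc_def SL2_def a_minus_def TR_minus cong: conj_cong)

lemma SLn_MR: "x \<in> carrier SLn \<Longrightarrow> x \<in> carrier MR"
  by (cases x) (auto simp: SLn_carrier_iff)

lemma svar_pow: "svar [^]\<^bsub>MR\<^esub> (k::nat) = (var [^]\<^bsub>TR\<^esub> k, \<zero>\<^bsub>TR\<^esub>, \<zero>\<^bsub>TR\<^esub>, var [^]\<^bsub>TR\<^esub> k)"
  by (induction k) (auto simp: svar_def)

definition mcoeff :: "(nat \<Rightarrow> 'a) set \<times> (nat \<Rightarrow> 'a) set \<times> (nat \<Rightarrow> 'a) set \<times> (nat \<Rightarrow> 'a) set \<Rightarrow> nat \<Rightarrow> 'a \<times> 'a \<times> 'a \<times> 'a" where
  "mcoeff = (\<lambda>(a, b, c, d) i. (tc a i, tc b i, tc c i, tc d i))"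

lemma mcoeff_closed: "x \<in> carrier MR \<Longrightarrow> i < n \<Longrightarrow> mcoeff x i \<in> carrier (mat2 F)"
  by (auto simp: mcoeff_def)

lemma mcoeff_add: "x \<in> carrier MR \<Longrightarrow> y \<in> carrier MR \<Longrightarrow> i < n \<Longrightarrow>
    mcoeff (x \<oplus>\<^bsub>MR\<^esub> y) i = mcoeff x i \<oplus>\<^bsub>mat2 F\<^esub> mcoeff y i"
  by (cases x; cases y) (auto simp: mcoeff_def)

lemma mcoeff_one: "i < n \<Longrightarrow> mcoeff \<one>\<^bsub>MR\<^esub> i = (if i = 0 then \<one>\<^bsub>mat2 F\<^esub> else \<zero>\<^bsub>mat2 F\<^esub>)"
  by (auto simp: mcoeff_def tc_one)

lemma mcoeff_svar_mult: "x \<in> carrier MR \<Longrightarrow> i < n \<Longrightarrow>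
    mcoeff (svar [^]\<^bsub>MR\<^esub> k \<otimes>\<^bsub>MR\<^esub> x) i = (if i < k then \<zero>\<^bsub>mat2 F\<^esub> else mcoeff x (i - k))"
  by (cases x) (auto simp: mcoeff_def svar_pow tc_var_pow_mult)

lemma mcoeff_inject: "x \<in> carrier MR \<Longrightarrow> y \<in> carrier MR \<Longrightarrow> (\<And>i. i < n \<Longrightarrow> mcoeff x i = mcoeff y i) \<Longrightarrow> x = y"
  by (cases x; cases y) (simp add: mcoeff_def tc_inject)

lemma F_add_eq_zero: "x \<in> carrier F \<Longrightarrow> y \<in> carrier F \<Longrightarrow> x \<oplus> y = \<zero> \<longleftrightarrow> x = y"
  by (metis charF minus_equality minus_minus)

text \<open>The bridge from abstract congruences to coefficients, entry by entry through
  \<open>var_pow_factor\<close>. For \<open>n \<le> k\<close> the right side concerns all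
  coefficients, so the congruence is equality; this is how a word is finally recognised as
  exact.\<close>

lemma cong_iff_mcoeff:
  assumes "x \<in> carrier MR" "y \<in> carrier MR"
  shows "M.cong_s k x y \<longleftrightarrow> (\<forall>i<k. i < n \<longrightarrow> mcoeff x i = mcoeff y i)"
proof -
  have iff: "mcoeff (x \<oplus>\<^bsub>MR\<^esub> y) i = \<zero>\<^bsub>mat2 F\<^esub> \<longleftrightarrow> mcoeff x i = mcoeff y i" if "i < n" for i
    using assms that by (cases x; cases y) (auto simp: mcoeff_def F_add_eq_zero)
  show ?thesis
  proof
    assume "M.cong_s k x y"
    then obtain w where "w \<in> carrier MR" "x \<oplus>\<^bsub>MR\<^esub> y = svar [^]\<^bsub>MR\<^esub> k \<otimes>\<^bsub>MR\<^esub> w"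
      by (auto simp: M.cong_s_def)
    then show "\<forall>i<k. i < n \<longrightarrow> mcoeff x i = mcoeff y i"
      using iff mcoeff_svar_mult by metis
  next
    assume *: "\<forall>i<k. i < n \<longrightarrow> mcoeff x i = mcoeff y i"
    obtain a b c d where z: "x \<oplus>\<^bsub>MR\<^esub> y = (a, b, c, d)" by (cases "x \<oplus>\<^bsub>MR\<^esub> y")
    have "(a, b, c, d) \<in> carrier MR" unfolding z[symmetric] using assms by (rule M.add.m_closed)
    then have abcd: "a \<in> carrier TR" "b \<in> carrier TR" "c \<in> carrier TR" "d \<in> carrier TR" by auto
    have 0: "tc a i = \<zero>" "tc b i = \<zero>" "tc c i = \<zero>" "tc d i = \<zero>" if "i < k" "i < n" for i
      using iff[OF that(2)] * that unfolding z by (auto simp: mcoeff_def)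
    obtain a' b' c' d' where *: "a' \<in> carrier TR" "a = var [^]\<^bsub>TR\<^esub> k \<otimes>\<^bsub>TR\<^esub> a'"
        "b' \<in> carrier TR" "b = var [^]\<^bsub>TR\<^esub> k \<otimes>\<^bsub>TR\<^esub> b'"
        "c' \<in> carrier TR" "c = var [^]\<^bsub>TR\<^esub> k \<otimes>\<^bsub>TR\<^esub> c'"
        "d' \<in> carrier TR" "d = var [^]\<^bsub>TR\<^esub> k \<otimes>\<^bsub>TR\<^esub> d'"
      using abcd 0 by (metis var_pow_factor)
    have "x \<oplus>\<^bsub>MR\<^esub> y = svar [^]\<^bsub>MR\<^esub> k \<otimes>\<^bsub>MR\<^esub> (a', b', c', d')"
      unfolding z using * by (simp add: svar_pow)
    moreover have "(a', b', c', d') \<in> carrier MR" using * by simp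
    ultimately show "M.cong_s k x y" unfolding M.cong_s_def using assms by blast
  qed
qed

definition cst :: "'a \<Rightarrow> (nat \<Rightarrow> 'a) set" where
  "cst a = tpoly (\<lambda>i. if i = 0 then a else \<zero>)"

definition mcst :: "'a \<times> 'a \<times> 'a \<times> 'a \<Rightarrow> _" where
  "mcst = (\<lambda>(a, b, c, d). (cst a, cst b, cst c, cst d))"

lemma cst [simp]:
  assumes "a \<in> carrier F"
  shows "cst a \<in> carrier TR" "i < n \<Longrightarrow> tc (cst a) i = (if i = 0 then a else \<zero>)"
  unfolding cst_def using tpoly(1)[of "\<lambda>i. if i = 0 then a else \<zero>"]
    tpoly(2)[of "\<lambda>i. if i = 0 then a else \<zero>" i] assms by auto

lemma mcst_closed: "X \<in> carrier (mat2 F) \<Longrightarrow> mcst X \<in> carrier MR"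
  by (cases X) (simp add: mcst_def)

lemma mcst_mcoeff: "X \<in> carrier (mat2 F) \<Longrightarrow> i < n \<Longrightarrow> mcoeff (mcst X) i = (if i = 0 then X else \<zero>\<^bsub>mat2 F\<^esub>)"
  by (cases X) (simp add: mcst_def mcoeff_def)

lemma mcst_add:
  assumes "X \<in> carrier (mat2 F)" "Y \<in> carrier (mat2 F)"
  shows "mcst (X \<oplus>\<^bsub>mat2 F\<^esub> Y) = mcst X \<oplus>\<^bsub>MR\<^esub> mcst Y"
proof -
  interpret MF: ring "mat2 F" by (rule mat2_ring[OF is_cring])
  show ?thesis
    by (rule mcoeff_inject) (use assms mcst_closed M.add.m_closed MF.add.m_closed in \<open>auto simp: mcoeff_add mcst_mcoeff simp del: mat2_simps\<close>)
qed

lemma cst_mult: "a \<in> carrier F \<Longrightarrow> b \<in> carrier F \<Longrightarrow> cst (a \<otimes> b) = cst a \<otimes>\<^bsub>TR\<^esub> cst b"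
proof (rule tc_inject)
  fix i assume *: "a \<in> carrier F" "b \<in> carrier F" "i < n"
  have "tc (cst a \<otimes>\<^bsub>TR\<^esub> cst b) i = (\<Oplus>j\<in>{..i}. if 0 = j then a \<otimes> tc (cst b) i else \<zero>)"
    using * by (subst tc_mult, simp, simp, simp) (rule finsum_cong', auto)
  also have "\<dots> = a \<otimes> tc (cst b) i"
    using * finsum_singleton[of 0 "{..i}" "\<lambda>_. a \<otimes> tc (cst b) i"] by auto
  finally show "tc (cst (a \<otimes> b)) i = tc (cst a \<otimes>\<^bsub>TR\<^esub> cst b) i" using * by simp
qed auto

lemma cst_add: "a \<in> carrier F \<Longrightarrow> b \<in> carrier F \<Longrightarrow> cst (a \<oplus> b) = cst a \<oplus>\<^bsub>TR\<^esub> cst b"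
  by (rule tc_inject) auto

lemma mcst_mult:
  assumes "X \<in> carrier (mat2 F)" "Y \<in> carrier (mat2 F)"
  shows "mcst (X \<otimes>\<^bsub>mat2 F\<^esub> Y) = mcst X \<otimes>\<^bsub>MR\<^esub> mcst Y"
  using assms by (cases X; cases Y) (simp add: mcst_def cst_mult cst_add)

lemma leading_iff:
  assumes "x \<in> carrier MR" "X \<in> carrier (mat2 F)" "1 \<le> k"
  shows "M.leading k (mcst X) x \<longleftrightarrow>
    (\<forall>i\<le>k. i < n \<longrightarrow> mcoeff x i = (if i = 0 then \<one>\<^bsub>mat2 F\<^esub> else if i = k then X else \<zero>\<^bsub>mat2 F\<^esub>))"
proof -
  interpret MF: ring "mat2 F" by (rule mat2_ring[OF is_cring])
  have c: "svar [^]\<^bsub>MR\<^esub> k \<otimes>\<^bsub>MR\<^esub> mcst X \<in> carrier MR"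
    using assms mcst_closed M.m_closed M.nat_pow_closed M.s_closed by blast
  have "mcoeff (\<one>\<^bsub>MR\<^esub> \<oplus>\<^bsub>MR\<^esub> svar [^]\<^bsub>MR\<^esub> k \<otimes>\<^bsub>MR\<^esub> mcst X) i = (if i = 0 then \<one>\<^bsub>mat2 F\<^esub> else if i = k then X else \<zero>\<^bsub>mat2 F\<^esub>)"
    if "i \<le> k" "i < n" for i
    unfolding mcoeff_add[OF M.one_closed c that(2)] using that assms
    by (auto simp: mcoeff_svar_mult[OF mcst_closed] mcst_mcoeff mcoeff_one simp del: mat2_simps)
  then show ?thesis
    by (subst cong_iff_mcoeff[OF assms(1) M.add.m_closed[OF M.one_closed c]]) (auto simp: less_Suc_eq_le)
qed

lemma almost_scalar_one_iff:
  assumes "x \<in> carrier MR" "X \<in> carrier (mat2 F)"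
  shows "M.almost_scalar 1 (mcst X) x \<longleftrightarrow>
    (\<forall>i\<le>2. i < n \<longrightarrow> mcoeff x i = (if i \<le> 1 then \<one>\<^bsub>mat2 F\<^esub> else X))"
proof -
  interpret MF: ring "mat2 F" by (rule mat2_ring[OF is_cring])
  have c: "svar [^]\<^bsub>MR\<^esub> (2 * 1 :: nat) \<otimes>\<^bsub>MR\<^esub> mcst X \<in> carrier MR" "svar [^]\<^bsub>MR\<^esub> (1::nat) \<in> carrier MR"
    using assms mcst_closed M.m_closed M.nat_pow_closed M.s_closed by blast+
  have s: "mcoeff (svar [^]\<^bsub>MR\<^esub> (1::nat)) i = (if i = 1 then \<one>\<^bsub>mat2 F\<^esub> else \<zero>\<^bsub>mat2 F\<^esub>)" if "i < n" for i
    using mcoeff_svar_mult[OF M.one_closed that, of 1] mcoeff_one[of "i - 1"] that unfolding M.r_one[OF c(2)] by auto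
  have "mcoeff (\<one>\<^bsub>MR\<^esub> \<oplus>\<^bsub>MR\<^esub> svar [^]\<^bsub>MR\<^esub> (1::nat) \<oplus>\<^bsub>MR\<^esub> svar [^]\<^bsub>MR\<^esub> (2 * 1 :: nat) \<otimes>\<^bsub>MR\<^esub> mcst X) i = (if i \<le> 1 then \<one>\<^bsub>mat2 F\<^esub> else X)"
    if "i \<le> 2" "i < n" for i
    unfolding mcoeff_add[OF M.add.m_closed[OF M.one_closed c(2)] c(1) that(2)] mcoeff_add[OF M.one_closed c(2) that(2)]
      s[OF that(2)] mcoeff_svar_mult[OF mcst_closed[OF assms(2)] that(2)] mcoeff_one[OF that(2)]
    using that assms
    by (auto simp: mcst_mcoeff simp del: mat2_simps)
  then show ?thesis
    by (subst cong_iff_mcoeff[OF assms(1) M.add.m_closed[OF M.add.m_closed[OF M.one_closed c(2)] c(1)]]) (auto simp: less_Suc_eq_le)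
qed

end

section \<open>Words with prescribed leading terms\<close>

lemma word_value_simps [simp]: "word_value G [] = \<one>\<^bsub>G\<^esub>" "word_value G (x # xs) = x \<otimes>\<^bsub>G\<^esub> word_value G xs"
  by (simp_all add: word_value_def)

lemma (in group) word_value_closed [simp]: "set xs \<subseteq> carrier G \<Longrightarrow> word_value G xs \<in> carrier G"
  by (induction xs) auto

lemma (in group) word_value_append:
  "set xs \<subseteq> carrier G \<Longrightarrow> set ys \<subseteq> carrier G \<Longrightarrow> word_value G (xs @ ys) = word_value G xs \<otimes> word_value G ys"
  by (induction xs) (auto simp: m_assoc)

lemma (in group) word_value_replicate:
  "set xs \<subseteq> carrier G \<Longrightarrow> word_value G (concat (replicate k xs)) = word_value G xs [^] k"
proof (induction k)
  case (Suc k)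
  then have "word_value G (concat (replicate (Suc k) xs)) = word_value G xs \<otimes> word_value G xs [^] k"
    by (simp, subst word_value_append) auto
  then show ?case using Suc.prems by (simp only: nat_pow_Suc2 word_value_closed)
qed simp

text \<open>In a finite group the inverse of \<open>h\<close> is the positive power with exponent
  \<open>order G - 1\<close>, so generators generate by positive words as well.\<close>

lemma (in group) generate_positive_word:
  assumes "finite (carrier G)" "S \<subseteq> carrier G" "g \<in> generate G S"
  shows "\<exists>w. set w \<subseteq> S \<and> word_value G w = g"
  using assms(3)
proof (induction rule: generate.induct)
  case one
  show ?case by (rule exI[of _ "[]"]) simp
next
  case (incl h)
  then show ?case using assms(2) by (intro exI[of _ "[h]"]) auto
next
  case (inv h)
  then have h: "h \<in> carrier G" using assms(2) by auto
  have 0: "order G > 0" using assms(1) by (simp add: order_gt_0_iff_finite)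
  have "h [^] (order G - 1) \<otimes> h = h [^] order G"
    using h 0 by (metis Suc_diff_1 nat_pow_Suc)
  then have "h [^] (order G - 1) \<otimes> h = \<one>" using h by (simp add: pow_order_eq_1)
  then have "inv h = h [^] (order G - 1)" using h inv_equality by simp
  moreover have "word_value G (concat (replicate (order G - 1) [h])) = h [^] (order G - 1)"
    using h by (subst word_value_replicate) auto
  ultimately show ?case using inv by (intro exI[of _ "concat (replicate (order G - 1) [h])"]) auto
next
  case (eng h1 h2)
  then obtain w1 w2 where w: "set w1 \<subseteq> S" "word_value G w1 = h1" "set w2 \<subseteq> S" "word_value G w2 = h2" by auto
  then have "word_value G (w1 @ w2) = h1 \<otimes> h2"
    using assms(2) by (simp add: word_value_append)
  then show ?case using w by (intro exI[of _ "w1 @ w2"]) auto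
qed

text \<open>
  The words \<open>y'\<close> and \<open>h'\<close> stand for the inverses of \<open>y\<close> and \<open>h\<close>; the binary digits of \<open>m\<close>
  select the powers \<open>h\<^sup>2\<^sup>^\<^sup>p\<close> with which commutators are taken.
\<close>

function comm_word :: "nat \<Rightarrow> 'l list \<Rightarrow> 'l list \<Rightarrow> 'l list \<Rightarrow> 'l list \<Rightarrow> 'l list" where
  "comm_word m y y' h h' = (if m = 0 then y
     else if odd m then comm_word (m div 2) (y @ h @ y' @ h') (h @ y @ h' @ y') (h @ h) (h' @ h')
     else comm_word (m div 2) y y' (h @ h) (h' @ h'))"
  by auto
termination by (relation "measure fst") auto

declare comm_word.simps [simp del]

context trunc_field
begin

section \<open>Directions in the trace zero matrices and the reduction of one level\<close>

abbreviation wv where "wv \<equiv> word_value SLn"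

text \<open>The scalar matrices cannot serve as a third direction, since they commute with
  everything and no commutator fixes them. The matrix with all entries equal replaces them; like the
  other two it has trace 0 and determinant 0.\<close>

definition dirX :: "nat \<Rightarrow> 'a \<Rightarrow> 'a \<times> 'a \<times> 'a \<times> 'a" where
  "dirX d c = (if d = 0 then (\<zero>, c, \<zero>, \<zero>) else if d = 1 then (\<zero>, \<zero>, c, \<zero>) else (c, c, c, c))"

text \<open>An idempotent of trace 1 that acts as identity on \<open>dirX d c\<close> from one side
  and annihilates it from the other, so that the bracket returns \<open>dirX d c\<close>.\<close>

definition dirE :: "nat \<Rightarrow> 'a \<times> 'a \<times> 'a \<times> 'a" where
  "dirE d = (if d \<le> 1 then (\<zero>, \<zero>, \<zero>, \<one>) else (\<zero>, \<zero>, \<one>, \<one>))"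

lemma dir_closed [simp]: "c \<in> carrier F \<Longrightarrow> dirX d c \<in> carrier (mat2 F)" "dirE d \<in> carrier (mat2 F)"
  by (auto simp: dirX_def dirE_def)

lemma dirE_idem: "dirE d \<otimes>\<^bsub>mat2 F\<^esub> dirE d = dirE d"
  by (simp add: dirE_def)

lemma dir_commutator: "c \<in> carrier F \<Longrightarrow>
    dirX d c \<otimes>\<^bsub>mat2 F\<^esub> dirE d \<oplus>\<^bsub>mat2 F\<^esub> dirE d \<otimes>\<^bsub>mat2 F\<^esub> dirX d c = dirX d c"
  by (simp add: dirX_def dirE_def charF)

lemma dir_decompose:
  assumes "u \<in> carrier F" "f \<in> carrier F" "g \<in> carrier F"
  shows "dirX 2 u \<oplus>\<^bsub>mat2 F\<^esub> dirX 0 (f \<oplus> u) \<oplus>\<^bsub>mat2 F\<^esub> dirX 1 (g \<oplus> u) = (u, f, g, u)"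
proof -
  have "u \<oplus> (x \<oplus> u) = x" if "x \<in> carrier F" for x
    using assms(1) that charF by (metis a_assoc a_comm r_zero)
  then show ?thesis using assms by (simp add: dirX_def)
qed

lemma SLn_inverse:
  assumes "(a, b, c, d) \<in> carrier SLn"
  shows "inv\<^bsub>SLn\<^esub> (a, b, c, d) = (d, b, c, a)"
proof (rule SL.inv_equality)
  show "(d, b, c, a) \<in> carrier SLn" using assms by (simp add: SLn_carrier_iff TR.m_comm)
  show "(d, b, c, a) \<otimes>\<^bsub>SLn\<^esub> (a, b, c, d) = \<one>\<^bsub>SLn\<^esub>"
    using assms by (simp add: SLn_carrier_iff TR.m_comm TR_char2 TR.a_comm)
qed fact

text \<open>The power is congruent to 1 modulo the \<open>2 ^ K\<close>-th power of the variable,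
  and \<open>n \<le> 2 ^ K\<close> turns this congruence into equality.\<close>

lemma cong_one_power:
  assumes "x \<in> carrier SLn" "M.cong_s 1 x \<one>\<^bsub>MR\<^esub>" "n \<le> 2 ^ K"
  shows "x [^]\<^bsub>SLn\<^esub> (2 ^ K :: nat) = \<one>\<^bsub>SLn\<^esub>"
proof -
  have p: "x [^]\<^bsub>SLn\<^esub> (k::nat) = x [^]\<^bsub>MR\<^esub> k" for k
    by (induction k) simp_all
  have x: "x \<in> carrier MR" using assms(1) by (rule SLn_MR)
  have "M.cong_s (2 ^ K) (x [^]\<^bsub>MR\<^esub> (2 ^ K :: nat)) \<one>\<^bsub>MR\<^esub>" by (rule M.pow_two_power) fact
  then have "x [^]\<^bsub>MR\<^esub> (2 ^ K :: nat) = \<one>\<^bsub>MR\<^esub>"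
    using assms(3) by (subst (asm) cong_iff_mcoeff) (auto intro!: mcoeff_inject M.nat_pow_closed[OF x] simp del: mat2_simps)
  then show ?thesis using p by simp
qed

lemma inverse_word:
  assumes "set xs \<subseteq> carrier SLn" "M.cong_s 1 (wv xs) \<one>\<^bsub>MR\<^esub>" "n \<le> 2 ^ K"
  shows "wv xs \<otimes>\<^bsub>MR\<^esub> wv (concat (replicate (2 ^ K - 1) xs)) = \<one>\<^bsub>MR\<^esub>"
proof -
  have "wv xs \<otimes>\<^bsub>SLn\<^esub> wv xs [^]\<^bsub>SLn\<^esub> (2 ^ K - 1 :: nat) = wv xs [^]\<^bsub>SLn\<^esub> Suc (2 ^ K - 1)"
    using assms(1) SL.nat_pow_Suc2[OF SL.word_value_closed] by metis
  also have "\<dots> = \<one>\<^bsub>SLn\<^esub>" using cong_one_power[OF SL.word_value_closed[OF assms(1)] assms(2,3)] by simp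
  finally show ?thesis using assms(1) by (simp add: SL.word_value_replicate)
qed

text \<open>Induction over the binary digits of \<open>m\<close>, lowest first. A digit 1 raises the
  level \<open>j\<close> by \<open>2 * i\<close>, and every digit doubles \<open>i\<close>, so the
  sum \<open>j + 2 * i * m\<close> is invariant. The inverse words are carried along: the inverse of
  \<open>y h y' h'\<close> is \<open>h y h' y'\<close>. Letters are abstract and interpreted by
  \<open>f\<close>, because the program works with addresses instead of matrices.\<close>

lemma comm_word_leading:
  assumes f: "\<And>l. f l \<in> carrier SLn"
    and ae: "a \<in> carrier MR" "e \<in> carrier MR" "a \<otimes>\<^bsub>MR\<^esub> e \<oplus>\<^bsub>MR\<^esub> e \<otimes>\<^bsub>MR\<^esub> a = a" "e \<otimes>\<^bsub>MR\<^esub> e = e"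
    and "1 \<le> i" "1 \<le> j" "M.leading j a (wv (map f y))" "M.almost_scalar i e (wv (map f h))"
    and "wv (map f y) \<otimes>\<^bsub>MR\<^esub> wv (map f y') = \<one>\<^bsub>MR\<^esub>" "wv (map f h) \<otimes>\<^bsub>MR\<^esub> wv (map f h') = \<one>\<^bsub>MR\<^esub>"
  shows "M.leading (j + 2 * i * m) a (wv (map f (comm_word m y y' h h')))"
  using assms(6-)
proof (induction m y y' h h' arbitrary: i j rule: comm_word.induct)
  case (1 m y y' h h')
  let ?v = "\<lambda>xs. wv (map f xs)"
  have app: "?v (xs @ ys) = ?v xs \<otimes>\<^bsub>MR\<^esub> ?v ys" for xs ys
    using f by (simp add: SL.word_value_append image_subset_iff flip: SLn_mult)
  have cl: "?v xs \<in> carrier SLn" for xs using f by (simp add: image_subset_iff)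
  have clM: "?v xs \<in> carrier MR" for xs using SLn_MR[OF cl] .
  have comm: "?v xs \<otimes>\<^bsub>MR\<^esub> ?v ys = \<one>\<^bsub>MR\<^esub> \<Longrightarrow> ?v ys \<otimes>\<^bsub>MR\<^esub> ?v xs = \<one>\<^bsub>MR\<^esub>" for xs ys
    using SL.inv_comm[OF _ cl cl, of xs ys] by simp
  note y' = comm[OF 1(7)] and h' = comm[OF 1(8)]
  have canc: "(a1 \<otimes>\<^bsub>MR\<^esub> b1) \<otimes>\<^bsub>MR\<^esub> (c1 \<otimes>\<^bsub>MR\<^esub> d1) = a1 \<otimes>\<^bsub>MR\<^esub> (b1 \<otimes>\<^bsub>MR\<^esub> c1) \<otimes>\<^bsub>MR\<^esub> d1"
    if "a1 \<in> carrier MR" "b1 \<in> carrier MR" "c1 \<in> carrier MR" "d1 \<in> carrier MR" for a1 b1 c1 d1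
    by (metis M.m_assoc M.m_closed that)
  have canc': "(a1 \<otimes>\<^bsub>MR\<^esub> b1) \<otimes>\<^bsub>MR\<^esub> (c1 \<otimes>\<^bsub>MR\<^esub> d1) = \<one>\<^bsub>MR\<^esub>"
    if "a1 \<in> carrier MR" "b1 \<in> carrier MR" "c1 \<in> carrier MR" "d1 \<in> carrier MR"
      "b1 \<otimes>\<^bsub>MR\<^esub> c1 = \<one>\<^bsub>MR\<^esub>" "a1 \<otimes>\<^bsub>MR\<^esub> d1 = \<one>\<^bsub>MR\<^esub>" for a1 b1 c1 d1
    by (simp only: canc[OF that(1-4)] that(5,6) M.r_one[OF that(1)])
  show ?case
  proof (cases "m = 0")
    case True
    then show ?thesis using "1.prems" by (simp add: comm_word.simps del: mat2_simps)
  next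
    case m0: False
    have h2: "M.almost_scalar (2 * i) e (?v (h @ h))"
      unfolding app by (rule M.almost_scalar_square) (use "1.prems" ae in auto)
    have hh: "?v (h @ h) \<otimes>\<^bsub>MR\<^esub> ?v (h' @ h') = \<one>\<^bsub>MR\<^esub>"
      unfolding app by (rule canc') (fact clM 1(8))+
    show ?thesis
    proof (cases "odd m")
      case False
      have "M.leading (j + 2 * (2 * i) * (m div 2)) a (?v (comm_word (m div 2) y y' (h @ h) (h' @ h')))"
        by (rule "1.IH"(2)[OF m0 False _ 1(4) 1(5) h2 1(7) hh]) (use 1(3) in simp)
      moreover have "j + 2 * (2 * i) * (m div 2) = j + 2 * i * m" using False by simp
      ultimately have "M.leading (j + 2 * i * m) a (?v (comm_word (m div 2) y y' (h @ h) (h' @ h')))" by metis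
      then show ?thesis using False m0 by (subst comm_word.simps) (simp del: mat2_simps)
    next
      case True
      let ?y = "y @ h @ y' @ h'" and ?y' = "h @ y @ h' @ y'"
      have vy: "?v ?y = ?v y \<otimes>\<^bsub>MR\<^esub> ?v h \<otimes>\<^bsub>MR\<^esub> (?v y' \<otimes>\<^bsub>MR\<^esub> ?v h')"
        unfolding app by (metis M.m_assoc M.m_closed clM)
      have vy': "?v ?y' = ?v h \<otimes>\<^bsub>MR\<^esub> ?v y \<otimes>\<^bsub>MR\<^esub> (?v h' \<otimes>\<^bsub>MR\<^esub> ?v y')"
        unfolding app by (metis M.m_assoc M.m_closed clM)
      have l: "M.leading (j + 2 * i) a (?v ?y)"
        unfolding vy
        by (rule M.leading_commutator[OF 1(5) 1(6) ae(1,2,3) 1(3,4) clM clM 1(7) y' 1(8) h'])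
      have i: "?v ?y \<otimes>\<^bsub>MR\<^esub> ?v ?y' = \<one>\<^bsub>MR\<^esub>"
        unfolding vy vy'
      proof (rule canc')
        show "?v y' \<otimes>\<^bsub>MR\<^esub> ?v h' \<otimes>\<^bsub>MR\<^esub> (?v h \<otimes>\<^bsub>MR\<^esub> ?v y) = \<one>\<^bsub>MR\<^esub>"
          by (rule canc') (fact clM h' y')+
        show "?v y \<otimes>\<^bsub>MR\<^esub> ?v h \<otimes>\<^bsub>MR\<^esub> (?v h' \<otimes>\<^bsub>MR\<^esub> ?v y') = \<one>\<^bsub>MR\<^esub>"
          by (rule canc') (fact clM 1(8) 1(7))+
      qed (intro M.m_closed clM)+
      have "M.leading (j + 2 * i + 2 * (2 * i) * (m div 2)) a (?v (comm_word (m div 2) ?y ?y' (h @ h) (h' @ h')))"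
        by (rule "1.IH"(1)[OF m0 True _ _ l h2 i hh]) (use 1(3) in auto)
      moreover have "j + 2 * i + 2 * (2 * i) * (m div 2) = j + 2 * i * m"
      proof -
        have "m = 2 * (m div 2) + 1" using True by simp
        then have "2 * i * m = 2 * i * (2 * (m div 2) + 1)" by simp
        then show ?thesis by (simp add: algebra_simps)
      qed
      ultimately have "M.leading (j + 2 * i * m) a (?v (comm_word (m div 2) ?y ?y' (h @ h) (h' @ h')))" by metis
      then show ?thesis using True m0 by (subst comm_word.simps) (simp del: mat2_simps)
    qed
  qed
qed

text \<open>Determinant 1 forces a leading coefficient of trace 0. The inverse of \<open>r\<close>
  is its adjugate, whose leading coefficient has the diagonal entries exchanged. Leading
  coefficients add in products, so the diagonal entry \<open>u \<oplus> u'\<close> of the sum is a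
  coefficient of 1 at a positive level, that is, zero.\<close>

lemma mcoeff_leading_trace:
  assumes r: "r \<in> carrier SLn" "M.cong_s k r \<one>\<^bsub>MR\<^esub>" "1 \<le> k" "k < n" "mcoeff r k = (u, f, g, u')"
  shows "u' = u"
proof -
  interpret MF: ring "mat2 F" by (rule mat2_ring[OF is_cring])
  obtain a b c d where rr: "r = (a, b, c, d)" by (cases r)
  have r': "(d, b, c, a) \<in> carrier SLn"
    using r(1) unfolding rr by (simp add: SLn_carrier_iff TR.m_comm)
  have X: "(u, f, g, u') \<in> carrier (mat2 F)" "(u', f, g, u) \<in> carrier (mat2 F)"
    using mcoeff_closed[OF SLn_MR[OF r(1)] r(4)] unfolding r(5) by auto
  have eq: "mcoeff r i = \<one>\<^bsub>mat2 F\<^esub>" if "i = 0" for i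
    using r(2-4) that SLn_MR[OF r(1)] by (subst (asm) cong_iff_mcoeff) (auto simp: mcoeff_one simp del: mat2_simps)
  have eq': "mcoeff r i = \<zero>\<^bsub>mat2 F\<^esub>" if "0 < i" "i < k" for i
    using r(2-4) that SLn_MR[OF r(1)] by (subst (asm) cong_iff_mcoeff) (auto simp: mcoeff_one simp del: mat2_simps)
  have l1: "M.leading k (mcst (u, f, g, u')) r"
    using eq eq' r(5) by (subst leading_iff[OF SLn_MR[OF r(1)] X(1) r(3)]) (auto simp: le_less simp del: mat2_simps)
  have l2: "M.leading k (mcst (u', f, g, u)) (d, b, c, a)"
    using l1 r(3,4) unfolding rr leading_iff[OF SLn_MR[OF r(1), unfolded rr] X(1) r(3)] leading_iff[OF SLn_MR[OF r'] X(2) r(3)]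
    by (auto simp: mcoeff_def)
  have "r \<otimes>\<^bsub>MR\<^esub> (d, b, c, a) = \<one>\<^bsub>MR\<^esub>"
    using r(1) SL.r_inv[of r] by (simp only: rr SLn_inverse[OF r(1)[unfolded rr]] SLn_mult)
  then have l3: "M.leading k (mcst ((u, f, g, u') \<oplus>\<^bsub>mat2 F\<^esub> (u', f, g, u))) \<one>\<^bsub>MR\<^esub>"
    using M.leading_mult[OF l1 l2 r(3) mcst_closed[OF X(1)] mcst_closed[OF X(2)]] X by (simp only: mcst_add)
  have "mcoeff \<one>\<^bsub>MR\<^esub> k = (u, f, g, u') \<oplus>\<^bsub>mat2 F\<^esub> (u', f, g, u)"
    using l3 r(3,4) leading_iff[OF M.one_closed MF.add.m_closed[OF X] r(3)] by (simp del: mat2_simps)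
  then have "\<zero> = u \<oplus> u'" using r(3,4) by (simp add: mcoeff_one del: mat2_simps(2))
  then show ?thesis using F_add_eq_zero[of u u'] X by simp
qed

text \<open>The correction has the same leading coefficient as \<open>r\<close>, not the negative
  one: in characteristic 2 the two cancel.\<close>

lemma cong_Suc_of_product:
  assumes r: "r \<in> carrier SLn" "M.cong_s k r \<one>\<^bsub>MR\<^esub>" "1 \<le> k" "k < n" "mcoeff r k = (u, f, g, u')"
    and p: "M.leading k (mcst (dirX 2 u)) p2" "M.leading k (mcst (dirX 0 (f \<oplus> u))) p0" "M.leading k (mcst (dirX 1 (g \<oplus> u))) p1"
  shows "M.cong_s (Suc k) (r \<otimes>\<^bsub>MR\<^esub> (p2 \<otimes>\<^bsub>MR\<^esub> p0 \<otimes>\<^bsub>MR\<^esub> p1)) \<one>\<^bsub>MR\<^esub>"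
proof -
  have u: "u' = u" by (rule mcoeff_leading_trace[OF r])
  have ufg: "u \<in> carrier F" "f \<in> carrier F" "g \<in> carrier F"
    using mcoeff_closed[OF SLn_MR[OF r(1)] r(4)] unfolding r(5) by auto
  then have X: "(u, f, g, u) \<in> carrier (mat2 F)" by simp
  have fu: "f \<oplus> u \<in> carrier F" "g \<oplus> u \<in> carrier F" using ufg by auto
  note D = dir_closed(1)[OF ufg(1), of 2] dir_closed(1)[OF fu(1), of 0] dir_closed(1)[OF fu(2), of 1]
  note M = mcst_closed[OF D(1)] mcst_closed[OF D(2)] mcst_closed[OF D(3)]
  have eq: "mcoeff r i = \<one>\<^bsub>mat2 F\<^esub>" if "i = 0" for i
    using r(2-4) that SLn_MR[OF r(1)] by (subst (asm) cong_iff_mcoeff) (auto simp: mcoeff_one simp del: mat2_simps)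
  have eq': "mcoeff r i = \<zero>\<^bsub>mat2 F\<^esub>" if "0 < i" "i < k" for i
    using r(2-4) that SLn_MR[OF r(1)] by (subst (asm) cong_iff_mcoeff) (auto simp: mcoeff_one simp del: mat2_simps)
  have l1: "M.leading k (mcst (u, f, g, u)) r"
    using eq eq' r(5) unfolding u by (subst leading_iff[OF SLn_MR[OF r(1)] X r(3)]) (auto simp: le_less simp del: mat2_simps)
  have "mcst (dirX 2 u) \<oplus>\<^bsub>MR\<^esub> mcst (dirX 0 (f \<oplus> u)) \<oplus>\<^bsub>MR\<^esub> mcst (dirX 1 (g \<oplus> u)) = mcst (u, f, g, u)"
  proof -
    interpret MF: ring "mat2 F" by (rule mat2_ring[OF is_cring])
    show ?thesis using D MF.add.m_closed[OF D(1,2)] by (simp only: mcst_add[symmetric] dir_decompose[OF ufg])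
  qed
  moreover have "M.leading k (mcst (dirX 2 u) \<oplus>\<^bsub>MR\<^esub> mcst (dirX 0 (f \<oplus> u)) \<oplus>\<^bsub>MR\<^esub> mcst (dirX 1 (g \<oplus> u))) (p2 \<otimes>\<^bsub>MR\<^esub> p0 \<otimes>\<^bsub>MR\<^esub> p1)"
    by (intro M.leading_mult p r(3) M M.add.m_closed)
  ultimately have "M.leading k (mcst (u, f, g, u)) (p2 \<otimes>\<^bsub>MR\<^esub> p0 \<otimes>\<^bsub>MR\<^esub> p1)" by simp
  from M.leading_mult[OF l1 this r(3) mcst_closed[OF X] mcst_closed[OF X]]
  show ?thesis by (simp add: M.char2[OF mcst_closed[OF X]] del: mat2_simps)
qed

text \<open>As \<open>dirX d c\<close> has trace 0 and determinant 0, the matrix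
  \<open>1 + t^j X\<close> has determinant exactly 1, without higher corrections.\<close>

lemma ex_leading:
  assumes "c \<in> carrier F" "1 \<le> j"
  shows "\<exists>y\<in>carrier SLn. \<forall>i<n. mcoeff y i = (if i = 0 then \<one>\<^bsub>mat2 F\<^esub> else if i = j then dirX d c else \<zero>\<^bsub>mat2 F\<^esub>)"
proof -
  interpret MF: ring "mat2 F" by (rule mat2_ring[OF is_cring])
  let ?s = "svar [^]\<^bsub>MR\<^esub> j \<otimes>\<^bsub>MR\<^esub> mcst (dirX d c)"
  let ?y = "\<one>\<^bsub>MR\<^esub> \<oplus>\<^bsub>MR\<^esub> ?s"
  have s: "?s \<in> carrier MR" by (intro M.m_closed M.nat_pow_closed M.s_closed mcst_closed dir_closed assms)
  have m: "mcoeff ?y i = (if i = 0 then \<one>\<^bsub>mat2 F\<^esub> else if i = j then dirX d c else \<zero>\<^bsub>mat2 F\<^esub>)" if "i < n" for i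
    unfolding mcoeff_add[OF M.one_closed s that] using assms that
    by (auto simp: mcoeff_one mcoeff_svar_mult[OF mcst_closed] mcst_mcoeff simp del: mat2_simps)
  have c0: "cst \<zero> = \<zero>\<^bsub>TR\<^esub>" by (rule tc_inject) simp_all
  have "?y \<in> carrier SLn"
  proof -
    let ?v = "var [^]\<^bsub>TR\<^esub> j \<otimes>\<^bsub>TR\<^esub> cst c"
    have v: "?v \<in> carrier TR" using assms by simp
    then have "(\<one>\<^bsub>TR\<^esub> \<oplus>\<^bsub>TR\<^esub> ?v) \<otimes>\<^bsub>TR\<^esub> (\<one>\<^bsub>TR\<^esub> \<oplus>\<^bsub>TR\<^esub> ?v) \<oplus>\<^bsub>TR\<^esub> ?v \<otimes>\<^bsub>TR\<^esub> ?v
        = \<one>\<^bsub>TR\<^esub> \<oplus>\<^bsub>TR\<^esub> (?v \<oplus>\<^bsub>TR\<^esub> ?v) \<oplus>\<^bsub>TR\<^esub> (?v \<otimes>\<^bsub>TR\<^esub> ?v \<oplus>\<^bsub>TR\<^esub> ?v \<otimes>\<^bsub>TR\<^esub> ?v)"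
      by (simp only: TR.l_distr TR.r_distr TR.l_one TR.r_one TR.one_closed TR.a_ac TR.a_closed TR.m_closed)
    then have "(\<one>\<^bsub>TR\<^esub> \<oplus>\<^bsub>TR\<^esub> ?v) \<otimes>\<^bsub>TR\<^esub> (\<one>\<^bsub>TR\<^esub> \<oplus>\<^bsub>TR\<^esub> ?v) \<oplus>\<^bsub>TR\<^esub> ?v \<otimes>\<^bsub>TR\<^esub> ?v = \<one>\<^bsub>TR\<^esub>"
      using v by (simp add: TR_char2)
    then show ?thesis using v cst(1)[OF assms(1)] by (simp add: svar_pow mcst_def dirX_def c0 SLn_carrier_iff)
  qed
  then show ?thesis using m by blast
qed

text \<open>The diagonal matrix with entries \<open>1 + t\<close> and its inverse
  \<open>1 + t + t^2 + ...\<close> is scalar up to \<open>t^1\<close>; the entries first differ at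
  \<open>t^2\<close>, which yields the idempotent with a single 1 in the lower right corner.\<close>

lemma ex_almost_scalar:
  "\<exists>w\<in>carrier SLn. \<forall>i<n. i \<le> 2 \<longrightarrow> mcoeff w i = (if i \<le> 1 then \<one>\<^bsub>mat2 F\<^esub> else dirE d)"
proof -
  let ?a = "\<one>\<^bsub>TR\<^esub> \<oplus>\<^bsub>TR\<^esub> var"
  define v where "v = tpoly (\<lambda>_. \<one>)"
  have v: "v \<in> carrier TR" "tc v i = \<one>" if "i < n" for i
    using tpoly[of "\<lambda>_. \<one>"] that by (auto simp: v_def)
  have v': "v \<in> carrier TR" using v(1)[of 0] n_pos by simp
  have tv: "tc var i = (if i = 1 then \<one> else \<zero>)" if "i < n" for i
    unfolding var_def using that by (subst tpoly(2)) auto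
  have av: "?a \<otimes>\<^bsub>TR\<^esub> v = \<one>\<^bsub>TR\<^esub>"
  proof (rule tc_inject)
    fix i assume i: "i < n"
    have "?a \<otimes>\<^bsub>TR\<^esub> v = v \<oplus>\<^bsub>TR\<^esub> var \<otimes>\<^bsub>TR\<^esub> v" using v' by (simp add: TR.l_distr)
    then show "tc (?a \<otimes>\<^bsub>TR\<^esub> v) i = tc \<one>\<^bsub>TR\<^esub> i"
      using i v' v by (simp add: tc_var_mult tc_one charF)
  qed (use v' in simp_all)
  \<comment> \<open>The sum \<open>?a \<oplus> v\<close> is \<open>t^2 + t^3 + ...\<close>, which
    puts the required 1 into the lower left corner at level 2 and leaves the determinant of the
    triangular matrix alone.\<close>
  define z where "z = (if d \<le> 1 then \<zero>\<^bsub>TR\<^esub> else ?a \<oplus>\<^bsub>TR\<^esub> v)"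
  have z: "z \<in> carrier TR" using v' by (simp add: z_def)
  let ?w = "(?a, \<zero>\<^bsub>TR\<^esub>, z, v)"
  have w: "?w \<in> carrier SLn"
    using av v' z by (simp add: SLn_carrier_iff)
  have "mcoeff ?w i = (if i \<le> 1 then \<one>\<^bsub>mat2 F\<^esub> else dirE d)" if "i < n" "i \<le> 2" for i
  proof -
    consider "i = 0" | "i = 1" | "i = 2" using \<open>i \<le> 2\<close> by linarith
    then show ?thesis
      using \<open>i < n\<close> v v' by cases (auto simp: mcoeff_def z_def dirE_def tc_one tv charF)
  qed
  then show ?thesis using w by blast
qed

text \<open>Partial sums of the convolution are kept as a separate argument because the program
  accumulates exactly these partial sums in its inner loop.\<close>

primrec mconv :: "(nat \<Rightarrow> 'a \<times> 'a \<times> 'a \<times> 'a) \<Rightarrow> (nat \<Rightarrow> 'a \<times> 'a \<times> 'a \<times> 'a) \<Rightarrow> nat \<Rightarrow> nat \<Rightarrow> 'a \<times> 'a \<times> 'a \<times> 'a" where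
  "mconv f g i 0 = \<zero>\<^bsub>mat2 F\<^esub>"
| "mconv f g i (Suc k) = mconv f g i k \<oplus>\<^bsub>mat2 F\<^esub> f k \<otimes>\<^bsub>mat2 F\<^esub> g (i - k)"

lemma mcoeff_mult:
  assumes "x \<in> carrier MR" "y \<in> carrier MR" "i < n"
  shows "mcoeff (x \<otimes>\<^bsub>MR\<^esub> y) i = mconv (mcoeff x) (mcoeff y) i (Suc i)"
proof -
  obtain a b c d a' b' c' d' where xy: "x = (a, b, c, d)" "y = (a', b', c', d')"
    by (cases x; cases y)
  have cl: "a \<in> carrier TR" "b \<in> carrier TR" "c \<in> carrier TR" "d \<in> carrier TR"
    "a' \<in> carrier TR" "b' \<in> carrier TR" "c' \<in> carrier TR" "d' \<in> carrier TR"
    using assms xy by auto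
  let ?s = "\<lambda>A B k. finsum F (\<lambda>j. tc A j \<otimes> tc B (i - j)) {..<k}"
  have sc: "?s A B k \<in> carrier F" if "A \<in> carrier TR" "B \<in> carrier TR" "k \<le> Suc i" for A B k
    using that assms(3) by (intro finsum_closed) auto
  have ss: "?s A B (Suc k) = ?s A B k \<oplus> tc A k \<otimes> tc B (i - k)"
    if "A \<in> carrier TR" "B \<in> carrier TR" "k \<le> i" for A B k
  proof -
    have "?s A B (Suc k) = tc A k \<otimes> tc B (i - k) \<oplus> ?s A B k"
      unfolding lessThan_Suc using that assms(3) by (subst finsum_insert) auto
    then show ?thesis using sc[OF that(1,2), of k] that assms(3) by (simp add: a_comm)
  qed
  have "mconv (mcoeff x) (mcoeff y) i k =
     (?s a a' k \<oplus> ?s b c' k, ?s a b' k \<oplus> ?s b d' k, ?s c a' k \<oplus> ?s d c' k, ?s c b' k \<oplus> ?s d d' k)" if "k \<le> Suc i" for k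
    using that
  proof (induction k)
    case (Suc k)
    have k: "k \<le> i" "k \<le> Suc i" "k < n" using Suc.prems assms(3) by auto
    show ?case
      unfolding mconv.simps Suc.IH[OF k(2)]
      using sc[OF _ _ k(2)] cl k assms(3) ss[OF _ _ k(1)] by (simp add: mcoeff_def xy a_ac)
  qed simp
  moreover have "tc (A \<otimes>\<^bsub>TR\<^esub> B) i = ?s A B (Suc i)" if "A \<in> carrier TR" "B \<in> carrier TR" for A B
    using tc_mult[OF that assms(3)] unfolding lessThan_Suc_atMost .
  ultimately show ?thesis using cl assms(3) by (simp add: xy mcoeff_def del: mconv.simps)
qed

lemma SLn_finite:
  assumes "finite (carrier F)" shows "finite (carrier SLn)"
proof -
  have "finite (carrier TR)"
  proof (rule finite_imageD)
    show "finite ((\<lambda>A. restrict (tc A) {..<n}) ` carrier TR)"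
    proof (rule finite_subset)
      show "(\<lambda>A. restrict (tc A) {..<n}) ` carrier TR \<subseteq> {..<n} \<rightarrow>\<^sub>E carrier F"
        by (rule image_subsetI) (simp only: restrict_PiE_iff, simp)
    qed (use assms in \<open>auto intro: finite_PiE\<close>)
    show "inj_on (\<lambda>A. restrict (tc A) {..<n}) (carrier TR)"
    proof (rule inj_onI)
      fix A B assume AB: "A \<in> carrier TR" "B \<in> carrier TR" "restrict (tc A) {..<n} = restrict (tc B) {..<n}"
      show "A = B" by (rule tc_inject[OF AB(1,2)]) (use AB(3) in \<open>metis lessThan_iff restrict_apply'\<close>)
    qed
  qed
  then have "finite (carrier MR)" by simp
  then show ?thesis using SLn_MR finite_subset[of "carrier SLn" "carrier MR"] by blast
qed

text \<open>The unipotent upper triangular matrices already give this many elements. The bound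
  converts polynomials in \<open>n\<close> into powers of the logarithm of the group order.\<close>

lemma SLn_order:
  assumes "finite (carrier F)" shows "2 ^ n \<le> order SLn"
proof -
  let ?P = "{..<n} \<rightarrow>\<^sub>E carrier F" and ?h = "\<lambda>f. (\<one>\<^bsub>TR\<^esub>, tpoly f, \<zero>\<^bsub>TR\<^esub>, \<one>\<^bsub>TR\<^esub>)"
  have f: "tpoly f \<in> carrier TR" "\<And>i. i < n \<Longrightarrow> tc (tpoly f) i = f i" if "f \<in> ?P" for f
  proof -
    have "\<And>i. i < n \<Longrightarrow> f i \<in> carrier F" using that by auto
    then show "tpoly f \<in> carrier TR" "\<And>i. i < n \<Longrightarrow> tc (tpoly f) i = f i" using tpoly by blast+
  qed
  have "inj_on ?h ?P"
  proof (rule inj_onI)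
    fix f g assume fg: "f \<in> ?P" "g \<in> ?P" "?h f = ?h g"
    then have "tpoly f = tpoly g" by simp
    then have "f i = g i" if "i < n" for i using f(2)[OF fg(1) that] f(2)[OF fg(2) that] by simp
    then show "f = g" using fg(1,2) by (intro PiE_ext) auto
  qed
  moreover have "?h ` ?P \<subseteq> carrier SLn"
    using f(1) by (auto simp: SLn_carrier_iff)
  ultimately have "card ?P \<le> order SLn"
    unfolding order_def using card_inj_on_le SLn_finite[OF assms] by blast
  moreover have "card ?P = card (carrier F) ^ n" by (simp add: card_PiE)
  moreover have "2 \<le> card (carrier F)"
  proof -
    have "card {\<zero>, \<one>} \<le> card (carrier F)" by (rule card_mono) (use assms in auto)
    then show ?thesis by simp
  qed
  ultimately show ?thesis using power_mono[of 2 "card (carrier F)" n] by simp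
qed

end

text \<open>Pigeonhole on suffixes: if two suffixes of a shortest word had the same value, the
  segment between their starting points could be cut out.\<close>

lemma foldr_shorten:
  assumes V: "\<And>ys. set ys \<subseteq> A \<Longrightarrow> foldr f ys z \<in> V" "finite V" and xs: "set xs \<subseteq> A"
  shows "\<exists>ys. set ys \<subseteq> A \<and> foldr f ys z = foldr f xs z \<and> length ys \<le> card V"
proof -
  define Q where "Q = (\<lambda>k. \<exists>ys. set ys \<subseteq> A \<and> foldr f ys z = foldr f xs z \<and> length ys = k)"
  have "Q (length xs)" using xs by (auto simp: Q_def)
  then have L: "Q (LEAST k. Q k)" by (rule LeastI)
  then obtain ys where ys: "set ys \<subseteq> A" "foldr f ys z = foldr f xs z" "length ys = (LEAST k. Q k)"
    by (auto simp: Q_def)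
  \<comment> \<open>The values of all suffixes, including the full word and the empty one, hence
    \<open>length ys + 1\<close> of them.\<close>
  define g where "g = (\<lambda>i. foldr f (drop i ys) z)"
  have "inj_on g {..length ys}"
  proof (rule linorder_inj_onI')
    fix i j assume ij: "i \<in> {..length ys}" "j \<in> {..length ys}" "i < j"
    show "g i \<noteq> g j"
    proof
      assume e: "g i = g j"
      let ?w = "take i ys @ drop j ys"
      have "foldr f ?w z = foldr f (take i ys) (g i)" unfolding e by (simp add: g_def)
      also have "\<dots> = foldr f (take i ys @ drop i ys) z" by (simp only: g_def foldr_append)
      also have "\<dots> = foldr f ys z" by simp
      finally have "Q (length ?w)"
        using ys set_take_subset[of i ys] set_drop_subset[of j ys] unfolding Q_def by (intro exI[of _ ?w]) auto
      then have "length ys \<le> length ?w" unfolding ys(3) by (rule Least_le)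
      then show False using ij by simp
    qed
  qed
  moreover have "g ` {..length ys} \<subseteq> V"
    using V(1) ys(1) set_drop_subset unfolding g_def by (meson image_subsetI order_trans)
  ultimately have "card {..length ys} \<le> card V" using V(2) card_inj_on_le by blast
  then show ?thesis using ys by auto
qed

section \<open>Choosing words by codes\<close>

fun quad_list :: "'a \<times> 'a \<times> 'a \<times> 'a \<Rightarrow> 'a list" where
  "quad_list (a, b, c, d) = [a, b, c, d]"

definition code :: "nat \<Rightarrow> (nat \<Rightarrow> 'a \<times> 'a \<times> 'a \<times> 'a) \<Rightarrow> 'a list" where
  "code m f = concat (map (\<lambda>i. quad_list (f i)) [0..<m])"

definition decode :: "'a list \<Rightarrow> nat \<Rightarrow> 'a \<times> 'a \<times> 'a \<times> 'a" where
  "decode xs i = (xs ! (4 * i), xs ! (4 * i + 1), xs ! (4 * i + 2), xs ! (4 * i + 3))"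

lemma length_quad_list [simp]: "length (quad_list x) = 4"
  by (cases x) simp

lemma length_code [simp]: "length (code m f) = 4 * m"
  by (induction m) (simp_all add: code_def)

lemma code_Suc: "code (Suc m) f = code m f @ quad_list (f m)"
  by (simp add: code_def)

lemma code_nth: "i < m \<Longrightarrow> e < 4 \<Longrightarrow> code m f ! (4 * i + e) = quad_list (f i) ! e"
proof (induction m)
  case (Suc m)
  show ?case
  proof (cases "i = m")
    case True
    then show ?thesis using Suc.prems by (simp add: code_Suc nth_append)
  next
    case False
    then have "4 * i + e < 4 * m" using Suc.prems by linarith
    then show ?thesis using Suc False by (simp add: code_Suc nth_append)
  qed
qed simp

lemma decode_code [simp]: "i < m \<Longrightarrow> decode (code m f) i = f i"
proof -
  assume i: "i < m"
  have "decode (code m f) i = (quad_list (f i) ! 0, quad_list (f i) ! 1, quad_list (f i) ! 2, quad_list (f i) ! 3)"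
    using code_nth[OF i, of 0 f] code_nth[OF i, of 1 f] code_nth[OF i, of 2 f] code_nth[OF i, of 3 f] by (simp add: decode_def)
  then show ?thesis by (cases "f i") simp
qed

lemma code_cong: "(\<And>i. i < m \<Longrightarrow> f i = g i) \<Longrightarrow> code m f = code m g"
  unfolding code_def by (intro arg_cong[of _ _ concat] map_cong) auto

lemma take_code: "m \<le> k \<Longrightarrow> take (4 * m) (code k f) = code m f"
proof (induction k)
  case (Suc k)
  then show ?case by (cases "m = Suc k") (auto simp: code_Suc)
qed (simp add: code_def)

lemma set_code: "set (code m f) = (\<Union>i<m. set (quad_list (f i)))"
  by (auto simp: code_def)

text \<open>A positive word for the inverse of the value of \<open>xs\<close> whenever the \<open>N\<close>-th power of that value is trivial.\<close>

definition power_word :: "nat \<Rightarrow> 'l list \<Rightarrow> 'l list" where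
  "power_word N xs = concat (replicate (N - 1) xs)"

lemma length_power_word [simp]: "length (power_word N xs) = (N - 1) * length xs"
  by (simp add: power_word_def length_concat sum_list_replicate)

lemma set_power_word: "set (power_word N xs) \<subseteq> set xs"
  by (auto simp: power_word_def)

lemma set_comm_word: "set (comm_word m y y' h h') \<subseteq> set y \<union> set y' \<union> set h \<union> set h'"
proof (induction m y y' h h' rule: comm_word.induct)
  case (1 m y y' h h')
  consider "m = 0" | "m \<noteq> 0" "odd m" | "m \<noteq> 0" "\<not> odd m" by blast
  then show ?case
  proof cases
    case 2
    then show ?thesis using "1.IH"(1) by (subst comm_word.simps) auto
  next
    case 3
    then show ?thesis using "1.IH"(2) by (subst comm_word.simps) auto
  qed (auto simp: comm_word.simps)
qed

text \<open>Each binary digit at most quadruples the total of the four lengths, and halving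
  \<open>m\<close> divides \<open>m^2\<close> by at least 4. The length is thus quadratic in
  \<open>m\<close>, where unary iteration of commutators would be exponential.\<close>

lemma length_comm_word:
  assumes "1 \<le> m" "length y + length y' + length h + length h' \<le> X"
  shows "length (comm_word m y y' h h') \<le> 4 * m\<^sup>2 * X"
  using assms
proof (induction m y y' h h' arbitrary: X rule: comm_word.induct)
  case (1 m y y' h h')
  have e: "length (comm_word m y y' h h') \<le> (if m div 2 = 0 then 4 * X else 4 * (m div 2)\<^sup>2 * (4 * X))"
  proof (cases "odd m")
    case True
    let ?w = "comm_word (m div 2) (y @ h @ y' @ h') (h @ y @ h' @ y') (h @ h) (h' @ h')"
    have "length (comm_word m y y' h h') = length ?w"
      using True by (subst comm_word.simps) auto
    moreover have "length ?w \<le> 4 * X" if "m div 2 = 0"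
      using that "1.prems" by (simp add: comm_word.simps)
    moreover have "length ?w \<le> 4 * (m div 2)\<^sup>2 * (4 * X)" if "m div 2 \<noteq> 0"
      by (rule "1.IH"(1)) (use True that "1.prems" in auto)
    ultimately show ?thesis by simp
  next
    case False
    let ?w = "comm_word (m div 2) y y' (h @ h) (h' @ h')"
    have "length (comm_word m y y' h h') = length ?w"
      using False "1.prems" by (subst comm_word.simps) auto
    moreover have "length ?w \<le> 4 * X" if "m div 2 = 0"
      using that "1.prems" by (simp add: comm_word.simps)
    moreover have "length ?w \<le> 4 * (m div 2)\<^sup>2 * (4 * X)" if "m div 2 \<noteq> 0"
      by (rule "1.IH"(2)) (use False that "1.prems" in auto)
    ultimately show ?thesis by simp
  qed
  have "4 * (m div 2)\<^sup>2 \<le> m\<^sup>2"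
    using power_mono[of "2 * (m div 2)" m 2] by (simp add: power_mult_distrib)
  then have 1: "4 * (m div 2)\<^sup>2 * (4 * X) \<le> 4 * m\<^sup>2 * X" by simp
  have "4 * X \<le> 4 * m\<^sup>2 * X" using "1.prems" by simp
  with 1 have "(if m div 2 = 0 then 4 * X else 4 * (m div 2)\<^sup>2 * (4 * X)) \<le> 4 * m\<^sup>2 * X" by auto
  with e show ?case by (rule order_trans)
qed

section \<open>Codes of truncated matrices and built-in words\<close>

locale coded_group = trunc_field F n for F :: "nat ring" (structure) and n +
  fixes q :: nat
  assumes carrier_F: "carrier F = {..<q}"
begin

abbreviation tcode where "tcode \<equiv> trunc_mat_code F"

lemma F_less: "x \<in> carrier F \<longleftrightarrow> x < q"
  by (simp add: carrier_F)

lemma q_ge2: "2 \<le> q"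
proof -
  have "card {\<zero>, \<one>} \<le> card (carrier F)" by (rule card_mono) (use carrier_F in auto)
  then show ?thesis by (simp add: carrier_F)
qed

lemma tcode_eq: "tcode m x = code m (mcoeff x)"
  by (cases x) (simp add: trunc_mat_code_def code_def mcoeff_def)

lemma mconv_cong: "(\<And>j. j < k \<Longrightarrow> f j = f' j) \<Longrightarrow> (\<And>j. j \<le> i \<Longrightarrow> g j = g' j) \<Longrightarrow> mconv f g i k = mconv f' g' i k"
  by (induction k) (simp_all del: mat2_simps)

text \<open>Multiplication modulo the \<open>m\<close>-th power of the variable, carried out on
  codes alone. It does not mention \<open>n\<close>, so words found through it can be part of one
  program that serves all \<open>n\<close>.\<close>

definition class_mult :: "nat \<Rightarrow> nat list \<Rightarrow> nat list \<Rightarrow> nat list" where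
  "class_mult m x y = code m (\<lambda>i. mconv (decode x) (decode y) i (Suc i))"

definition class_one :: "nat \<Rightarrow> nat list" where
  "class_one m = code m (\<lambda>i. if i = 0 then \<one>\<^bsub>mat2 F\<^esub> else \<zero>\<^bsub>mat2 F\<^esub>)"

lemma tcode_mult:
  assumes "x \<in> carrier MR" "y \<in> carrier MR" "m \<le> n"
  shows "tcode m (x \<otimes>\<^bsub>MR\<^esub> y) = class_mult m (tcode m x) (tcode m y)"
  unfolding tcode_eq class_mult_def
proof (rule code_cong)
  fix i assume i: "i < m"
  have "mcoeff (x \<otimes>\<^bsub>MR\<^esub> y) i = mconv (mcoeff x) (mcoeff y) i (Suc i)"
    by (rule mcoeff_mult) (use assms i in auto)
  also have "\<dots> = mconv (decode (code m (mcoeff x))) (decode (code m (mcoeff y))) i (Suc i)"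
    by (rule mconv_cong) (use i in auto)
  finally show "mcoeff (x \<otimes>\<^bsub>MR\<^esub> y) i = \<dots>" .
qed

lemma tcode_one: "m \<le> n \<Longrightarrow> tcode m \<one>\<^bsub>MR\<^esub> = class_one m"
  unfolding tcode_eq class_one_def by (rule code_cong) (simp add: mcoeff_one del: mat2_simps)

lemma tcode_word:
  assumes "set w \<subseteq> carrier SLn" "m \<le> n"
  shows "tcode m (wv w) = foldr (class_mult m) (map (tcode m) w) (class_one m)"
  using assms(1)
proof (induction w)
  case (Cons x w)
  then have "x \<in> carrier MR" "wv w \<in> carrier MR" using SLn_MR SL.word_value_closed[of w] by auto
  then show ?case using Cons assms(2) by (simp add: tcode_mult del: mat2_simps)
qed (use assms(2) in \<open>simp add: tcode_one del: mat2_simps\<close>)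

lemma tcode_closed:
  assumes "x \<in> carrier MR" "m \<le> n"
  shows "set (tcode m x) \<subseteq> {..<q}"
  using mcoeff_closed[OF assms(1)] assms(2) unfolding tcode_eq set_code carrier_F
proof -
  show "(\<Union>i<m. set (quad_list (mcoeff x i))) \<subseteq> {..<q}"
  proof (rule UN_least)
    fix i assume "i \<in> {..<m}"
    then have "mcoeff x i \<in> carrier (mat2 F)" using mcoeff_closed[OF assms(1)] assms(2) by auto
    then show "set (quad_list (mcoeff x i)) \<subseteq> {..<q}" by (cases "mcoeff x i") (auto simp: carrier_F)
  qed
qed

lemma length_tcode [simp]: "length (tcode m x) = 4 * m"
  by (simp add: tcode_eq)

lemma take_tcode: "m \<le> k \<Longrightarrow> take (4 * m) (tcode k x) = tcode m x"
  by (simp add: tcode_eq take_code)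

text \<open>Depends only on the set \<open>A\<close> of classes of the generators, so that a program can have it built in.\<close>

definition base_word :: "nat \<Rightarrow> nat list set \<Rightarrow> nat list \<Rightarrow> nat list list" where
  "base_word m A c = (SOME w. set w \<subseteq> A \<and> foldr (class_mult m) w (class_one m) = c \<and> length w \<le> q ^ (4 * m))"

text \<open>A positive word for \<open>g\<close> exists because the group is finite; its letters are
  replaced by their classes, and \<open>foldr_shorten\<close> bounds the length by the number
  \<open>q ^ (4 * m)\<close> of codes. The elements of \<open>S\<close> themselves enter only to
  show that such a word of classes exists.\<close>

lemma base_word:
  assumes S: "S \<subseteq> carrier SLn" "generate SLn S = carrier SLn" and g: "g \<in> carrier SLn" and m: "m \<le> n"
  defines "A \<equiv> tcode m ` S"
  shows "set (base_word m A (tcode m g)) \<subseteq> A"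
    "foldr (class_mult m) (base_word m A (tcode m g)) (class_one m) = tcode m g"
    "length (base_word m A (tcode m g)) \<le> q ^ (4 * m)"
proof -
  let ?V = "{xs. set xs \<subseteq> {..<q} \<and> length xs = 4 * m}"
  have fin: "finite (carrier SLn)" by (rule SLn_finite) (simp add: carrier_F)
  obtain w where w: "set w \<subseteq> S" "wv w = g"
    using SL.generate_positive_word[OF fin S(1)] S(2) g by blast
  have "\<exists>v. set v \<subseteq> A \<and> foldr (class_mult m) v (class_one m) = foldr (class_mult m) (map (tcode m) w) (class_one m) \<and> length v \<le> card ?V"
  proof (rule foldr_shorten)
    fix ys assume "set ys \<subseteq> A"
    then have "ys \<in> lists (tcode m ` S)" unfolding A_def by auto
    then obtain v where v: "ys = map (tcode m) v" "set v \<subseteq> S" unfolding lists_image by auto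
    then have vc: "set v \<subseteq> carrier SLn" using S(1) by auto
    have "foldr (class_mult m) ys (class_one m) = tcode m (wv v)" unfolding v(1) by (rule tcode_word[symmetric]) (fact vc m)+
    moreover have "tcode m (wv v) \<in> ?V"
      using tcode_closed[OF SLn_MR[OF SL.word_value_closed[OF vc]] m] by simp
    ultimately show "foldr (class_mult m) ys (class_one m) \<in> ?V" by simp
  qed (use w A_def in \<open>auto intro: finite_lists_length_eq\<close>)
  moreover have "foldr (class_mult m) (map (tcode m) w) (class_one m) = tcode m g"
    using tcode_word[of w m] w S(1) m by auto
  moreover have "card ?V = q ^ (4 * m)" using card_lists_length_eq[of "{..<q}" "4 * m"] by simp
  ultimately have "\<exists>v. set v \<subseteq> A \<and> foldr (class_mult m) v (class_one m) = tcode m g \<and> length v \<le> q ^ (4 * m)"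
    by simp
  from someI_ex[OF this] show "set (base_word m A (tcode m g)) \<subseteq> A"
    "foldr (class_mult m) (base_word m A (tcode m g)) (class_one m) = tcode m g"
    "length (base_word m A (tcode m g)) \<le> q ^ (4 * m)"
    unfolding base_word_def by blast+
qed

definition target_y :: "nat \<Rightarrow> nat \<Rightarrow> nat \<Rightarrow> nat \<Rightarrow> nat list" where
  "target_y m d c j = code m (\<lambda>i. if i = 0 then \<one>\<^bsub>mat2 F\<^esub> else if i = j then dirX d c else \<zero>\<^bsub>mat2 F\<^esub>)"

definition target_h :: "nat \<Rightarrow> nat \<Rightarrow> nat list" where
  "target_h m d = code m (\<lambda>i. if i \<le> 1 then \<one>\<^bsub>mat2 F\<^esub> else dirE d)"

text \<open>A word with leading coefficient \<open>dirX d c\<close> at level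
  \<open>j + 2 * m\<close>. The map \<open>pos\<close> replaces each class by one chosen letter, so
  the same built-in word of classes serves every generating set with these classes.\<close>

definition dir_word :: "nat list set \<Rightarrow> nat \<Rightarrow> (nat list \<Rightarrow> 'l) \<Rightarrow> nat \<Rightarrow> nat \<Rightarrow> nat \<Rightarrow> nat \<Rightarrow> 'l list" where
  "dir_word A N pos j m d c =
     (let y = map pos (base_word 3 A (target_y 3 d c j)); h = map pos (base_word 3 A (target_h 3 d))
      in comm_word m y (power_word N y) h (power_word N h))"

definition level_word :: "nat list set \<Rightarrow> nat \<Rightarrow> (nat list \<Rightarrow> 'l) \<Rightarrow> nat \<Rightarrow> nat \<Rightarrow> nat \<times> nat \<times> nat \<times> nat \<Rightarrow> 'l list" where
  "level_word A N pos j m = (\<lambda>(u, f, g, _).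
     dir_word A N pos j m 2 u @ dir_word A N pos j m 0 (f \<oplus> u) @ dir_word A N pos j m 1 (g \<oplus> u))"

section \<open>Words in one chosen letter for each class\<close>

context
  fixes S A N pos and elt :: "'l \<Rightarrow> nat trunc_mat" and K :: nat
  assumes S: "S \<subseteq> carrier SLn" "generate SLn S = carrier SLn" and n3: "3 \<le> n"
    and A: "A = tcode 3 ` S" and N: "N = 2 ^ K" "n \<le> N"
    and pos: "\<And>x. x \<in> A \<Longrightarrow> tcode 3 (elt (pos x)) = x" and elt: "\<And>l. elt l \<in> carrier SLn"
begin

text \<open>Letters stand for their classes modulo \<open>t^3\<close>, so the value of the lifted
  word is prescribed at levels 0, 1, 2 whichever representatives \<open>pos\<close> selects; at
  higher levels nothing is controlled.\<close>

lemma base_word_class: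
  assumes g: "g \<in> carrier SLn"
  shows "wv (map elt (map pos (base_word 3 A (tcode 3 g)))) \<in> carrier SLn"
    "\<And>i. i \<le> 2 \<Longrightarrow> mcoeff (wv (map elt (map pos (base_word 3 A (tcode 3 g))))) i = mcoeff g i"
proof -
  let ?w = "base_word 3 A (tcode 3 g)"
  note b = base_word[OF S g n3, folded A]
  have c: "set (map elt (map pos ?w)) \<subseteq> carrier SLn" using elt by auto
  then show "wv (map elt (map pos ?w)) \<in> carrier SLn" by simp
  have "map (tcode 3) (map elt (map pos ?w)) = ?w"
    using pos b(1) by (simp add: map_idI subset_iff)
  then have "tcode 3 (wv (map elt (map pos ?w))) = tcode 3 g"
    using tcode_word[OF c n3] b(2) by simp
  then have "decode (tcode 3 (wv (map elt (map pos ?w)))) i = decode (tcode 3 g) i" for i by simp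
  then show "\<And>i. i \<le> 2 \<Longrightarrow> mcoeff (wv (map elt (map pos ?w))) i = mcoeff g i"
    unfolding tcode_eq by (metis decode_code le_imp_less_Suc numeral_3_eq_3 numeral_2_eq_2)
qed

text \<open>The prescribed values at levels 0 to 2 are attained in the group by
  \<open>ex_leading\<close> and \<open>ex_almost_scalar\<close>, so the built-in words exist. They
  fix \<open>y\<close> at level \<open>j \<le> 2\<close> and \<open>h\<close> with
  \<open>i = 1\<close>, from where \<open>comm_word_leading\<close> takes over.\<close>

lemma dir_word_leading:
  assumes c: "c \<in> carrier F" and j: "1 \<le> j" "j \<le> 2"
  shows "M.leading (j + 2 * m) (mcst (dirX d c)) (wv (map elt (dir_word A N pos j m d c)))"
proof -
  interpret MF: ring "mat2 F" by (rule mat2_ring[OF is_cring])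
  let ?y = "map pos (base_word 3 A (target_y 3 d c j))" and ?h = "map pos (base_word 3 A (target_h 3 d))"
  let ?v = "\<lambda>xs. wv (map elt xs)"
  obtain y where y: "y \<in> carrier SLn" "\<And>i. i < n \<Longrightarrow> mcoeff y i = (if i = 0 then \<one>\<^bsub>mat2 F\<^esub> else if i = j then dirX d c else \<zero>\<^bsub>mat2 F\<^esub>)"
    using ex_leading[OF c j(1), of d] by blast
  obtain h where h: "h \<in> carrier SLn" "\<And>i. i < n \<Longrightarrow> i \<le> 2 \<Longrightarrow> mcoeff h i = (if i \<le> 1 then \<one>\<^bsub>mat2 F\<^esub> else dirE d)"
    using ex_almost_scalar[of d] by blast
  have ty: "target_y 3 d c j = tcode 3 y" unfolding target_y_def tcode_eq by (rule code_cong) (use y n3 in auto)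
  have th: "target_h 3 d = tcode 3 h" unfolding target_h_def tcode_eq by (rule code_cong) (use h n3 in auto)
  note vy = base_word_class[OF y(1), folded ty] and vh = base_word_class[OF h(1), folded th]
  have vym: "mcoeff (?v ?y) i = (if i = 0 then \<one>\<^bsub>mat2 F\<^esub> else if i = j then dirX d c else \<zero>\<^bsub>mat2 F\<^esub>)" if "i \<le> 2" for i
    using vy(2)[OF that] y(2)[of i] n3 that by simp
  have vhm: "mcoeff (?v ?h) i = (if i \<le> 1 then \<one>\<^bsub>mat2 F\<^esub> else dirE d)" if "i \<le> 2" for i
    using vh(2)[OF that] h(2)[of i] n3 that by simp
  have ly: "M.leading j (mcst (dirX d c)) (?v ?y)"
    unfolding leading_iff[OF SLn_MR[OF vy(1)] dir_closed(1)[OF c] j(1)] using vym j by auto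
  have lh: "M.almost_scalar 1 (mcst (dirE d)) (?v ?h)"
    unfolding almost_scalar_one_iff[OF SLn_MR[OF vh(1)] dir_closed(2)] using vhm by auto
  have set: "set (map elt xs) \<subseteq> carrier SLn" for xs using elt by auto
  have 1: "M.cong_s 1 (?v ?y) \<one>\<^bsub>MR\<^esub>" "M.cong_s 1 (?v ?h) \<one>\<^bsub>MR\<^esub>"
    unfolding cong_iff_mcoeff[OF SLn_MR[OF vy(1)] M.one_closed] cong_iff_mcoeff[OF SLn_MR[OF vh(1)] M.one_closed]
    using vym vhm by (auto simp: mcoeff_one simp del: mat2_simps)
  have m: "map elt (power_word N xs) = concat (replicate (N - 1) (map elt xs))" for xs
    by (simp add: power_word_def map_concat)
  have iy: "?v ?y \<otimes>\<^bsub>MR\<^esub> ?v (power_word N ?y) = \<one>\<^bsub>MR\<^esub>"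
    unfolding m unfolding N(1) by (rule inverse_word[OF set 1(1)]) (use N in simp)
  have ih: "?v ?h \<otimes>\<^bsub>MR\<^esub> ?v (power_word N ?h) = \<one>\<^bsub>MR\<^esub>"
    unfolding m unfolding N(1) by (rule inverse_word[OF set 1(2)]) (use N in simp)
  have com: "mcst (dirX d c) \<otimes>\<^bsub>MR\<^esub> mcst (dirE d) \<oplus>\<^bsub>MR\<^esub> mcst (dirE d) \<otimes>\<^bsub>MR\<^esub> mcst (dirX d c) = mcst (dirX d c)"
    using c dir_closed MF.m_closed by (simp only: mcst_mult[symmetric] mcst_add[symmetric] dir_commutator)
  have idem: "mcst (dirE d) \<otimes>\<^bsub>MR\<^esub> mcst (dirE d) = mcst (dirE d)"
    by (simp only: mcst_mult[symmetric] dir_closed dirE_idem)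
  have "M.leading (j + 2 * 1 * m) (mcst (dirX d c)) (?v (comm_word m ?y (power_word N ?y) ?h (power_word N ?h)))"
    by (rule comm_word_leading[OF elt mcst_closed mcst_closed com idem _ j(1) ly lh iy ih]) (use c dir_closed in \<open>simp_all del: mat2_simps\<close>)
  then show ?thesis by (simp add: dir_word_def Let_def mult_ac)
qed

lemma level_word_reduces:
  assumes r: "r \<in> carrier SLn" "M.cong_s k r \<one>\<^bsub>MR\<^esub>" and k: "k < n" "k = j + 2 * m" and j: "1 \<le> j" "j \<le> 2"
  shows "M.cong_s (Suc k) (r \<otimes>\<^bsub>MR\<^esub> wv (map elt (level_word A N pos j m (mcoeff r k)))) \<one>\<^bsub>MR\<^esub>"
proof -
  obtain u f g u' where X: "mcoeff r k = (u, f, g, u')" by (cases "mcoeff r k")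
  have ufg: "u \<in> carrier F" "f \<in> carrier F" "g \<in> carrier F"
    using mcoeff_closed[OF SLn_MR[OF r(1)] k(1)] unfolding X by auto
  then have fu: "f \<oplus> u \<in> carrier F" "g \<oplus> u \<in> carrier F" by auto
  have set: "set (map elt xs) \<subseteq> carrier SLn" for xs using elt by auto
  have app: "wv (map elt (xs @ ys)) = wv (map elt xs) \<otimes>\<^bsub>MR\<^esub> wv (map elt ys)" for xs ys
    unfolding map_append SLn_mult[symmetric] by (rule SL.word_value_append[OF set set])
  have cl: "wv (map elt xs) \<in> carrier MR" for xs by (rule SLn_MR[OF SL.word_value_closed[OF set]])
  have "wv (map elt (level_word A N pos j m (mcoeff r k))) =
    wv (map elt (dir_word A N pos j m 2 u)) \<otimes>\<^bsub>MR\<^esub> wv (map elt (dir_word A N pos j m 0 (f \<oplus> u))) \<otimes>\<^bsub>MR\<^esub> wv (map elt (dir_word A N pos j m 1 (g \<oplus> u)))"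
    unfolding X level_word_def prod.case app by (rule M.m_assoc[symmetric]) (rule cl)+
  moreover have "1 \<le> k" using k j by simp
  ultimately show ?thesis
    using cong_Suc_of_product[OF r _ k(1) X dir_word_leading[OF ufg(1) j, of m 2, folded k(2)] dir_word_leading[OF fu(1) j, of m 0, folded k(2)] dir_word_leading[OF fu(2) j, of m 1, folded k(2)]]
    by metis
qed

text \<open>Each of \<open>y\<close> and \<open>h\<close> has at most \<open>q ^ 12\<close> letters
  and together with its inverse word \<open>N\<close> times as many; the total
  \<open>2 * N * q ^ 12\<close> meets the factor \<open>4 * m^2\<close> of
  \<open>length_comm_word\<close>.\<close>

lemma length_dir_word:
  assumes c: "c \<in> carrier F" and j: "1 \<le> j" "j \<le> 2" and m: "1 \<le> m"
  shows "length (dir_word A N pos j m d c) \<le> 8 * m\<^sup>2 * N * q ^ 12"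
proof -
  let ?y = "map pos (base_word 3 A (target_y 3 d c j))" and ?h = "map pos (base_word 3 A (target_h 3 d))"
  obtain y where y: "y \<in> carrier SLn" "\<And>i. i < n \<Longrightarrow> mcoeff y i = (if i = 0 then \<one>\<^bsub>mat2 F\<^esub> else if i = j then dirX d c else \<zero>\<^bsub>mat2 F\<^esub>)"
    using ex_leading[OF c j(1), of d] by blast
  obtain h where h: "h \<in> carrier SLn" "\<And>i. i < n \<Longrightarrow> i \<le> 2 \<Longrightarrow> mcoeff h i = (if i \<le> 1 then \<one>\<^bsub>mat2 F\<^esub> else dirE d)"
    using ex_almost_scalar[of d] by blast
  have ty: "target_y 3 d c j = tcode 3 y" unfolding target_y_def tcode_eq by (rule code_cong) (use y n3 in auto)
  have th: "target_h 3 d = tcode 3 h" unfolding target_h_def tcode_eq by (rule code_cong) (use h n3 in auto)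
  have l: "length ?y \<le> q ^ 12" "length ?h \<le> q ^ 12"
    unfolding ty th using base_word(3)[OF S y(1) n3] base_word(3)[OF S h(1) n3] by (simp_all add: A)
  have N1: "1 \<le> N" using N by simp
  have t: "length xs + length (power_word N xs) = N * length xs" for xs :: "'l list"
    using N1 by (cases N) simp_all
  have "length ?y + length (power_word N ?y) + length ?h + length (power_word N ?h) = N * length ?y + N * length ?h"
    using t[of ?y] t[of ?h] by simp
  also have "\<dots> \<le> N * (2 * q ^ 12)" using mult_le_mono2[OF l(1), of N] mult_le_mono2[OF l(2), of N] by linarith
  finally have "length (comm_word m ?y (power_word N ?y) ?h (power_word N ?h)) \<le> 4 * m\<^sup>2 * (N * (2 * q ^ 12))"
    by (rule length_comm_word[OF m])
  then show ?thesis by (simp add: dir_word_def Let_def mult_ac)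
qed

end

end

section \<open>Timed correctness of programs\<close>

text \<open>Total correctness with a time budget, in the style of a weakest precondition: the
  postcondition may itself be a \<open>runs\<close> statement for the rest of the program.\<close>

definition runs :: "program \<Rightarrow> machine_state \<Rightarrow> nat \<Rightarrow> (machine_state \<Rightarrow> bool) \<Rightarrow> bool" where
  "runs P s t Q \<longleftrightarrow> (\<exists>k s'. exec P s k s' \<and> k \<le> t \<and> Q s')"

lemma runsI: "exec P s k s' \<Longrightarrow> k \<le> t \<Longrightarrow> Q s' \<Longrightarrow> runs P s t Q"
  unfolding runs_def by blast

lemma runsE:
  assumes "runs P s t Q" obtains k s' where "exec P s k s'" "k \<le> t" "Q s'"
  using assms unfolding runs_def by blast

lemma runs_mono: "runs P s t Q \<Longrightarrow> t \<le> t' \<Longrightarrow> (\<And>s'. Q s' \<Longrightarrow> Q' s') \<Longrightarrow> runs P s t' Q'"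
  unfolding runs_def by (meson order_trans)

lemma runs_Seq:
  assumes "runs P s t1 (\<lambda>s'. runs R s' t2 Q)" "t1 + t2 \<le> t"
  shows "runs (Seq P R) s t Q"
proof -
  obtain k s' where k: "exec P s k s'" "k \<le> t1" "runs R s' t2 Q" using assms(1) by (rule runsE)
  from k(3) obtain l s'' where l: "exec R s' l s''" "l \<le> t2" "Q s''" by (rule runsE)
  have "exec (Seq P R) s (k + l) s''" by (rule exec.Seq) (fact k l)+
  then show ?thesis by (rule runsI) (use k l assms(2) in auto)
qed

text \<open>Determinism of \<open>exec\<close> makes this an equivalence, so it can be used as a
  rewrite rule that executes straight-line code symbolically.\<close>

lemma runs_Seq_atomic:
  assumes "exec P s 1 s'"
  shows "runs (Seq P R) s t Q \<longleftrightarrow> 1 \<le> t \<and> runs R s' (t - 1) Q"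
proof
  assume "runs (Seq P R) s t Q"
  then obtain k s'' where k: "exec (Seq P R) s k s''" "k \<le> t" "Q s''" by (rule runsE)
  from k(1) obtain k1 k2 s1 where "exec P s k1 s1" "exec R s1 k2 s''" "k = k1 + k2" by (rule exec_SeqE) auto
  moreover have "k1 = 1 \<and> s1 = s'" using exec_deterministic[OF \<open>exec P s k1 s1\<close> assms] .
  ultimately show "1 \<le> t \<and> runs R s' (t - 1) Q" using k by (auto intro: runsI[of R s' k2 s''])
next
  assume "1 \<le> t \<and> runs R s' (t - 1) Q"
  then show "runs (Seq P R) s t Q"
    by (intro runs_Seq[of P s 1 R "t - 1" Q t]) (auto intro: runsI[OF assms])
qed

lemma runs_atomic:
  assumes "exec P s 1 s'"
  shows "runs P s t Q \<longleftrightarrow> 1 \<le> t \<and> Q s'"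
  unfolding runs_def using assms exec_deterministic[OF assms] by blast

lemmas atomic_exec = exec.Skip exec.Const exec.Add exec.Sub exec.Read exec.Write

lemma runs_Seq_assoc: "runs (Seq (Seq P Q) R) s t B \<longleftrightarrow> runs (Seq P (Seq Q R)) s t B"
proof -
  have "exec (Seq (Seq P Q) R) s k s' \<longleftrightarrow> exec (Seq P (Seq Q R)) s k s'" for k s'
  proof
    assume "exec (Seq (Seq P Q) R) s k s'"
    then obtain k1 s1 k2 where 1: "exec (Seq P Q) s k1 s1" "exec R s1 k2 s'" "k = k1 + k2" by (rule exec_SeqE) auto
    from 1(1) obtain k3 s2 k4 where 2: "exec P s k3 s2" "exec Q s2 k4 s1" "k1 = k3 + k4" by (rule exec_SeqE) auto
    show "exec (Seq P (Seq Q R)) s k s'"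
      using exec.Seq[OF 2(1) exec.Seq[OF 2(2) 1(2)]] 1(3) 2(3) by (simp add: add.assoc)
  next
    assume "exec (Seq P (Seq Q R)) s k s'"
    then obtain k1 s1 k2 where 1: "exec P s k1 s1" "exec (Seq Q R) s1 k2 s'" "k = k1 + k2" by (rule exec_SeqE) auto
    from 1(2) obtain k3 s2 k4 where 2: "exec Q s1 k3 s2" "exec R s2 k4 s'" "k2 = k3 + k4" by (rule exec_SeqE) auto
    show "exec (Seq (Seq P Q) R) s k s'"
      using exec.Seq[OF exec.Seq[OF 1(1) 2(1)] 2(2)] 1(3) 2(3) by (simp add: add.assoc)
  qed
  then show ?thesis by (simp add: runs_def)
qed

lemma runs_IfLess:
  "runs (IfLess u v P R) (\<rho>, \<mu>) t Q \<longleftrightarrow> 1 \<le> t \<and> (if \<rho> u < \<rho> v then runs P (\<rho>, \<mu>) (t - 1) Q else runs R (\<rho>, \<mu>) (t - 1) Q)"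
proof -
  have *: "(\<exists>k. exec (IfLess u v P R) s k s' \<and> k \<le> t) \<longleftrightarrow>
     1 \<le> t \<and> (\<exists>k. exec (if fst s u < fst s v then P else R) s k s' \<and> k \<le> t - 1)" for s s'
  proof
    assume "\<exists>k. exec (IfLess u v P R) s k s' \<and> k \<le> t"
    then obtain k where "exec (IfLess u v P R) s k s'" "k \<le> t" by blast
    then show "1 \<le> t \<and> (\<exists>k. exec (if fst s u < fst s v then P else R) s k s' \<and> k \<le> t - 1)"
      by (elim exec_IfE) (auto intro!: exI)
  next
    assume "1 \<le> t \<and> (\<exists>k. exec (if fst s u < fst s v then P else R) s k s' \<and> k \<le> t - 1)"
    then obtain k where k: "1 \<le> t" "exec (if fst s u < fst s v then P else R) s k s'" "k \<le> t - 1" by blast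
    then have "exec (IfLess u v P R) s (k + 1) s'"
      using exec.IfTrue[of s u v P k s' R] exec.IfFalse[of s u v R k s' P] by (cases "fst s u < fst s v") auto
    then show "\<exists>k. exec (IfLess u v P R) s k s' \<and> k \<le> t" using k by (intro exI[of _ "k + 1"]) auto
  qed
  have r: "runs P' s t Q \<longleftrightarrow> (\<exists>s'. (\<exists>k. exec P' s k s' \<and> k \<le> t) \<and> Q s')" for P' s t
    unfolding runs_def by blast
  show ?thesis unfolding r * by (cases "\<rho> u < \<rho> v") simp_all
qed

lemma runs_IfTrue: "fst s u < fst s v \<Longrightarrow> runs P s t Q \<Longrightarrow> t + 1 \<le> t' \<Longrightarrow> runs (IfLess u v P R) s t' Q"
  by (cases s) (auto simp: runs_IfLess intro: runs_mono)

lemma runs_IfFalse: "\<not> fst s u < fst s v \<Longrightarrow> runs R s t Q \<Longrightarrow> t + 1 \<le> t' \<Longrightarrow> runs (IfLess u v P R) s t' Q"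
  by (cases s) (auto simp: runs_IfLess intro: runs_mono)

lemmas runs_simps = atomic_exec[THEN runs_Seq_atomic] atomic_exec[THEN runs_atomic] runs_Seq_assoc runs_IfLess

text \<open>The invariant is indexed by the number of completed passes, which gives termination and
  timing together: each pass costs \<open>T\<close> plus one test, and the failing test adds one
  step.\<close>

lemma runs_While:
  assumes "I 0 s" and step: "\<And>i \<rho> \<mu>. i < N \<Longrightarrow> I i (\<rho>, \<mu>) \<Longrightarrow> \<rho> u < \<rho> v \<and> runs P (\<rho>, \<mu>) T (I (Suc i))"
    and last: "\<And>\<rho> \<mu>. I N (\<rho>, \<mu>) \<Longrightarrow> \<not> \<rho> u < \<rho> v \<and> Q (\<rho>, \<mu>)"
    and t: "N * (T + 1) + 1 \<le> t"
  shows "runs (WhileLess u v P) s t Q"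
proof -
  have "runs (WhileLess u v P) s (k * (T + 1) + 1) Q" if "k \<le> N" "I (N - k) s" for k s
    using that
  proof (induction k arbitrary: s)
    case 0
    then have l: "\<not> fst s u < fst s v" "Q s" using last[of "fst s" "snd s"] by auto
    show ?case by (rule runsI[OF exec.WhileFalse[of s u v P, OF l(1)]]) (use l(2) in simp_all)
  next
    case (Suc k)
    have st: "fst s u < fst s v" "runs P s T (I (Suc (N - Suc k)))"
      using step[of "N - Suc k" "fst s" "snd s"] Suc.prems by auto
    from st(2) obtain l s' where l: "exec P s l s'" "l \<le> T" "I (Suc (N - Suc k)) s'" by (rule runsE)
    have "Suc (N - Suc k) = N - k" using Suc.prems by simp
    then have "runs (WhileLess u v P) s' (k * (T + 1) + 1) Q" using Suc l by simp
    then obtain j s'' where j: "exec (WhileLess u v P) s' j s''" "j \<le> k * (T + 1) + 1" "Q s''" by (rule runsE)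
    have "exec (WhileLess u v P) s (l + j + 1) s''" by (rule exec.WhileTrue) (fact st l j)+
    then show ?case by (rule runsI) (use l j in auto)
  qed
  from this[of N s] show ?thesis using assms(1) t by (auto intro: runs_mono)
qed

lemma runs_While_unfold:
  "fst s u < fst s v \<Longrightarrow> runs P s t1 (\<lambda>s'. runs (WhileLess u v P) s' t2 Q) \<Longrightarrow> t1 + t2 + 1 \<le> t \<Longrightarrow> runs (WhileLess u v P) s t Q"
  "\<not> fst s u < fst s v \<Longrightarrow> 1 \<le> t \<Longrightarrow> Q s \<Longrightarrow> runs (WhileLess u v P) s t Q"
proof -
  assume a: "fst s u < fst s v" "runs P s t1 (\<lambda>s'. runs (WhileLess u v P) s' t2 Q)" "t1 + t2 + 1 \<le> t"
  from a(2) obtain k s' where k: "exec P s k s'" "k \<le> t1" "runs (WhileLess u v P) s' t2 Q" by (rule runsE)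
  from k(3) obtain l s'' where l: "exec (WhileLess u v P) s' l s''" "l \<le> t2" "Q s''" by (rule runsE)
  have "exec (WhileLess u v P) s (k + l + 1) s''" by (rule exec.WhileTrue) (fact a k l)+
  then show "runs (WhileLess u v P) s t Q" by (rule runsI) (use k l a in auto)
next
  assume "\<not> fst s u < fst s v" "1 \<le> t" "Q s"
  then show "runs (WhileLess u v P) s t Q" unfolding runs_def using exec.WhileFalse[of s u v P] by blast
qed

text \<open>The closing \<open>Skip\<close> takes one step, which accounts for the extra 1 in the
  time bounds of blocks.\<close>

definition block :: "program list \<Rightarrow> program" where
  "block Ps = foldr Seq Ps Skip"

lemma block_simps: "block [] = Skip" "block (P # Ps) = Seq P (block Ps)"
  by (simp_all add: block_def)

lemma runs_block_append:
  assumes "runs (block Ps) s t1 (\<lambda>s'. runs (block Rs) s' t2 Q)" "t1 + t2 \<le> t"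
  shows "runs (block (Ps @ Rs)) s t Q"
  using assms
proof (induction Ps arbitrary: s t1 t)
  case Nil
  then show ?case by (auto simp: block_simps runs_simps intro: runs_mono)
next
  case (Cons P Ps)
  from Cons.prems(1) obtain k s1 where k: "exec (Seq P (block Ps)) s k s1" "k \<le> t1" "runs (block Rs) s1 t2 Q"
    unfolding block_simps by (rule runsE)
  from k(1) obtain k1 k2 s2 where e: "exec P s k1 s2" "exec (block Ps) s2 k2 s1" "k = k1 + k2" by (rule exec_SeqE) auto
  have "runs (block (Ps @ Rs)) s2 (k2 + t2) Q"
    by (rule Cons.IH[of s2 k2]) (use e k in \<open>auto intro: runsI[OF e(2)]\<close>)
  then have "runs (Seq P (block (Ps @ Rs))) s (k1 + (k2 + t2)) Q"
    by (intro runs_Seq[of P s k1 _ "k2 + t2"]) (use e in \<open>auto intro: runsI[OF e(1)]\<close>)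
  then show ?case using Cons.prems(2) e k by (auto simp: block_simps intro: runs_mono)
qed

lemma runs_block_Cons: "runs P s t1 (\<lambda>s'. runs (block Ps) s' t2 Q) \<Longrightarrow> t1 + t2 \<le> t \<Longrightarrow> runs (block (P # Ps)) s t Q"
  unfolding block_simps by (rule runs_Seq)

lemma runs_block_single: "runs P s t1 Q \<Longrightarrow> t1 + 1 \<le> t \<Longrightarrow> runs (block [P]) s t Q"
  by (rule runs_block_Cons[where ?t2.0 = 1], erule runs_mono) (auto simp: block_simps runs_simps)

lemma runs_block_atomic:
  assumes "exec P s 1 s'"
  shows "runs (block (P # Ps)) s t Q \<longleftrightarrow> 1 \<le> t \<and> runs (block Ps) s' (t - 1) Q"
  unfolding block_simps by (rule runs_Seq_atomic[OF assms])

lemma runs_block_Nil: "runs (block []) s t Q \<longleftrightarrow> 1 \<le> t \<and> Q s"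
  unfolding block_simps by (rule runs_atomic[OF exec.Skip])

lemmas block_runs = atomic_exec[THEN runs_block_atomic] runs_block_Nil

definition frame :: "nat set \<Rightarrow> nat set \<Rightarrow> machine_state \<Rightarrow> machine_state \<Rightarrow> bool" where
  "frame R A s s' \<longleftrightarrow> (\<forall>r. r \<notin> R \<longrightarrow> fst s' r = fst s r) \<and> (\<forall>a. a \<notin> A \<longrightarrow> snd s' a = snd s a)"

lemma frame_refl [simp]: "frame R A s s"
  by (simp add: frame_def)

lemma frame_trans: "frame R A s s' \<Longrightarrow> frame R A s' s'' \<Longrightarrow> frame R A s s''"
  by (simp add: frame_def)

lemma frame_mono: "frame R A s s' \<Longrightarrow> R \<subseteq> R' \<Longrightarrow> A \<subseteq> A' \<Longrightarrow> frame R' A' s s'"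
  unfolding frame_def by blast

lemma frame_reg: "frame R A s s' \<Longrightarrow> r \<notin> R \<Longrightarrow> fst s' r = fst s r"
  by (simp add: frame_def)

lemma frame_array: "frame R A s s' \<Longrightarrow> a \<notin> A \<Longrightarrow> snd s' a = snd s a"
  by (simp add: frame_def)

text \<open>Register 19 is scratch space for the branching macros.\<close>

fun case_prog :: "nat \<Rightarrow> nat \<Rightarrow> program list \<Rightarrow> program" where
  "case_prog r i [] = Skip"
| "case_prog r i (P # Ps) = Seq (Const 19 (Suc i)) (IfLess r 19 P (case_prog r (Suc i) Ps))"

text \<open>The last premise ranges over all contents \<open>x\<close> of register 19, because the
  comparisons overwrite it before a branch is entered.\<close>

lemma runs_case_prog:
  assumes "i \<le> \<rho> r" "\<rho> r < i + length Ps" "r \<noteq> 19" "\<And>x. runs (Ps ! (\<rho> r - i)) (\<rho>(19 := x), \<mu>) t Q"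
  shows "runs (case_prog r i Ps) (\<rho>, \<mu>) (2 * length Ps + t) Q"
  using assms
proof (induction Ps arbitrary: i \<rho>)
  case (Cons P Ps)
  show ?case
  proof (cases "\<rho> r < Suc i")
    case True
    then have "\<rho> r = i" using Cons.prems(1) by simp
    then have "(P # Ps) ! (\<rho> r - i) = P" by simp
    then have "runs P (\<rho>(19 := Suc i), \<mu>) t Q"
      using Cons.prems(4)[of "Suc i"] by (simp only:)
    then have "runs P (\<rho>(19 := Suc i), \<mu>) (2 * length Ps + t) Q"
      by (rule runs_mono) simp_all
    then show ?thesis using True Cons.prems(3) by (simp add: runs_simps)
  next
    case False
    have e: "(P # Ps) ! (\<rho> r - i) = Ps ! ((\<rho>(19 := Suc i)) r - Suc i)"
      using False Cons.prems(3) by (simp add: nth_Cons' Suc_diff_le)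
    have "runs (case_prog r (Suc i) Ps) (\<rho>(19 := Suc i), \<mu>) (2 * length Ps + t) Q"
    proof (rule Cons.IH)
      show "runs (Ps ! ((\<rho>(19 := Suc i)) r - Suc i)) (\<rho>(19 := Suc i, 19 := x), \<mu>) t Q" for x
        unfolding e[symmetric] fun_upd_upd by (rule Cons.prems(4))
    qed (use False Cons.prems in auto)
    then show ?thesis using False Cons.prems(3) by (simp add: runs_simps)
  qed
qed simp

text \<open>A finite table in the control flow, with one branch for each tuple of values below
  \<open>q\<close>. This replaces field arithmetic and the selection of built-in words on a machine
  that can only add and subtract.\<close>

fun dispatch :: "nat \<Rightarrow> nat list \<Rightarrow> (nat list \<Rightarrow> program) \<Rightarrow> program" where
  "dispatch q [] f = f []"
| "dispatch q (r # rs) f = case_prog r 0 (map (\<lambda>v. dispatch q rs (\<lambda>vs. f (v # vs))) [0..<q])"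

lemma runs_dispatch:
  assumes "\<And>r. r \<in> set rs \<Longrightarrow> \<rho> r < q \<and> r \<noteq> 19" "\<And>x. runs (f (map \<rho> rs)) (\<rho>(19 := x), \<mu>) t Q"
  shows "runs (dispatch q rs f) (\<rho>, \<mu>) (2 * q * length rs + t) Q"
  using assms
proof (induction rs arbitrary: f \<rho>)
  case Nil
  then show ?case using Nil(2)[of "\<rho> 19"] by simp
next
  case (Cons r rs)
  have r: "\<rho> r < q" "r \<noteq> 19" using Cons.prems(1) by auto
  have "runs (dispatch q rs (\<lambda>vs. f (\<rho> r # vs))) (\<rho>(19 := x), \<mu>) (2 * q * length rs + t) Q" for x
  proof (rule Cons.IH)
    have m: "map (\<rho>(19 := x)) rs = map \<rho> rs" using Cons.prems(1) by auto
    show "runs (f (\<rho> r # map (\<rho>(19 := x)) rs)) (\<rho>(19 := x, 19 := y), \<mu>) t Q" for y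
      unfolding m using Cons.prems(2)[of y] by (simp only: list.map fun_upd_upd)
  qed (use Cons.prems(1) in auto)
  then have "runs (case_prog r 0 (map (\<lambda>v. dispatch q rs (\<lambda>vs. f (v # vs))) [0..<q])) (\<rho>, \<mu>)
      (2 * length (map (\<lambda>v. dispatch q rs (\<lambda>vs. f (v # vs))) [0..<q]) + (2 * q * length rs + t)) Q"
    by (intro runs_case_prog) (use r in auto)
  then show ?case by (simp add: algebra_simps)
qed

text \<open>
  Words are kept in the arrays 6 to 10; the length of the word in array \<open>a\<close> is in register \<open>a + 6\<close>.
  Registers 0 and 1 hold the constants 0 and 1.
\<close>

lemma replicate_Suc_conv_snoc: "replicate (Suc n) x = replicate n x @ [x]"
  by (simp add: replicate_append_same)

section \<open>Computing with words held in arrays\<close>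

definition bufs :: "(nat \<Rightarrow> nat list) \<Rightarrow> machine_state \<Rightarrow> bool" where
  "bufs f s \<longleftrightarrow> fst s 0 = 0 \<and> fst s 1 = 1 \<and>
     (\<forall>a\<in>{6..10}. fst s (a + 6) = length (f a) \<and> (\<forall>i<length (f a). snd s a i = f a ! i))"

abbreviation "bframe \<equiv> frame {12..<30} {6..10}"

definition bruns :: "nat set \<Rightarrow> program \<Rightarrow> (nat \<Rightarrow> nat list) \<Rightarrow> machine_state \<Rightarrow> nat \<Rightarrow> (nat \<Rightarrow> nat list) \<Rightarrow> bool" where
  "bruns R P f s t f' \<longleftrightarrow> runs P s t (\<lambda>s'. bufs f' s' \<and> frame R {6..10} s s')"

abbreviation append_regs :: "nat set" where "append_regs \<equiv> {20, 21, 22} \<union> {12..16}"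

text \<open>The length of the source is saved before the loop. This makes the case
  \<open>a = b\<close> terminate, in which the length register grows with every pass; doubling a
  word is that case.\<close>

definition append_prog :: "nat \<Rightarrow> nat \<Rightarrow> program" where
  "append_prog b a = block [Const 20 0, Add 21 (a + 6) 0,
     WhileLess 20 21 (block [Read 22 a 20, Write b (b + 6) 22, Add 20 20 1, Add (b + 6) (b + 6) 1])]"

lemma runs_append_prog:
  assumes ab: "a \<in> {6..10}" "b \<in> {6..10}" and f: "bufs f s"
  shows "runs (append_prog b a) s (6 * length (f a) + 5)
    (\<lambda>s'. bufs (f(b := f b @ f a)) s' \<and> frame ({20, 21, 22} \<union> {12..16}) {6..10} s s')"
proof -
  obtain \<rho> \<mu> where s: "s = (\<rho>, \<mu>)" by fastforce
  have ne: "b \<noteq> 14" "b \<noteq> 15" "b \<noteq> 16" "a \<noteq> 14" "a \<noteq> 15" "a \<noteq> 16" "b + 6 \<noteq> 0" "b + 6 \<noteq> 1" "b + 6 \<noteq> Suc 0" "a + 6 \<noteq> 20" "b + 6 \<noteq> 20" "b + 6 \<noteq> 21" "b + 6 \<noteq> 22"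
    "20 \<noteq> b + 6" "21 \<noteq> b + 6" "22 \<noteq> b + 6" "0 \<noteq> b + 6" "1 \<noteq> b + 6" "Suc 0 \<noteq> b + 6"
    using ab by auto
  have 01: "\<rho> 0 = 0" "\<rho> 1 = 1" "\<rho> (Suc 0) = 1" using f by (auto simp: bufs_def s)
  have la: "\<rho> (a + 6) = length (f a)" "\<And>i. i < length (f a) \<Longrightarrow> \<mu> a i = f a ! i"
    "\<rho> (b + 6) = length (f b)" "\<And>i. i < length (f b) \<Longrightarrow> \<mu> b i = f b ! i" using f ab by (auto simp: bufs_def s)
  define I where "I = (\<lambda>i (\<rho>', \<mu>'). \<rho>' 20 = i \<and> \<rho>' 21 = length (f a) \<and> \<rho>' (b + 6) = length (f b) + i \<and>
     (\<forall>j<i. \<mu>' b (length (f b) + j) = f a ! j) \<and> (\<forall>j<length (f b). \<mu>' b j = f b ! j) \<and>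
     (\<forall>r. r \<notin> {20, 21, 22, b + 6} \<longrightarrow> \<rho>' r = \<rho> r) \<and> (\<forall>c. c \<noteq> b \<longrightarrow> \<mu>' c = (\<mu> c :: nat \<Rightarrow> nat)))"
  let ?Q = "\<lambda>s'. bufs (f(b := f b @ f a)) s' \<and> frame ({20, 21, 22} \<union> {12..16}) {6..10} s s'"
  have "runs (WhileLess 20 21 (block [Read 22 a 20, Write b (b + 6) 22, Add 20 20 1, Add (b + 6) (b + 6) 1]))
      (\<rho>(20 := 0, 21 := length (f a)), \<mu>) (6 * length (f a) + 1) ?Q"
  proof (rule runs_While[where I = I and N = "length (f a)" and T = 5])
    show "I 0 (\<rho>(20 := 0, 21 := length (f a)), \<mu>)"
      using la ne by (auto simp: I_def)
  next
    fix i \<rho>' \<mu>' assume i: "i < length (f a)" and I: "I i (\<rho>', \<mu>')"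
    \<comment> \<open>For \<open>a = b\<close> the cell that is read lies in the old part of the
      array, which the loop leaves intact.\<close>
    have v: "\<mu>' a i = f a ! i"
    proof (cases "a = b")
      case False
      then show ?thesis using I i la(2) by (auto simp: I_def)
    qed (use I i in \<open>auto simp: I_def\<close>)
    have 1: "\<rho>' (Suc 0) = 1" using I 01 ne by (auto simp: I_def)
    have r: "runs (block [Read 22 a 20, Write b (b + 6) 22, Add 20 20 1, Add (b + 6) (b + 6) 1]) (\<rho>', \<mu>') 5 (I (Suc i))"
      using I v 1 ne
      by (simp add: block_simps runs_simps I_def less_Suc_eq)
    show "\<rho>' 20 < \<rho>' 21 \<and> runs (block [Read 22 a 20, Write b (b + 6) 22, Add 20 20 1, Add (b + 6) (b + 6) 1]) (\<rho>', \<mu>') 5 (I (Suc i))"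
      using I i r by (simp add: I_def)
  next
    fix \<rho>' \<mu>' assume I: "I (length (f a)) (\<rho>', \<mu>')"
    have "bufs (f(b := f b @ f a)) (\<rho>', \<mu>')"
      unfolding bufs_def
    proof (intro conjI ballI)
      fix c :: nat assume c: "c \<in> {6..10}"
      have "\<rho>' (c + 6) = length ((f(b := f b @ f a)) c) \<and> (\<forall>i<length ((f(b := f b @ f a)) c). \<mu>' c i = (f(b := f b @ f a)) c ! i)"
      proof (cases "c = b")
        case True
        have Ib: "\<And>j. j < length (f a) \<Longrightarrow> \<mu>' b (length (f b) + j) = f a ! j" using I by (simp add: I_def)
        have "\<mu>' b i = (f b @ f a) ! i" if "i < length (f b) + length (f a)" for i
        proof (cases "i < length (f b)")
          case False
          then have "i - length (f b) < length (f a)" "length (f b) + (i - length (f b)) = i" using that by auto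
          then have "\<mu>' b i = f a ! (i - length (f b))" using Ib by metis
          then show ?thesis using False by (simp add: nth_append)
        qed (use I in \<open>simp add: I_def nth_append\<close>)
        then show ?thesis using True I by (simp add: I_def)
      next
        case False
        then have "\<rho>' (c + 6) = \<rho> (c + 6)" "\<mu>' c = \<mu> c" using I c by (auto simp: I_def)
        then show ?thesis using False f c by (auto simp: bufs_def s)
      qed
      then show "fst (\<rho>', \<mu>') (c + 6) = length ((f(b := f b @ f a)) c)"
        "\<forall>i<length ((f(b := f b @ f a)) c). snd (\<rho>', \<mu>') c i = (f(b := f b @ f a)) c ! i" by auto
    qed (use I 01 ne in \<open>auto simp: I_def\<close>)
    moreover have "frame ({20, 21, 22} \<union> {12..16}) {6..10} s (\<rho>', \<mu>')"
      unfolding frame_def s using I ab by (auto simp: I_def)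
    ultimately show "\<not> \<rho>' 20 < \<rho>' 21 \<and> ?Q (\<rho>', \<mu>')" using I by (simp add: I_def)
  qed simp
  then show ?thesis
    unfolding append_prog_def s
    using 01 la ne by (simp add: block_runs) (erule runs_block_single, simp)
qed

lemma bufs_frame:
  assumes "bufs f s" "frame R A s s'" "R \<inter> ({0, 1} \<union> {12..16}) = {}" "A \<inter> {6..10} = {}"
  shows "bufs f s'"
proof -
  have "fst s' r = fst s r" if "r \<in> {0, 1} \<union> {12..16}" for r using frame_reg[OF assms(2)] assms(3) that by blast
  moreover have "snd s' a = snd s a" if "a \<in> {6..10}" for a using frame_array[OF assms(2)] assms(4) that by blast
  ultimately show ?thesis using assms(1) by (auto simp: bufs_def)
qed

lemma bruns_mono: "bruns R P f s t f' \<Longrightarrow> t \<le> t' \<Longrightarrow> bruns R P f s t' f'"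
  unfolding bruns_def by (rule runs_mono)

lemma bruns_append:
  "bufs f s \<Longrightarrow> a \<in> {6..10} \<Longrightarrow> b \<in> {6..10} \<Longrightarrow> 6 * length (f a) + 5 \<le> t \<Longrightarrow> bruns append_regs (append_prog b a) f s t (f(b := f b @ f a))"
  unfolding bruns_def by (rule runs_mono[OF runs_append_prog]) auto

lemma bruns_clear:
  assumes "bufs f s" "b \<in> {6..10}" "1 \<le> t" shows "bruns append_regs (Const (b + 6) 0) f s t (f(b := []))"
  using assms by (cases s) (auto simp: bruns_def runs_simps bufs_def frame_def)

lemma bruns_block:
  assumes "bruns R P f s t1 f'" "\<And>s'. bufs f' s' \<Longrightarrow> frame R {6..10} s s' \<Longrightarrow> bruns R (block Ps) f' s' t2 f''" "t1 + t2 \<le> t"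
  shows "bruns R (block (P # Ps)) f s t f''"
  unfolding bruns_def
proof (rule runs_block_Cons[OF runs_mono[OF assms(1)[unfolded bruns_def] order_refl] assms(3)])
  fix s' assume s': "bufs f' s' \<and> frame R {6..10} s s'"
  show "runs (block Ps) s' t2 (\<lambda>s'. bufs f'' s' \<and> frame R {6..10} s s')"
    by (rule runs_mono[OF assms(2)[of s', unfolded bruns_def]]) (use s' in \<open>auto intro: frame_trans\<close>)
qed

lemma bruns_Nil: "bufs f s \<Longrightarrow> 1 \<le> t \<Longrightarrow> bruns R (block []) f s t f"
  by (simp add: bruns_def block_runs)

lemma bruns_append_Cons:
  assumes "bufs f s" "a \<in> {6..10}" "b \<in> {6..10}" "length (f a) \<le> X" "f(b := f b @ f a) = f1"
    "\<And>s'. bufs f1 s' \<Longrightarrow> bruns append_regs (block Ps) f1 s' t f'"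
  shows "bruns append_regs (block (append_prog b a # Ps)) f s (6 * X + 5 + t) f'"
  by (rule bruns_block[OF bruns_append[OF assms(1,2,3)]]) (use assms(4-) in auto)

lemma bruns_clear_Cons:
  assumes "bufs f s" "b \<in> {6..10}" "c = b + 6" "f(b := []) = f1"
    "\<And>s'. bufs f1 s' \<Longrightarrow> bruns append_regs (block Ps) f1 s' t f'"
  shows "bruns append_regs (block (Const c 0 # Ps)) f s (1 + t) f'"
  unfolding assms(3) by (rule bruns_block[OF bruns_clear[OF assms(1,2)]]) (use assms(4-) in auto)

definition push_prog :: "nat \<Rightarrow> nat list \<Rightarrow> program" where
  "push_prog b rs = block (concat (map (\<lambda>r. [Write b (b + 6) r, Add (b + 6) (b + 6) 1]) rs))"

lemma bruns_push:
  assumes "bufs f s" "b \<in> {6..10}" "\<And>r. r \<in> set rs \<Longrightarrow> r \<notin> {12..<30}" "2 * length rs + 1 \<le> t"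
  shows "bruns {12..16} (push_prog b rs) f s t (f(b := f b @ map (fst s) rs))"
  using assms
proof (induction rs arbitrary: f s t)
  case Nil
  then show ?case by (simp add: push_prog_def bruns_Nil)
next
  case (Cons r rs)
  obtain \<rho> \<mu> where s: "s = (\<rho>, \<mu>)" by fastforce
  define s' where "s' = (\<rho>(b + 6 := \<rho> (b + 6) + 1), \<mu>(b := (\<mu> b)(\<rho> (b + 6) := \<rho> r)))"
  have 1: "\<rho> (Suc 0) = 1" using Cons.prems(1) by (simp add: bufs_def s)
  have fr: "frame {12..16} {6..10} s s'" using Cons.prems(2) by (auto simp: frame_def s s'_def)
  let ?f = "f(b := f b @ [\<rho> r])"
  have b': "bufs ?f s'"
    using Cons.prems(1,2) by (auto simp: bufs_def s s'_def nth_append less_Suc_eq)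
  have e: "fst s' x = fst s x" if "x \<in> set rs" for x
    using Cons.prems(2) Cons.prems(3)[of x] that by (auto simp: s s'_def)
  have "bruns {12..16} (push_prog b rs) ?f s' (t - Suc (Suc 0)) (?f(b := ?f b @ map (fst s') rs))"
    by (rule Cons.IH[OF b' Cons.prems(2)]) (use Cons.prems in auto)
  also have "?f(b := ?f b @ map (fst s') rs) = f(b := f b @ map (fst s) (r # rs))"
    using e by (simp add: s cong: map_cong)
  finally have "runs (block (concat (map (\<lambda>r. [Write b (b + 6) r, Add (b + 6) (b + 6) 1]) rs))) s' (t - Suc (Suc 0))
     (\<lambda>s'. bufs (f(b := f b @ map (fst s) (r # rs))) s' \<and> frame {12..16} {6..10} s s')"
    unfolding bruns_def push_prog_def by (rule runs_mono) (use fr in \<open>auto intro: frame_trans\<close>)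
  moreover define f' where "f' = f(b := f b @ map (fst s) (r # rs))"
  ultimately have "runs (block (concat (map (\<lambda>r. [Write b (b + 6) r, Add (b + 6) (b + 6) 1]) rs))) s' (t - Suc (Suc 0))
     (\<lambda>s'. bufs f' s' \<and> frame {12..16} {6..10} s s')" by simp
  moreover have "Suc 0 \<le> t - Suc 0" using Cons.prems(4) by simp
  ultimately have "bruns {12..16} (push_prog b (r # rs)) f s t f'" using Cons.prems(2,4) 1
    by (simp add: bruns_def push_prog_def block_runs s s'_def)
  then show ?case unfolding f'_def .
qed

text \<open>The counter starts at 1 and stops at \<open>N\<close>, giving the \<open>N - 1\<close>
  copies that represent an inverse.\<close>

definition power_prog :: "nat \<Rightarrow> nat \<Rightarrow> program" where
  "power_prog b a = block [Const (b + 6) 0, Const 23 1, WhileLess 23 5 (block [append_prog b a, Add 23 23 1])]"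

lemma bruns_power:
  assumes f: "bufs f s" and ab: "a \<in> {6..10}" "b \<in> {6..10}" "a \<noteq> b" and N: "fst s 5 = N" "1 \<le> N"
    and t: "N * (6 * length (f a) + 8) + 4 \<le> t"
  shows "bruns {12..<30} (power_prog b a) f s t (f(b := power_word N (f a)))"
proof -
  obtain \<rho> \<mu> where s: "s = (\<rho>, \<mu>)" by fastforce
  define s0 where "s0 = (\<rho>(b + 6 := 0, 23 := 1), \<mu>)"
  have f0: "bufs (f(b := [])) s0" "bframe s s0"
    using f ab by (auto simp: bufs_def s s0_def frame_def)
  let ?g = "\<lambda>i. f(b := concat (replicate i (f a)))"
  define I where "I = (\<lambda>i s'. bufs (?g i) s' \<and> bframe s s' \<and> fst s' 23 = Suc i)"
  have "runs (WhileLess 23 5 (block [append_prog b a, Add 23 23 1])) s0 ((N - 1) * (6 * length (f a) + 7 + 1) + 1)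
     (\<lambda>s'. bufs (f(b := power_word N (f a))) s' \<and> bframe s s')"
  proof (rule runs_While[where I = I and N = "N - 1" and T = "6 * length (f a) + 7"])
    show "I 0 s0" using f0 by (simp add: I_def) (simp add: s0_def)
  next
    fix i \<rho>' \<mu>' assume i: "i < N - 1" and I: "I i (\<rho>', \<mu>')"
    have "\<rho>' 5 = N" using frame_reg[of "{12..<30}" "{6..10}" s "(\<rho>', \<mu>')" 5] I N(1) by (simp add: I_def)
    moreover have "runs (block [append_prog b a, Add 23 23 1]) (\<rho>', \<mu>') (6 * length (f a) + 7) (I (Suc i))"
    proof (rule runs_block_Cons[OF runs_mono])
      have "bufs (?g i) (\<rho>', \<mu>')" using I by (simp add: I_def)
      then show "runs (append_prog b a) (\<rho>', \<mu>') (6 * length (?g i a) + 5)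
        (\<lambda>s'. bufs ((?g i)(b := ?g i b @ ?g i a)) s' \<and> frame ({20, 21, 22} \<union> {12..16}) {6..10} (\<rho>', \<mu>') s')"
        using ab by (intro runs_append_prog)
      show "6 * length (?g i a) + 5 \<le> 6 * length (f a) + 5" using ab by simp
      fix s1 assume s1: "bufs ((?g i)(b := ?g i b @ ?g i a)) s1 \<and> frame ({20, 21, 22} \<union> {12..16}) {6..10} (\<rho>', \<mu>') s1"
      obtain \<rho>1 \<mu>1 where s1': "s1 = (\<rho>1, \<mu>1)" by fastforce
      have ga: "?g i a = f a" using ab by simp
      have g: "(?g i)(b := ?g i b @ ?g i a) = ?g (Suc i)" unfolding ga
        by (simp only: fun_upd_upd fun_upd_same replicate_Suc_conv_snoc concat_append concat.simps append_Nil2)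
      have "bufs (?g (Suc i)) (\<rho>1(23 := Suc (Suc i)), \<mu>1)"
        by (rule bufs_frame[of _ s1 "{23}" "{}"]) (use s1[unfolded g] in \<open>auto simp: frame_def s1'\<close>)
      moreover have "\<rho>1 23 = Suc i" "\<rho>1 (Suc 0) = 1"
        using s1 I unfolding s1' by (auto simp: frame_def I_def bufs_def)
      moreover have "bframe s (\<rho>1(23 := Suc (Suc i)), \<mu>1)"
      proof -
        have "bframe (\<rho>', \<mu>') s1" using s1 by (auto intro: frame_mono)
        moreover have "bframe s (\<rho>', \<mu>')" using I by (simp add: I_def)
        ultimately have "bframe s s1" using frame_trans by blast
        then show ?thesis unfolding s1' by (simp add: frame_def)
      qed
      ultimately show "runs (block [Add 23 23 1]) s1 2 (I (Suc i))"
        unfolding s1' by (simp add: block_runs I_def)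
    qed simp
    ultimately show "\<rho>' 23 < \<rho>' 5 \<and> runs (block [append_prog b a, Add 23 23 1]) (\<rho>', \<mu>') (6 * length (f a) + 7) (I (Suc i))"
      using I i by (simp add: I_def)
  next
    fix \<rho>' \<mu>' assume I: "I (N - 1) (\<rho>', \<mu>')"
    have "\<rho>' 5 = N" using frame_reg[of "{12..<30}" "{6..10}" s "(\<rho>', \<mu>')" 5] I N(1) by (simp add: I_def)
    then show "\<not> \<rho>' 23 < \<rho>' 5 \<and> bufs (f(b := power_word N (f a))) (\<rho>', \<mu>') \<and> bframe s (\<rho>', \<mu>')"
      using I N by (simp add: I_def power_word_def)
  qed simp
  moreover have "(N - 1) * (6 * length (f a) + 7 + 1) + 1 + 1 \<le> t - 2"
  proof -
    have "(N - 1) * (6 * length (f a) + 8) \<le> N * (6 * length (f a) + 8)" by simp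
    moreover have "6 * length (f a) + 7 + 1 = 6 * length (f a) + 8" by simp
    ultimately show ?thesis using t by presburger
  qed
  ultimately show ?thesis
    using t ab unfolding bruns_def power_prog_def s s0_def
    by (simp add: block_runs) (intro conjI, linarith, erule runs_block_single, simp add: numeral_2_eq_2)
qed

lemma append_regs_subset: "append_regs \<subseteq> {12..<30}"
  by auto

text \<open>Arrays 6 to 9 hold \<open>y\<close>, \<open>y'\<close>, \<open>h\<close>,
  \<open>h'\<close>. The new inverse is assembled in array 10 while \<open>y\<close> and
  \<open>y'\<close> are still intact; then \<open>y\<close> is extended in place, and array 10
  replaces \<open>y'\<close>.\<close>

definition comm_prog :: program where
  "comm_prog = block [Const 16 0, append_prog 10 8, append_prog 10 6, append_prog 10 9, append_prog 10 7,
     append_prog 6 8, append_prog 6 7, append_prog 6 9, Const 13 0, append_prog 7 10]"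

lemma bruns_comm:
  assumes f: "bufs f s" and X: "length (f 6) + length (f 7) + length (f 8) + length (f 9) \<le> X"
  shows "bruns append_regs comm_prog f s (60 * X + 60)
    (f(10 := f 8 @ f 6 @ f 9 @ f 7, 6 := f 6 @ f 8 @ f 7 @ f 9, 7 := f 8 @ f 6 @ f 9 @ f 7))"
    unfolding comm_prog_def
    apply (rule bruns_mono)
     apply (rule bruns_clear_Cons[where b = 10 and ?f1.0 = "f(10 := [])"], rule f, simp, simp, simp)
     apply (rule bruns_append_Cons[where X = X and ?f1.0 = "f(10 := f 8)"], assumption, simp, simp, use X in simp, simp add: fun_upd_twist)
     apply (rule bruns_append_Cons[where X = X and ?f1.0 = "f(10 := f 8 @ f 6)"], assumption, simp, simp, use X in simp, simp add: fun_upd_twist)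
     apply (rule bruns_append_Cons[where X = X and ?f1.0 = "f(10 := f 8 @ f 6 @ f 9)"], assumption, simp, simp, use X in simp, simp add: fun_upd_twist)
     apply (rule bruns_append_Cons[where X = X and ?f1.0 = "f(10 := f 8 @ f 6 @ f 9 @ f 7)"], assumption, simp, simp, use X in simp, simp add: fun_upd_twist)
     apply (rule bruns_append_Cons[where X = X and ?f1.0 = "f(10 := f 8 @ f 6 @ f 9 @ f 7, 6 := f 6 @ f 8)"], assumption, simp, simp, use X in simp, simp add: fun_upd_twist)
     apply (rule bruns_append_Cons[where X = X and ?f1.0 = "f(10 := f 8 @ f 6 @ f 9 @ f 7, 6 := f 6 @ f 8 @ f 7)"], assumption, simp, simp, use X in simp, simp add: fun_upd_twist)
     apply (rule bruns_append_Cons[where X = X and ?f1.0 = "f(10 := f 8 @ f 6 @ f 9 @ f 7, 6 := f 6 @ f 8 @ f 7 @ f 9)"], assumption, simp, simp, use X in simp, simp add: fun_upd_twist)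
     apply (rule bruns_clear_Cons[where b = 7 and ?f1.0 = "f(10 := f 8 @ f 6 @ f 9 @ f 7, 6 := f 6 @ f 8 @ f 7 @ f 9, 7 := [])"], assumption, simp, simp, simp)
     apply (rule bruns_append_Cons[where X = X and ?f1.0 = "f(10 := f 8 @ f 6 @ f 9 @ f 7, 6 := f 6 @ f 8 @ f 7 @ f 9, 7 := f 8 @ f 6 @ f 9 @ f 7)"], assumption, simp, simp, use X in simp, simp add: fun_upd_twist)
     apply (rule bruns_Nil, assumption, rule order_refl)
    apply simp
    done

definition build_loop :: program where
  "build_loop = WhileLess 0 25 (block [Const 26 0, Const 27 2,
     WhileLess 1 25 (block [Sub 25 25 27, Add 26 26 1]),
     IfLess 0 25 comm_prog Skip, Add 25 26 0, append_prog 8 8, append_prog 9 9])"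

text \<open>Repeated subtraction of 2 yields quotient and remainder without division. The linear
  cost is harmless, since \<open>m\<close> is bounded by \<open>n\<close>.\<close>

lemma runs_halve:
  assumes "\<rho> 25 = m" "\<rho> 26 = 0" "\<rho> 27 = 2" "\<rho> 1 = 1"
  shows "runs (WhileLess 1 25 (block [Sub 25 25 27, Add 26 26 1])) (\<rho>, \<mu>) (4 * m + 1) (\<lambda>s'. s' = (\<rho>(25 := m mod 2, 26 := m div 2), \<mu>))"
proof (rule runs_While[where I = "\<lambda>i s'. s' = (\<rho>(25 := m - 2 * i, 26 := i), \<mu>)" and N = "m div 2" and T = 3])
  show "(\<rho>, \<mu>) = (\<rho>(25 := m - 2 * 0, 26 := 0), \<mu>)" using assms by auto
next
  fix i \<rho>' \<mu>' assume i: "i < m div 2" and I: "(\<rho>', \<mu>') = (\<rho>(25 := m - 2 * i, 26 := i), \<mu>)"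
  show "\<rho>' 1 < \<rho>' 25 \<and> runs (block [Sub 25 25 27, Add 26 26 1]) (\<rho>', \<mu>') 3 (\<lambda>s'. s' = (\<rho>(25 := m - 2 * Suc i, 26 := Suc i), \<mu>))"
    using I i assms by (auto simp: block_runs)
next
  fix \<rho>' \<mu>' assume "(\<rho>', \<mu>') = (\<rho>(25 := m - 2 * (m div 2), 26 := m div 2), \<mu>)"
  moreover have "m - 2 * (m div 2) = m mod 2" by (simp add: minus_mult_div_eq_mod)
  ultimately show "\<not> \<rho>' 1 < \<rho>' 25 \<and> (\<rho>', \<mu>') = (\<rho>(25 := m mod 2, 26 := m div 2), \<mu>)"
    using assms by auto
qed simp

text \<open>The quantity \<open>4 * m^2 * X\<close> does not grow when \<open>m\<close> is halved
  and the total length \<open>X\<close> of the words quadruples, so one constant \<open>B\<close>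
  bounds the copying in all rounds. At \<open>m = 0\<close> it carries no information, whence the
  separate premise \<open>X \<le> B\<close>. Counting at most \<open>m\<close> rounds is crude but
  sufficient.\<close>

lemma runs_build_loop:
  assumes "bufs f s" "fst s 25 = m" "m \<le> M" "length (f 6) + length (f 7) + length (f 8) + length (f 9) \<le> X" "X \<le> B" "m \<noteq> 0 \<Longrightarrow> 4 * m\<^sup>2 * X \<le> B"
  shows "runs build_loop s (m * (72 * B + 4 * M + 100) + 1)
    (\<lambda>s'. \<exists>f'. bufs f' s' \<and> f' 6 = comm_word m (f 6) (f 7) (f 8) (f 9) \<and> bframe s s')"
  using assms
proof (induction m arbitrary: f s X rule: less_induct)
  case (less m)
  obtain \<rho> \<mu> where s: "s = (\<rho>, \<mu>)" by fastforce
  have z: "\<rho> 0 = 0" "\<rho> 1 = 1" "\<rho> (Suc 0) = 1" "\<rho> 25 = m" using less.prems by (auto simp: bufs_def s)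
  show ?case
  proof (cases "m = 0")
    case True
    then show ?thesis unfolding build_loop_def using less.prems(1) z
      by (intro runs_While_unfold(2)) (auto simp: s comm_word.simps)
  next
    case m0: False
    define f1 where "f1 = (if odd m then f(10 := f 8 @ f 6 @ f 9 @ f 7, 6 := f 6 @ f 8 @ f 7 @ f 9, 7 := f 8 @ f 6 @ f 9 @ f 7) else f)"
    define f2 where "f2 = f1(8 := f 8 @ f 8, 9 := f 9 @ f 9)"
    define s1 where "s1 = (\<rho>(26 := 0, 27 := 2, 25 := m mod 2, 26 := m div 2), \<mu>)"
    have s1: "bufs f s1" "bframe s s1" using less.prems(1) by (auto simp: bufs_def s1_def s frame_def)
    have XB: "4 * X \<le> B"
    proof -
      have "1 \<le> m\<^sup>2" using m0 by simp
      then have "4 * X \<le> 4 * m\<^sup>2 * X" by simp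
      then show ?thesis using less.prems(6)[OF m0] by (rule le_trans)
    qed
    have f1: "length (f1 8) \<le> X" "length (f1 9) \<le> X" "f1 8 = f 8" "f1 9 = f 9" using less.prems(4) by (auto simp: f1_def)
    have comm: "runs (IfLess 0 25 comm_prog Skip) s1 (60 * X + 61) (\<lambda>s'. bufs f1 s' \<and> frame append_regs {6..10} s1 s')"
    proof (cases "odd m")
      case True
      have "runs comm_prog s1 (60 * X + 60) (\<lambda>s'. bufs f1 s' \<and> frame append_regs {6..10} s1 s')"
      proof -
        have "f1 = f(10 := f 8 @ f 6 @ f 9 @ f 7, 6 := f 6 @ f 8 @ f 7 @ f 9, 7 := f 8 @ f 6 @ f 9 @ f 7)"
          using True by (simp add: f1_def)
        then show ?thesis using bruns_comm[OF s1(1) less.prems(4)] by (simp only: bruns_def)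
      qed
      then show ?thesis using True z by (rule_tac runs_IfTrue) (auto simp: s1_def odd_iff_mod_2_eq_one)
    next
      case False
      then show ?thesis using z s1(1) by (simp add: s1_def runs_simps f1_def)
    qed
    let ?L = "\<lambda>s'. \<exists>f'. bufs f' s' \<and> f' 6 = comm_word m (f 6) (f 7) (f 8) (f 9) \<and> bframe s s'"
    have rest: "runs (block [Add 25 26 0, append_prog 8 8, append_prog 9 9]) s2 (12 * X + 12)
        (\<lambda>s'. bufs f2 s' \<and> bframe s s' \<and> fst s' 25 = m div 2)"
      if s2: "bufs f1 s2" "frame append_regs {6..10} s1 s2" for s2
    proof -
      obtain \<rho>2 \<mu>2 where s2': "s2 = (\<rho>2, \<mu>2)" by fastforce
      have r: "\<rho>2 26 = m div 2" "\<rho>2 0 = 0" using s2 frame_reg[OF s2(2), of 26] by (auto simp: s2' s1_def bufs_def)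
      define s3 where "s3 = (\<rho>2(25 := m div 2), \<mu>2)"
      have b3: "bufs f1 s3" "bframe s2 s3" using s2(1) by (auto simp: bufs_def s3_def s2' frame_def)
      have f3: "bframe s s3" using s1(2) frame_mono[OF s2(2)] b3(2) frame_trans by (metis (no_types, lifting) append_regs_subset order_refl)
      have "bruns append_regs (block [append_prog 8 8, append_prog 9 9]) f1 s3 (12 * X + 11) f2"
        apply (rule bruns_mono)
         apply (rule bruns_append_Cons[where X = X and ?f1.0 = "f1(8 := f1 8 @ f1 8)"], rule b3(1), simp, simp, rule f1, simp)
         apply (rule bruns_append_Cons[where X = X and ?f1.0 = f2], assumption, simp, simp, use f1 in simp, use f1 in \<open>simp add: f2_def\<close>)
         apply (rule bruns_Nil, assumption, rule order_refl)
        apply simp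
        done
      then have "runs (block [append_prog 8 8, append_prog 9 9]) s3 (12 * X + 11) (\<lambda>s'. bufs f2 s' \<and> bframe s s' \<and> fst s' 25 = m div 2)"
        unfolding bruns_def
      proof (rule runs_mono)
        fix s4 assume s4: "bufs f2 s4 \<and> frame append_regs {6..10} s3 s4"
        then have "fst s4 25 = fst s3 25" by (intro frame_reg[of append_regs "{6..10}"]) auto
        moreover have "bframe s3 s4" using s4 frame_mono[OF _ append_regs_subset] by blast
        ultimately show "bufs f2 s4 \<and> bframe s s4 \<and> fst s4 25 = m div 2"
          using s4 frame_trans[OF f3] by (simp add: s3_def)
      qed simp
      then show ?thesis using r by (simp add: block_runs s2' s3_def) (erule runs_mono, simp_all)
    qed
    let ?body = "[Const 26 0, Const 27 2, WhileLess 1 25 (block [Sub 25 25 27, Add 26 26 1]),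
       IfLess 0 25 comm_prog Skip, Add 25 26 0, append_prog 8 8, append_prog 9 9]"
    have body: "runs (block ?body) s (72 * X + 4 * m + 76) (\<lambda>s'. bufs f2 s' \<and> bframe s s' \<and> fst s' 25 = m div 2)"
    proof -
      have "runs (block [IfLess 0 25 comm_prog Skip, Add 25 26 0, append_prog 8 8, append_prog 9 9]) s1 (72 * X + 73)
         (\<lambda>s'. bufs f2 s' \<and> bframe s s' \<and> fst s' 25 = m div 2)"
        by (rule runs_block_Cons[OF runs_mono[OF comm order_refl]]) (use rest in auto)
      then have "runs (block [WhileLess 1 25 (block [Sub 25 25 27, Add 26 26 1]), IfLess 0 25 comm_prog Skip, Add 25 26 0, append_prog 8 8, append_prog 9 9])
          (\<rho>(26 := 0, 27 := 2), \<mu>) (72 * X + 4 * m + 74) (\<lambda>s'. bufs f2 s' \<and> bframe s s' \<and> fst s' 25 = m div 2)"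
        by (intro runs_block_Cons[OF runs_mono[OF runs_halve[of _ m] order_refl]]) (use z in \<open>auto simp: s1_def\<close>)
      then show ?thesis using z by (simp add: block_runs s) (erule runs_mono, simp_all)
    qed
    have "runs build_loop s' (m div 2 * (72 * B + 4 * M + 100) + 1) ?L" if s': "bufs f2 s'" "bframe s s'" "fst s' 25 = m div 2" for s'
    proof -
      have len: "length (f2 6) + length (f2 7) + length (f2 8) + length (f2 9) \<le> 4 * X"
        using less.prems(4) by (auto simp: f2_def f1_def)
      have le: "4 * (m div 2)\<^sup>2 * (4 * X) \<le> B"
      proof -
        have "4 * (m div 2)\<^sup>2 \<le> m\<^sup>2"
          using power_mono[of "2 * (m div 2)" m 2] by (simp add: power_mult_distrib)
        then have "4 * (m div 2)\<^sup>2 * (4 * X) \<le> 4 * m\<^sup>2 * X" by simp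
        then show ?thesis using less.prems(6)[OF m0] by (rule le_trans)
      qed
      have "comm_word m (f 6) (f 7) (f 8) (f 9) = comm_word (m div 2) (f2 6) (f2 7) (f2 8) (f2 9)"
        using m0 by (subst comm_word.simps) (auto simp: f2_def f1_def)
      then have c: "comm_word (m div 2) (f2 6) (f2 7) (f2 8) (f2 9) = comm_word m (f 6) (f 7) (f 8) (f 9)" by simp
      have "m div 2 < m" "m div 2 \<le> M" using m0 less.prems(3) by auto
      from less.IH[of "m div 2", OF this(1) s'(1,3) this(2) len XB le] show ?thesis
        unfolding c by (rule runs_mono) (use s'(2) frame_trans in blast)+
    qed
    then have H: "runs (block ?body) s (72 * X + 4 * m + 76) (\<lambda>s'. runs build_loop s' (m div 2 * (72 * B + 4 * M + 100) + 1) ?L)"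
      by (intro runs_mono[OF body]) auto
    have le: "72 * X + 4 * m + 76 + (m div 2 * (72 * B + 4 * M + 100) + 1) + 1 \<le> m * (72 * B + 4 * M + 100) + 1"
    proof -
      obtain k where k: "m = Suc k" "m div 2 \<le> k" using m0 by (cases m) auto
      define C where "C = 72 * B + 4 * M + 100"
      have "(m div 2) * C \<le> k * C" using k by (intro mult_le_mono1)
      moreover have "72 * X + 4 * m + 100 \<le> C" using less.prems(3,5) by (simp add: C_def)
      moreover have "m * C = k * C + C" by (simp add: k(1))
      ultimately show ?thesis unfolding C_def[symmetric] by linarith
    qed
    have g: "fst s 0 < fst s 25" using z m0 by (simp add: s)
    show ?thesis
      using runs_While_unfold(1)[OF g H[unfolded build_loop_def] le] unfolding build_loop_def .
  qed
qed

lemma bruns_then: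
  assumes "bruns R P f s t1 f'" "R \<subseteq> {12..<30}" "bframe s0 s"
    "\<And>s'. bufs f' s' \<Longrightarrow> bframe s0 s' \<Longrightarrow> runs (block Ps) s' t2 Q"
  shows "runs (block (P # Ps)) s (t1 + t2) Q"
proof (rule runs_block_Cons[OF runs_mono[OF assms(1)[unfolded bruns_def] order_refl]])
  fix s' assume "bufs f' s' \<and> frame R {6..10} s s'"
  then show "runs (block Ps) s' t2 Q"
    using assms(4) frame_trans[OF assms(3) frame_mono[OF _ assms(2) subset_refl]] by blast
qed simp

lemma bruns_clear': "bufs f s \<Longrightarrow> b \<in> {6..10} \<Longrightarrow> c = b + 6 \<Longrightarrow> bruns append_regs (Const c 0) f s 1 (f(b := []))"
  using bruns_clear[of f s b 1] by simp

lemma bruns_power':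
  assumes "bufs f s" "a \<in> {6..10}" "b \<in> {6..10}" "a \<noteq> b" "fst s 5 = N" "1 \<le> N" "length (f a) \<le> D"
    "f(b := power_word N (f a)) = f1"
  shows "bruns {12..<30} (power_prog b a) f s (N * (6 * D + 8) + 4) f1"
proof -
  have "N * (6 * length (f a) + 8) \<le> N * (6 * D + 8)" using assms(7) by (intro mult_le_mono2) simp
  then show ?thesis using bruns_power[OF assms(1-6), of "N * (6 * D + 8) + 4"] assms(8) by simp
qed

lemma bruns_push':
  assumes "bufs f s" "b \<in> {6..10}" "\<And>r. r \<in> set rs \<Longrightarrow> r \<notin> {12..<30}" "length rs \<le> D" "f(b := f b @ map (fst s) rs) = f1"
  shows "bruns {12..16} (push_prog b rs) f s (2 * D + 1) f1"
  unfolding assms(5)[symmetric] by (rule bruns_push[OF assms(1-2)]) (use assms(3,4) in auto)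

text \<open>Registers 12 and 14 are the lengths of arrays 6 and 8, so the two constants empty these
  arrays. Register 10 supplies \<open>m\<close>, and register 5 the power of two \<open>N\<close>
  used for the inverses.\<close>

definition build_prog :: "nat list \<Rightarrow> nat list \<Rightarrow> program" where
  "build_prog ys hs = block [Const 12 0, push_prog 6 ys, power_prog 7 6, Const 14 0, push_prog 8 hs, power_prog 9 8,
     Add 25 10 0, build_loop]"

lemma runs_build_prog:
  assumes f: "bufs f s" and N: "fst s 5 = N" "1 \<le> N" and m: "fst s 10 = m" "1 \<le> m" "m \<le> M"
    and regs: "\<And>r. r \<in> set ys \<union> set hs \<Longrightarrow> r \<notin> {12..<30}" and D: "length ys \<le> D" "length hs \<le> D" "1 \<le> D"
    and B: "8 * m\<^sup>2 * N * D \<le> B"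
  shows "runs (build_prog ys hs) s ((M + 2) * (72 * B + 4 * M + 100))
    (\<lambda>s'. \<exists>f'. bufs f' s' \<and> bframe s s' \<and> f' 6 = comm_word m (map (fst s) ys) (power_word N (map (fst s) ys)) (map (fst s) hs) (power_word N (map (fst s) hs)))"
proof -
  let ?y = "map (fst s) ys" and ?h = "map (fst s) hs"
  let ?f = "f(6 := ?y, 7 := power_word N ?y, 8 := ?h, 9 := power_word N ?h)"
  have mm: "1 \<le> m\<^sup>2" using m(2) by simp
  have ND: "8 * (N * D) \<le> B"
  proof -
    have "8 * (N * D) \<le> m\<^sup>2 * (8 * (N * D))" using mm by simp
    also have "\<dots> = 8 * m\<^sup>2 * N * D" by (simp add: mult_ac)
    finally show ?thesis using B by (rule le_trans)
  qed
  have N1: "N \<le> N * D" using D(3) by simp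
  let ?P = "N * (6 * D + 8) + 4"
  have P: "?P \<le> 2 * B + 4"
  proof -
    have "N * (6 * D + 8) \<le> 14 * (N * D)" using N1 by (simp add: algebra_simps)
    then show ?thesis using ND by linarith
  qed
  have regs': "map (fst s') hs = ?h" if "bframe s s'" for s' using regs frame_reg[OF that] by auto
  have fr: "bframe s s' \<Longrightarrow> fst s' 5 = N" "bframe s s' \<Longrightarrow> fst s' 10 = m" for s'
    using N m frame_reg[of "{12..<30}" "{6..10}" s s' 5] frame_reg[of "{12..<30}" "{6..10}" s s' 10] by auto
  have sub: "append_regs \<subseteq> {12..<30}" "{12..16} \<subseteq> {12..<30::nat}" by auto
  have lp: "runs (block [Add 25 10 0, build_loop]) s1 (m * (72 * B + 4 * M + 100) + 3)
     (\<lambda>s'. \<exists>f'. bufs f' s' \<and> bframe s s' \<and> f' 6 = comm_word m ?y (power_word N ?y) ?h (power_word N ?h))"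
    if s1: "bufs ?f s1" "bframe s s1" for s1
  proof -
    obtain \<rho> \<mu> where s1': "s1 = (\<rho>, \<mu>)" by fastforce
    define s2 where "s2 = (\<rho>(25 := m), \<mu>)"
    have r: "\<rho> 10 = m" "\<rho> 0 = 0" using fr(2)[OF s1(2)] s1(1) by (auto simp: s1' bufs_def)
    have b2: "bufs ?f s2" "bframe s s2" using s1 by (auto simp: bufs_def s2_def s1' frame_def)
    have X: "length (?f 6) + length (?f 7) + length (?f 8) + length (?f 9) \<le> 2 * (N * D)"
    proof -
      have t: "length xs + length (power_word N xs) = N * length xs" for xs :: "nat list"
        using N(2) by (cases N) simp_all
      have "length (?f 6) + length (?f 7) + length (?f 8) + length (?f 9) = N * length ys + N * length hs"
        using t[of ?y] t[of ?h] by simp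
      then show ?thesis using mult_le_mono2[OF D(1), of N] mult_le_mono2[OF D(2), of N] by linarith
    qed
    have B': "4 * m\<^sup>2 * (2 * (N * D)) \<le> B" using B by (simp add: mult_ac)
    have "2 * (N * D) \<le> B" using ND by simp
    from runs_build_loop[OF b2(1) _ m(3) X this B']
    have "runs build_loop s2 (m * (72 * B + 4 * M + 100) + 1)
      (\<lambda>s'. \<exists>f'. bufs f' s' \<and> bframe s s' \<and> f' 6 = comm_word m ?y (power_word N ?y) ?h (power_word N ?h))"
      by (rule runs_mono) (use b2(2) in \<open>auto simp: s2_def intro: frame_trans\<close>)
    then have "runs (block [build_loop]) s2 (m * (72 * B + 4 * M + 100) + 2)
      (\<lambda>s'. \<exists>f'. bufs f' s' \<and> bframe s s' \<and> f' 6 = comm_word m ?y (power_word N ?y) ?h (power_word N ?h))"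
      by (rule runs_block_single) simp
    then show ?thesis using r by (simp add: block_runs s1' s2_def)
  qed
  have "runs (build_prog ys hs) s (1 + ((2 * D + 1) + (?P + (1 + ((2 * D + 1) + (?P + (m * (72 * B + 4 * M + 100) + 3)))))))
    (\<lambda>s'. \<exists>f'. bufs f' s' \<and> bframe s s' \<and> f' 6 = comm_word m ?y (power_word N ?y) ?h (power_word N ?h))"
    (is "runs _ _ _ ?Q")
  proof -
    have regsy: "map (fst s') ys = ?y" if "bframe s s'" for s' using regs frame_reg[OF that] by auto
    show ?thesis
      unfolding build_prog_def
      apply (rule bruns_then[OF _ sub(1) frame_refl])
       apply (rule bruns_clear'[OF f, of 6], simp, simp)
      apply (rule bruns_then[OF _ sub(2)])
        apply (erule bruns_push'[where ?f1.0 = "f(6 := ?y)"], simp, use regs in blast, rule D, simp only: fun_upd_same fun_upd_upd append_Nil regsy)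
       apply assumption
      apply (rule bruns_then[OF _ subset_refl])
        apply (erule bruns_power'[where N = N and D = D and ?f1.0 = "f(6 := ?y, 7 := power_word N ?y)"], simp, simp, simp, erule fr, rule N(2), use D in simp, simp only: fun_upd_same)
       apply assumption
      apply (rule bruns_then[OF _ sub(1)])
        apply (erule bruns_clear'[where b = 8], simp, simp)
       apply assumption
      apply (rule bruns_then[OF _ sub(2)])
        apply (erule bruns_push'[where ?f1.0 = "f(6 := ?y, 7 := power_word N ?y, 8 := ?h)"], simp, use regs in blast, rule D, simp only: fun_upd_same fun_upd_upd append_Nil regs')
       apply assumption
      apply (rule bruns_then[OF _ subset_refl])
        apply (erule bruns_power'[where N = N and D = D and ?f1.0 = ?f], simp, simp, simp, erule fr, rule N(2), use D in simp, simp only: fun_upd_same)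
       apply assumption
      apply (rule lp)
       apply assumption
      apply assumption
      done
  qed
  then show ?thesis
  proof (rule runs_mono)
    have "D \<le> N * D" using N(2) by simp
    then have D': "8 * D \<le> B" using ND by (meson le_trans mult_le_mono2)
    define P' C where "P' = ?P" and "C = 72 * B + 4 * M + 100"
    have "m * C \<le> M * C" using m(3) by (rule mult_le_mono1)
    moreover have "4 * D + 2 * P' + 7 \<le> 2 * C"
    proof -
      have "4 * D \<le> B" "2 * P' \<le> 4 * B + 8" using P D' unfolding P'_def[symmetric] by simp_all
      then have "4 * D + 2 * P' + 7 \<le> B + (4 * B + 8) + 7" by simp
      also have "\<dots> \<le> 2 * C" by (simp add: C_def)
      finally show ?thesis .
    qed
    moreover have "(M + 2) * C = M * C + 2 * C" by simp
    ultimately show "1 + ((2 * D + 1) + (?P + (1 + ((2 * D + 1) + (?P + (m * (72 * B + 4 * M + 100) + 3)))))) \<le> (M + 2) * (72 * B + 4 * M + 100)"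
      unfolding P'_def[symmetric] C_def[symmetric] by linarith
  qed
qed

section \<open>Emitting letters\<close>

definition smat :: "(nat \<Rightarrow> nat) \<Rightarrow> nat \<Rightarrow> nat \<Rightarrow> nat \<times> nat \<times> nat \<times> nat" where
  "smat inp a j = (inp (a + 4 * j), inp (a + 4 * j + 1), inp (a + 4 * j + 2), inp (a + 4 * j + 3))"

context coded_group
begin

text \<open>One table entry of multiply and accumulate for 2 by 2 matrices over \<open>F\<close>:
  the result is computed when the program is written down, and the machine only stores four
  constants.\<close>

definition mac_prog :: "nat list \<Rightarrow> program" where
  "mac_prog vs = (case (vs ! 0, vs ! 1, vs ! 2, vs ! 3) \<oplus>\<^bsub>mat2 F\<^esub> (vs ! 4, vs ! 5, vs ! 6, vs ! 7) \<otimes>\<^bsub>mat2 F\<^esub> (vs ! 8, vs ! 9, vs ! 10, vs ! 11) of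
     (a, b, c, d) \<Rightarrow> block [Const 44 a, Const 45 b, Const 46 c, Const 47 d])"

abbreviation "mac_regs \<equiv> [44, 45, 46, 47, 48, 49, 50, 51, 52, 53, 54, 55::nat]"

definition mac_dispatch :: program where
  "mac_dispatch = dispatch q mac_regs mac_prog"

text \<open>Twelve registers are resolved in at most \<open>2 * q\<close> steps each; four
  assignments and the closing \<open>Skip\<close> follow.\<close>

lemma runs_mac:
  assumes "\<And>r. r \<in> set mac_regs \<Longrightarrow> \<rho> r < q"
    and "(\<rho> 44, \<rho> 45, \<rho> 46, \<rho> 47) \<oplus>\<^bsub>mat2 F\<^esub> (\<rho> 48, \<rho> 49, \<rho> 50, \<rho> 51) \<otimes>\<^bsub>mat2 F\<^esub> (\<rho> 52, \<rho> 53, \<rho> 54, \<rho> 55) = (a, b, c, d)"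
  shows "runs mac_dispatch (\<rho>, \<mu>) (24 * q + 5) (\<lambda>s'. \<exists>x. s' = (\<rho>(19 := x, 44 := a, 45 := b, 46 := c, 47 := d), \<mu>))"
proof -
  have m: "mac_prog (map \<rho> mac_regs) = block [Const 44 a, Const 45 b, Const 46 c, Const 47 d]"
    using assms(2) by (simp add: mac_prog_def eval_nat_numeral del: mat2_simps)
  have "runs (dispatch q mac_regs mac_prog) (\<rho>, \<mu>) (2 * q * length mac_regs + 5) (\<lambda>s'. \<exists>x. s' = (\<rho>(19 := x, 44 := a, 45 := b, 46 := c, 47 := d), \<mu>))"
    by (rule runs_dispatch, use assms(1) in force) (unfold m, auto simp: block_runs)
  then show ?thesis unfolding mac_dispatch_def by (rule runs_mono) auto
qed

text \<open>Register 36 runs upward through the coefficients of the left factor, while the address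
  in register 38 moves down by 4 through those of the letter, so the two indices always add up to
  \<open>i\<close>.\<close>

definition conv_loop :: program where
  "conv_loop = WhileLess 36 37 (block [Read 48 2 36, Read 49 3 36, Read 50 4 36, Read 51 5 36,
     Read 52 0 38, Add 39 38 1, Read 53 0 39, Add 39 39 1, Read 54 0 39, Add 39 39 1, Read 55 0 39, Sub 38 38 11,
     mac_dispatch, Add 36 36 1])"

lemma mconv_closed:
  "(\<And>j. j < k \<Longrightarrow> f j \<in> carrier (mat2 F)) \<Longrightarrow> (\<And>j. j < k \<Longrightarrow> g (i - j) \<in> carrier (mat2 F)) \<Longrightarrow> mconv f g i k \<in> carrier (mat2 F)"
proof -
  interpret MF: ring "mat2 F" by (rule mat2_ring[OF is_cring])
  show "(\<And>j. j < k \<Longrightarrow> f j \<in> carrier (mat2 F)) \<Longrightarrow> (\<And>j. j < k \<Longrightarrow> g (i - j) \<in> carrier (mat2 F)) \<Longrightarrow> mconv f g i k \<in> carrier (mat2 F)"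
    by (induction k) (simp_all del: mat2_simps)
qed

lemma quad_less: "(a, b, c, d) \<in> carrier (mat2 F) \<longleftrightarrow> a < q \<and> b < q \<and> c < q \<and> d < q"
  by (simp add: carrier_F)

lemma runs_conv_loop:
  assumes c: "\<rho> 1 = 1" "\<rho> 11 = 4" "\<rho> 36 = 0" "\<rho> 37 = i + 1" "\<rho> 38 = a + 4 * i" "(\<rho> 44, \<rho> 45, \<rho> 46, \<rho> 47) = \<zero>\<^bsub>mat2 F\<^esub>"
    and R: "\<And>j. j \<le> i \<Longrightarrow> (\<mu> 2 j, \<mu> 3 j, \<mu> 4 j, \<mu> 5 j) = R j" "\<And>j. j \<le> i \<Longrightarrow> R j \<in> carrier (mat2 F)"
    and a: "\<And>j. j \<le> i \<Longrightarrow> smat (\<mu> 0) a j \<in> carrier (mat2 F)"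
  shows "runs conv_loop (\<rho>, \<mu>) ((i + 1) * (24 * q + 20) + 1)
    (\<lambda>s'. \<exists>\<rho>'. s' = (\<rho>', \<mu>) \<and> (\<rho>' 44, \<rho>' 45, \<rho>' 46, \<rho>' 47) = mconv R (smat (\<mu> 0) a) i (Suc i) \<and>
      (\<forall>r. r \<notin> {19, 36, 38, 39} \<union> {44..<56} \<longrightarrow> \<rho>' r = \<rho> r))"
  unfolding conv_loop_def
proof (rule runs_While[where N = "i + 1" and T = "24 * q + 19" and I = "\<lambda>j s'. \<exists>\<rho>'. s' = (\<rho>', \<mu>) \<and> \<rho>' 36 = j \<and> \<rho>' 38 = a + 4 * i - 4 * j \<and>
    (\<rho>' 44, \<rho>' 45, \<rho>' 46, \<rho>' 47) = mconv R (smat (\<mu> 0) a) i j \<and> (\<forall>r. r \<notin> {19, 36, 38, 39} \<union> {44..<56} \<longrightarrow> \<rho>' r = \<rho> r)"])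
  let ?I = "\<lambda>j s'. \<exists>\<rho>'. s' = (\<rho>', \<mu>) \<and> \<rho>' 36 = j \<and> \<rho>' 38 = a + 4 * i - 4 * j \<and>
    (\<rho>' 44, \<rho>' 45, \<rho>' 46, \<rho>' 47) = mconv R (smat (\<mu> 0) a) i j \<and> (\<forall>r. r \<notin> {19, 36, 38, 39} \<union> {44..<56} \<longrightarrow> \<rho>' r = \<rho> r)"
  show "?I 0 (\<rho>, \<mu>)" using c by auto
next
  fix j \<rho>' \<mu>'
  assume j: "j < i + 1" and I: "\<exists>\<rho>''. (\<rho>', \<mu>') = (\<rho>'', \<mu>) \<and> \<rho>'' 36 = j \<and> \<rho>'' 38 = a + 4 * i - 4 * j \<and>
    (\<rho>'' 44, \<rho>'' 45, \<rho>'' 46, \<rho>'' 47) = mconv R (smat (\<mu> 0) a) i j \<and> (\<forall>r. r \<notin> {19, 36, 38, 39} \<union> {44..<56} \<longrightarrow> \<rho>'' r = \<rho> r)"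
  let ?I = "\<lambda>j s'. \<exists>\<rho>'. s' = (\<rho>', \<mu>) \<and> \<rho>' 36 = j \<and> \<rho>' 38 = a + 4 * i - 4 * j \<and>
    (\<rho>' 44, \<rho>' 45, \<rho>' 46, \<rho>' 47) = mconv R (smat (\<mu> 0) a) i j \<and> (\<forall>r. r \<notin> {19, 36, 38, 39} \<union> {44..<56} \<longrightarrow> \<rho>' r = \<rho> r)"
  have m: "\<mu>' = \<mu>" and r: "\<rho>' 36 = j" "\<rho>' 38 = a + 4 * (i - j)"
    "(\<rho>' 44, \<rho>' 45, \<rho>' 46, \<rho>' 47) = mconv R (smat (\<mu> 0) a) i j" "\<And>r. r \<notin> {19, 36, 38, 39} \<union> {44..<56} \<Longrightarrow> \<rho>' r = \<rho> r"
    using I j by auto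
  have r1: "\<rho>' 1 = 1" "\<rho>' (Suc 0) = 1" "\<rho>' 11 = 4" "\<rho>' 37 = i + 1" using r(4)[of 1] r(4)[of 11] r(4)[of 37] c by auto
  let ?p = "a + 4 * (i - j)"
  \<comment> \<open>In the last pass the address may fall below \<open>a\<close> or be cut off at 0
    by truncated subtraction; it is not read again.\<close>
  define \<rho>1 where "\<rho>1 = \<rho>'(48 := \<mu> 2 j, 49 := \<mu> 3 j, 50 := \<mu> 4 j, 51 := \<mu> 5 j,
    52 := \<mu> 0 ?p, 39 := Suc ?p, 53 := \<mu> 0 (Suc ?p), 39 := Suc (Suc ?p), 54 := \<mu> 0 (Suc (Suc ?p)),
    39 := Suc (Suc (Suc ?p)), 55 := \<mu> 0 (Suc (Suc (Suc ?p))), 38 := ?p - 4)"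
  have q1: "(\<rho>1 44, \<rho>1 45, \<rho>1 46, \<rho>1 47) = mconv R (smat (\<mu> 0) a) i j" using r(3) by (simp add: \<rho>1_def)
  have q2: "(\<rho>1 48, \<rho>1 49, \<rho>1 50, \<rho>1 51) = R j" using R(1)[of j] j by (simp add: \<rho>1_def)
  have q3: "(\<rho>1 52, \<rho>1 53, \<rho>1 54, \<rho>1 55) = smat (\<mu> 0) a (i - j)" by (simp add: \<rho>1_def smat_def eval_nat_numeral)
  have "mconv R (smat (\<mu> 0) a) i j \<in> carrier (mat2 F)" by (rule mconv_closed) (use R a j in auto)
  then have l1: "\<rho>1 44 < q" "\<rho>1 45 < q" "\<rho>1 46 < q" "\<rho>1 47 < q" unfolding q1[symmetric] by (simp_all only: quad_less)
  have l2: "\<rho>1 48 < q" "\<rho>1 49 < q" "\<rho>1 50 < q" "\<rho>1 51 < q" using R(2)[of j] j unfolding q2[symmetric] quad_less by auto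
  have l3: "\<rho>1 52 < q" "\<rho>1 53 < q" "\<rho>1 54 < q" "\<rho>1 55 < q" using a[of "i - j"] j unfolding q3[symmetric] quad_less by auto
  obtain A B C D where ABCD: "mconv R (smat (\<mu> 0) a) i (Suc j) = (A, B, C, D)" by (cases "mconv R (smat (\<mu> 0) a) i (Suc j)")
  have eq: "(\<rho>1 44, \<rho>1 45, \<rho>1 46, \<rho>1 47) \<oplus>\<^bsub>mat2 F\<^esub> (\<rho>1 48, \<rho>1 49, \<rho>1 50, \<rho>1 51) \<otimes>\<^bsub>mat2 F\<^esub> (\<rho>1 52, \<rho>1 53, \<rho>1 54, \<rho>1 55) = (A, B, C, D)"
    unfolding q1 q2 q3 using ABCD by (simp only: mconv.simps)
  have "runs (block [mac_dispatch, Add 36 36 1]) (\<rho>1, \<mu>) (24 * q + 7) (?I (Suc j))"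
  proof (rule runs_block_Cons[OF runs_mono[OF runs_mac[OF _ eq] order_refl]])
    fix r assume "r \<in> set mac_regs" then show "\<rho>1 r < q" using l1 l2 l3 by auto
  next
    fix s' assume "\<exists>x. s' = (\<rho>1(19 := x, 44 := A, 45 := B, 46 := C, 47 := D), \<mu>)"
    then obtain x where s': "s' = (\<rho>1(19 := x, 44 := A, 45 := B, 46 := C, 47 := D), \<mu>)" by blast
    show "runs (block [Add 36 36 1]) s' 2 (?I (Suc j))"
      unfolding s' using r r1 ABCD j by (simp add: block_runs \<rho>1_def)
  qed simp
  moreover define Q where "Q = ?I (Suc j)"
  ultimately have "runs (block [Read 48 2 36, Read 49 3 36, Read 50 4 36, Read 51 5 36,
     Read 52 0 38, Add 39 38 1, Read 53 0 39, Add 39 39 1, Read 54 0 39, Add 39 39 1, Read 55 0 39, Sub 38 38 11,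
     mac_dispatch, Add 36 36 1]) (\<rho>', \<mu>) (24 * q + 19) (?I (Suc j))"
    using r(1,2) r1 unfolding Q_def[symmetric] \<rho>1_def
    by (simp add: block_runs) (erule runs_mono, simp_all)
  then show "\<rho>' 36 < \<rho>' 37 \<and> runs (block [Read 48 2 36, Read 49 3 36, Read 50 4 36, Read 51 5 36,
     Read 52 0 38, Add 39 38 1, Read 53 0 39, Add 39 39 1, Read 54 0 39, Add 39 39 1, Read 55 0 39, Sub 38 38 11,
     mac_dispatch, Add 36 36 1]) (\<rho>', \<mu>') (24 * q + 19) (?I (Suc j))"
    using j r r1 unfolding m by simp
qed (use c in auto)

text \<open>Coefficients are replaced in place from the highest to the lowest. Coefficient
  \<open>i\<close> of the product involves the old coefficients up to \<open>i\<close> only, and in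
  this order these are still present.\<close>

definition update_loop :: program where
  "update_loop = WhileLess 0 34 (block [Sub 34 34 1, Sub 35 35 11, Const 44 \<zero>, Const 45 \<zero>, Const 46 \<zero>, Const 47 \<zero>,
     Const 36 0, Add 37 34 1, Add 38 35 0, conv_loop, Write 2 34 44, Write 3 34 45, Write 4 34 46, Write 5 34 47])"

definition letter_step :: "(nat \<Rightarrow> nat) \<Rightarrow> nat \<Rightarrow> (nat \<Rightarrow> nat \<times> nat \<times> nat \<times> nat) \<Rightarrow> nat \<Rightarrow> nat \<times> nat \<times> nat \<times> nat" where
  "letter_step inp a R i = mconv R (smat inp a) i (Suc i)"

abbreviation loop_regs :: "nat set" where "loop_regs \<equiv> {19} \<union> {34..<40} \<union> {44..<56}"

lemma runs_update_loop:
  assumes c: "\<rho> 0 = 0" "\<rho> 1 = 1" "\<rho> 11 = 4" "\<rho> 34 = n" "\<rho> 35 = a + 4 * n"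
    and R: "\<And>i. i < n \<Longrightarrow> (\<mu> 2 i, \<mu> 3 i, \<mu> 4 i, \<mu> 5 i) = R i" "\<And>i. i < n \<Longrightarrow> R i \<in> carrier (mat2 F)"
    and a: "\<And>j. j < n \<Longrightarrow> smat (\<mu> 0) a j \<in> carrier (mat2 F)"
  shows "runs update_loop (\<rho>, \<mu>) (n * (n * (24 * q + 20) + 16) + 1)
    (\<lambda>s'. (\<forall>i<n. (snd s' 2 i, snd s' 3 i, snd s' 4 i, snd s' 5 i) = letter_step (\<mu> 0) a R i) \<and> frame loop_regs {2..5} (\<rho>, \<mu>) s')"
  unfolding update_loop_def
proof (rule runs_While[where N = n and T = "n * (24 * q + 20) + 15" and
    I = "\<lambda>c s'. fst s' 34 = n - c \<and> fst s' 35 = a + 4 * (n - c) \<and> frame loop_regs {2..5} (\<rho>, \<mu>) s' \<and>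
      (\<forall>i<n. (snd s' 2 i, snd s' 3 i, snd s' 4 i, snd s' 5 i) = (if i < n - c then R i else letter_step (\<mu> 0) a R i))"])
  let ?I = "\<lambda>c s'. fst s' 34 = n - c \<and> fst s' 35 = a + 4 * (n - c) \<and> frame loop_regs {2..5} (\<rho>, \<mu>) s' \<and>
      (\<forall>i<n. (snd s' 2 i, snd s' 3 i, snd s' 4 i, snd s' 5 i) = (if i < n - c then R i else letter_step (\<mu> 0) a R i))"
  show "?I 0 (\<rho>, \<mu>)" using c R by auto
next
  fix k \<rho>' \<mu>'
  let ?I = "\<lambda>c s'. fst s' 34 = n - c \<and> fst s' 35 = a + 4 * (n - c) \<and> frame loop_regs {2..5} (\<rho>, \<mu>) s' \<and>
      (\<forall>i<n. (snd s' 2 i, snd s' 3 i, snd s' 4 i, snd s' 5 i) = (if i < n - c then R i else letter_step (\<mu> 0) a R i))"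
  assume k: "k < n" and I: "?I k (\<rho>', \<mu>')"
  define i where "i = n - Suc k"
  have i: "i < n" "n - k = Suc i" using k by (auto simp: i_def)
  have fr: "frame loop_regs {2..5} (\<rho>, \<mu>) (\<rho>', \<mu>')" and r: "\<rho>' 34 = Suc i" "\<rho>' 35 = a + 4 * Suc i"
    and q': "\<And>j. j < n \<Longrightarrow> (\<mu>' 2 j, \<mu>' 3 j, \<mu>' 4 j, \<mu>' 5 j) = (if j \<le> i then R j else letter_step (\<mu> 0) a R j)"
    using I unfolding i(2) by (auto simp: less_Suc_eq_le)
  have r1: "\<rho>' 0 = 0" "\<rho>' 1 = 1" "\<rho>' (Suc 0) = 1" "\<rho>' 11 = 4"
    using frame_reg[OF fr, of 0] frame_reg[OF fr, of 1] frame_reg[OF fr, of 11] c by auto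
  have m0: "\<mu>' 0 = \<mu> 0" using frame_array[OF fr, of 0] by simp
  define \<rho>1 where "\<rho>1 = \<rho>'(34 := i, 35 := a + 4 * i, 44 := \<zero>, 45 := \<zero>, 46 := \<zero>, 47 := \<zero>, 36 := 0, 37 := Suc i, 38 := a + 4 * i)"
  have cl: "runs conv_loop (\<rho>1, \<mu>') ((i + 1) * (24 * q + 20) + 1)
    (\<lambda>s'. \<exists>\<rho>2. s' = (\<rho>2, \<mu>') \<and> (\<rho>2 44, \<rho>2 45, \<rho>2 46, \<rho>2 47) = mconv R (smat (\<mu>' 0) a) i (Suc i) \<and>
      (\<forall>r. r \<notin> {19, 36, 38, 39} \<union> {44..<56} \<longrightarrow> \<rho>2 r = \<rho>1 r))"
    by (rule runs_conv_loop) (use r1 i R(2) a q' in \<open>auto simp: \<rho>1_def m0 simp del: mat2_simps(1)\<close>)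
  define Q where "Q = ?I (Suc k)"
  have "runs (block [conv_loop, Write 2 34 44, Write 3 34 45, Write 4 34 46, Write 5 34 47]) (\<rho>1, \<mu>') ((i + 1) * (24 * q + 20) + 6) Q"
  proof (rule runs_block_Cons[OF runs_mono[OF cl order_refl]])
    fix s' assume "\<exists>\<rho>2. s' = (\<rho>2, \<mu>') \<and> (\<rho>2 44, \<rho>2 45, \<rho>2 46, \<rho>2 47) = mconv R (smat (\<mu>' 0) a) i (Suc i) \<and>
      (\<forall>r. r \<notin> {19, 36, 38, 39} \<union> {44..<56} \<longrightarrow> \<rho>2 r = \<rho>1 r)"
    then obtain \<rho>2 where s': "s' = (\<rho>2, \<mu>')" "(\<rho>2 44, \<rho>2 45, \<rho>2 46, \<rho>2 47) = letter_step (\<mu> 0) a R i"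
      "\<And>r. r \<notin> {19, 36, 38, 39} \<union> {44..<56} \<Longrightarrow> \<rho>2 r = \<rho>1 r" unfolding m0 letter_step_def by blast
    have r2: "\<rho>2 34 = i" "\<rho>2 35 = a + 4 * i" using s'(3)[of 34] s'(3)[of 35] by (simp_all add: \<rho>1_def)
    define \<mu>2 where "\<mu>2 = \<mu>'(2 := (\<mu>' 2)(i := \<rho>2 44), 3 := (\<mu>' 3)(i := \<rho>2 45), 4 := (\<mu>' 4)(i := \<rho>2 46), 5 := (\<mu>' 5)(i := \<rho>2 47))"
    have f2: "frame loop_regs {2..5} (\<rho>, \<mu>) (\<rho>2, \<mu>2)"
    proof (rule frame_trans[OF fr])
      have "\<rho>2 r = \<rho>' r" if "r \<notin> loop_regs" for r using s'(3)[of r] that by (auto simp: \<rho>1_def)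
      then show "frame loop_regs {2..5} (\<rho>', \<mu>') (\<rho>2, \<mu>2)" by (auto simp: frame_def \<mu>2_def)
    qed
    have m2: "(\<mu>2 2 j, \<mu>2 3 j, \<mu>2 4 j, \<mu>2 5 j) = (if j < i then R j else letter_step (\<mu> 0) a R j)" if "j < n" for j
      using q'[OF that] s'(2) by (cases "j = i") (auto simp: \<mu>2_def)
    have "Q (\<rho>2, \<mu>2)" unfolding Q_def using f2 m2 r2 k i(2) by (simp add: i_def)
    then show "runs (block [Write 2 34 44, Write 3 34 45, Write 4 34 46, Write 5 34 47]) s' 5 Q"
      unfolding s'(1) \<mu>2_def using r2 by (simp add: block_runs)
  qed simp
  then have "runs (block [Sub 34 34 1, Sub 35 35 11, Const 44 \<zero>, Const 45 \<zero>, Const 46 \<zero>, Const 47 \<zero>,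
     Const 36 0, Add 37 34 1, Add 38 35 0, conv_loop, Write 2 34 44, Write 3 34 45, Write 4 34 46, Write 5 34 47]) (\<rho>', \<mu>') ((i + 1) * (24 * q + 20) + 15) Q"
    using r r1 unfolding \<rho>1_def by (simp add: block_runs)
  then have "runs (block [Sub 34 34 1, Sub 35 35 11, Const 44 \<zero>, Const 45 \<zero>, Const 46 \<zero>, Const 47 \<zero>,
     Const 36 0, Add 37 34 1, Add 38 35 0, conv_loop, Write 2 34 44, Write 3 34 45, Write 4 34 46, Write 5 34 47]) (\<rho>', \<mu>') (n * (24 * q + 20) + 15) Q"
    by (rule runs_mono) (use i mult_le_mono1[of "i + 1" n "24 * q + 20"] in auto)
  then show "\<rho>' 0 < \<rho>' 34 \<and> runs (block [Sub 34 34 1, Sub 35 35 11, Const 44 \<zero>, Const 45 \<zero>, Const 46 \<zero>, Const 47 \<zero>,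
     Const 36 0, Add 37 34 1, Add 38 35 0, conv_loop, Write 2 34 44, Write 3 34 45, Write 4 34 46, Write 5 34 47]) (\<rho>', \<mu>') (n * (24 * q + 20) + 15) (?I (Suc k))"
    using r r1 unfolding Q_def by simp
next
  fix \<rho>' \<mu>'
  assume I: "fst (\<rho>', \<mu>') 34 = n - n \<and> fst (\<rho>', \<mu>') 35 = a + 4 * (n - n) \<and> frame loop_regs {2..5} (\<rho>, \<mu>) (\<rho>', \<mu>') \<and>
      (\<forall>i<n. (snd (\<rho>', \<mu>') 2 i, snd (\<rho>', \<mu>') 3 i, snd (\<rho>', \<mu>') 4 i, snd (\<rho>', \<mu>') 5 i) = (if i < n - n then R i else letter_step (\<mu> 0) a R i))"
  then show "\<not> \<rho>' 0 < \<rho>' 34 \<and> (\<forall>i<n. (snd (\<rho>', \<mu>') 2 i, snd (\<rho>', \<mu>') 3 i, snd (\<rho>', \<mu>') 4 i, snd (\<rho>', \<mu>') 5 i) = letter_step (\<mu> 0) a R i) \<and> frame loop_regs {2..5} (\<rho>, \<mu>) (\<rho>', \<mu>')"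
    by simp
qed simp

definition copy_loop :: program where
  "copy_loop = WhileLess 31 3 (block [Read 33 0 32, Write 1 6 33, Add 6 6 1, Add 32 32 1, Add 31 31 1])"

lemma runs_copy_loop:
  assumes c: "\<rho> 1 = 1" "\<rho> 3 = L" "\<rho> 31 = 0" "\<rho> 32 = a" "\<rho> 6 = p"
  shows "runs copy_loop (\<rho>, \<mu>) (L * 7 + 1) (\<lambda>s'. frame {6, 31, 32, 33} {1} (\<rho>, \<mu>) s' \<and> fst s' 6 = p + L \<and>
    (\<forall>i<p. snd s' 1 i = \<mu> 1 i) \<and> (\<forall>i<L. snd s' 1 (p + i) = \<mu> 0 (a + i)))"
  unfolding copy_loop_def
proof (rule runs_While[where N = L and T = 6 and I = "\<lambda>k s'. frame {6, 31, 32, 33} {1} (\<rho>, \<mu>) s' \<and> fst s' 6 = p + k \<and> fst s' 31 = k \<and> fst s' 32 = a + k \<and>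
    (\<forall>i<p. snd s' 1 i = \<mu> 1 i) \<and> (\<forall>i<k. snd s' 1 (p + i) = \<mu> 0 (a + i))"])
  fix k \<rho>' \<mu>'
  assume k: "k < L" and I: "frame {6, 31, 32, 33} {1} (\<rho>, \<mu>) (\<rho>', \<mu>') \<and> fst (\<rho>', \<mu>') 6 = p + k \<and> fst (\<rho>', \<mu>') 31 = k \<and> fst (\<rho>', \<mu>') 32 = a + k \<and>
    (\<forall>i<p. snd (\<rho>', \<mu>') 1 i = \<mu> 1 i) \<and> (\<forall>i<k. snd (\<rho>', \<mu>') 1 (p + i) = \<mu> 0 (a + i))"
  have r: "\<rho>' (Suc 0) = 1" "\<rho>' 3 = L" "\<mu>' 0 = \<mu> 0" using I c by (auto simp: frame_def)
  show "\<rho>' 31 < \<rho>' 3 \<and> runs (block [Read 33 0 32, Write 1 6 33, Add 6 6 1, Add 32 32 1, Add 31 31 1]) (\<rho>', \<mu>') 6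
    (\<lambda>s'. frame {6, 31, 32, 33} {1} (\<rho>, \<mu>) s' \<and> fst s' 6 = p + Suc k \<and> fst s' 31 = Suc k \<and> fst s' 32 = a + Suc k \<and>
    (\<forall>i<p. snd s' 1 i = \<mu> 1 i) \<and> (\<forall>i<Suc k. snd s' 1 (p + i) = \<mu> 0 (a + i)))"
    using I r k by (auto simp: block_runs frame_def less_Suc_eq)
next
  fix \<rho>' \<mu>'
  assume I: "frame {6, 31, 32, 33} {1} (\<rho>, \<mu>) (\<rho>', \<mu>') \<and> fst (\<rho>', \<mu>') 6 = p + L \<and> fst (\<rho>', \<mu>') 31 = L \<and> fst (\<rho>', \<mu>') 32 = a + L \<and>
    (\<forall>i<p. snd (\<rho>', \<mu>') 1 i = \<mu> 1 i) \<and> (\<forall>i<L. snd (\<rho>', \<mu>') 1 (p + i) = \<mu> 0 (a + i))"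
  then have "\<rho>' 3 = L" using c by (auto simp: frame_def)
  then show "\<not> \<rho>' 31 < \<rho>' 3 \<and> frame {6, 31, 32, 33} {1} (\<rho>, \<mu>) (\<rho>', \<mu>') \<and> fst (\<rho>', \<mu>') 6 = p + L \<and>
    (\<forall>i<p. snd (\<rho>', \<mu>') 1 i = \<mu> 1 i) \<and> (\<forall>i<L. snd (\<rho>', \<mu>') 1 (p + i) = \<mu> 0 (a + i))"
    using I by simp
qed (use c in auto)

text \<open>
  While letters are emitted, the arrays 2 to 5 hold the coefficients \<open>R\<close> of the product of the inverse of the
  target with the word \<open>ws\<close> emitted so far; array 1 holds the codes of the letters of \<open>ws\<close>.
\<close>

definition emitted :: "(nat \<Rightarrow> nat) \<Rightarrow> (nat \<Rightarrow> nat \<times> nat \<times> nat \<times> nat) \<Rightarrow> nat list \<Rightarrow> machine_state \<Rightarrow> bool" where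
  "emitted inp R ws s \<longleftrightarrow> fst s 0 = 0 \<and> fst s 1 = 1 \<and> fst s 2 = n \<and> fst s 3 = 4 * n \<and> fst s 11 = 4 \<and> snd s 0 = inp \<and>
     (\<forall>i<n. (snd s 2 i, snd s 3 i, snd s 4 i, snd s 5 i) = R i) \<and>
     fst s 6 = 1 + 4 * n * length ws \<and> fst s 7 = length ws \<and>
     (\<forall>k<length ws. \<forall>i<4 * n. snd s 1 (1 + 4 * n * k + i) = inp (ws ! k + i))"

definition emit_letter :: program where
  "emit_letter = block [Const 31 0, Add 32 30 0, copy_loop, Add 7 7 1, Add 34 2 0, Add 35 30 3, update_loop]"

abbreviation emit_regs :: "nat set" where "emit_regs \<equiv> {6, 7, 19} \<union> {31..<40} \<union> {44..<56}"

lemma runs_emit_letter: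
  assumes e: "emitted inp R ws s" and a: "fst s 30 = a" "\<And>j. j < n \<Longrightarrow> smat inp a j \<in> carrier (mat2 F)"
    and R: "\<And>i. i < n \<Longrightarrow> R i \<in> carrier (mat2 F)"
  shows "runs emit_letter s (n * (n * (24 * q + 20) + 16) + 28 * n + 9) (\<lambda>s'. emitted inp (letter_step inp a R) (ws @ [a]) s' \<and> frame emit_regs {1..5} s s')"
proof -
  obtain \<rho> \<mu> where s: "s = (\<rho>, \<mu>)" by fastforce
  have r: "\<rho> 0 = 0" "\<rho> 1 = 1" "\<rho> (Suc 0) = 1" "\<rho> 2 = n" "\<rho> 3 = 4 * n" "\<rho> 11 = 4" "\<mu> 0 = inp" "\<rho> 30 = a"
      "\<rho> 6 = 1 + 4 * n * length ws" "\<rho> 7 = length ws"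
    using e a(1) by (auto simp: emitted_def s)
  define P where "P = (\<lambda>s'. emitted inp (letter_step inp a R) (ws @ [a]) s' \<and> frame emit_regs {1..5} s s')"
  define \<rho>1 where "\<rho>1 = \<rho>(31 := 0, 32 := a)"
  have "runs (block [copy_loop, Add 7 7 1, Add 34 2 0, Add 35 30 3, update_loop]) (\<rho>1, \<mu>) (n * (n * (24 * q + 20) + 16) + 28 * n + 7) P"
  proof (rule runs_block_Cons[OF runs_mono[OF runs_copy_loop order_refl]])
    show "\<rho>1 1 = 1" "\<rho>1 3 = 4 * n" "\<rho>1 31 = 0" "\<rho>1 32 = a" "\<rho>1 6 = 1 + 4 * n * length ws"
      using r by (auto simp: \<rho>1_def)
    fix s' assume s': "frame {6, 31, 32, 33} {1} (\<rho>1, \<mu>) s' \<and> fst s' 6 = 1 + 4 * n * length ws + 4 * n \<and>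
      (\<forall>i<1 + 4 * n * length ws. snd s' 1 i = \<mu> 1 i) \<and> (\<forall>i<4 * n. snd s' 1 (1 + 4 * n * length ws + i) = \<mu> 0 (a + i))"
    obtain \<rho>' \<mu>' where ss: "s' = (\<rho>', \<mu>')" by fastforce
    have f1: "frame {6, 31, 32, 33} {1} (\<rho>1, \<mu>) (\<rho>', \<mu>')" using s' ss by simp
    have r': "\<rho>' 0 = 0" "\<rho>' 1 = 1" "\<rho>' (Suc 0) = 1" "\<rho>' 2 = n" "\<rho>' 3 = 4 * n" "\<rho>' 11 = 4" "\<mu>' 0 = inp" "\<rho>' 30 = a" "\<rho>' 7 = length ws"
      "\<mu>' 2 = \<mu> 2" "\<mu>' 3 = \<mu> 3" "\<mu>' 4 = \<mu> 4" "\<mu>' 5 = \<mu> 5"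
      using f1 r by (auto simp: frame_def \<rho>1_def)
    define \<rho>2 where "\<rho>2 = \<rho>'(7 := Suc (length ws), 34 := n, 35 := a + 4 * n)"
    have f2: "frame emit_regs {1..5} s (\<rho>2, \<mu>')"
      using f1 unfolding s by (auto simp: frame_def \<rho>1_def \<rho>2_def)
    have "runs update_loop (\<rho>2, \<mu>') (n * (n * (24 * q + 20) + 16) + 1)
      (\<lambda>s'. (\<forall>i<n. (snd s' 2 i, snd s' 3 i, snd s' 4 i, snd s' 5 i) = letter_step (\<mu>' 0) a R i) \<and> frame loop_regs {2..5} (\<rho>2, \<mu>') s')"
      by (rule runs_update_loop) (use r' e a R in \<open>auto simp: \<rho>2_def emitted_def s simp del: mat2_simps(1)\<close>)
    then have "runs update_loop (\<rho>2, \<mu>') (n * (n * (24 * q + 20) + 16) + 1) P"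
    proof (rule runs_mono)
      fix s3 assume s3: "(\<forall>i<n. (snd s3 2 i, snd s3 3 i, snd s3 4 i, snd s3 5 i) = letter_step (\<mu>' 0) a R i) \<and> frame loop_regs {2..5} (\<rho>2, \<mu>') s3"
      have fr: "frame emit_regs {1..5} s s3"
        by (rule frame_trans[OF f2]) (rule frame_mono[of loop_regs "{2..5}"], use s3 in auto)
      have r3: "fst s3 0 = 0" "fst s3 1 = 1" "fst s3 2 = n" "fst s3 3 = 4 * n" "fst s3 11 = 4" "snd s3 0 = inp"
        using r unfolding s by (auto simp: frame_reg[OF fr] frame_array[OF fr] s)
      have r4: "fst s3 6 = 1 + 4 * n * length (ws @ [a])" "fst s3 7 = length (ws @ [a])" "snd s3 1 = \<mu>' 1"
        using s3 s' ss frame_reg[of loop_regs "{2..5}" "(\<rho>2, \<mu>')" s3] frame_array[of loop_regs "{2..5}" "(\<rho>2, \<mu>')" s3 1] by (auto simp: \<rho>2_def)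
      have out: "\<mu>' 1 (1 + 4 * n * k + i) = inp ((ws @ [a]) ! k + i)" if ki: "k < length (ws @ [a])" "i < 4 * n" for k i
      proof (cases "k = length ws")
        case True
        then show ?thesis using s' ss ki r by auto
      next
        case False
        then have k: "k < length ws" using ki by simp
        then have "4 * n * Suc k \<le> 4 * n * length ws" by (intro mult_le_mono2) simp
        then have "1 + 4 * n * k + i < 1 + 4 * n * length ws" using ki(2) by simp
        then have "\<mu>' 1 (1 + 4 * n * k + i) = \<mu> 1 (1 + 4 * n * k + i)" using s' ss by simp
        then show ?thesis using e k ki(2) by (simp add: emitted_def s nth_append)
      qed
      show "P s3" unfolding P_def emitted_def using fr r3 r4 out s3 r' by auto
    qed simp
    then show "runs (block [Add 7 7 1, Add 34 2 0, Add 35 30 3, update_loop]) s' (n * (n * (24 * q + 20) + 16) + 5) P"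
      unfolding ss using r' by (simp add: block_runs) (rule runs_block_single, simp add: \<rho>2_def, simp)
  qed simp
  then show ?thesis unfolding emit_letter_def s P_def[unfolded s, symmetric] using r
    by (simp add: block_runs \<rho>1_def P_def s) (erule runs_mono, simp_all)
qed

text \<open>Buffered words consist of addresses of generators in the input. Codes are fetched only
  on emission, so building a word costs one cell per letter and not \<open>4 * n\<close>.\<close>

definition emit_prog :: program where
  "emit_prog = block [Const 40 0, WhileLess 40 12 (block [Read 30 6 40, emit_letter, Add 40 40 1])]"

definition letter_steps :: "(nat \<Rightarrow> nat) \<Rightarrow> nat list \<Rightarrow> (nat \<Rightarrow> nat \<times> nat \<times> nat \<times> nat) \<Rightarrow> nat \<Rightarrow> nat \<times> nat \<times> nat \<times> nat" where
  "letter_steps inp = fold (letter_step inp)"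

lemma letter_step_closed:
  assumes "\<And>j. j < n \<Longrightarrow> smat inp a j \<in> carrier (mat2 F)" "\<And>i. i < n \<Longrightarrow> R i \<in> carrier (mat2 F)" "i < n"
  shows "letter_step inp a R i \<in> carrier (mat2 F)"
  unfolding letter_step_def by (rule mconv_closed) (use assms in auto)

lemma letter_steps_closed:
  "(\<And>a j. a \<in> set w \<Longrightarrow> j < n \<Longrightarrow> smat inp a j \<in> carrier (mat2 F)) \<Longrightarrow> (\<And>i. i < n \<Longrightarrow> R i \<in> carrier (mat2 F)) \<Longrightarrow> i < n \<Longrightarrow> letter_steps inp w R i \<in> carrier (mat2 F)"
proof (induction w arbitrary: R i)
  case (Cons a w)
  have "letter_steps inp w (letter_step inp a R) i \<in> carrier (mat2 F)"
    by (rule Cons.IH) (use Cons.prems letter_step_closed in auto)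
  then show ?case by (simp add: letter_steps_def)
qed (simp add: letter_steps_def)

lemma runs_emit_prog:
  assumes e: "emitted inp R ws s" and w: "fst s 12 = length w" "\<And>i. i < length w \<Longrightarrow> snd s 6 i = w ! i"
    and a: "\<And>a j. a \<in> set w \<Longrightarrow> j < n \<Longrightarrow> smat inp a j \<in> carrier (mat2 F)"
    and R: "\<And>i. i < n \<Longrightarrow> R i \<in> carrier (mat2 F)"
  shows "runs emit_prog s (length w * (n * (n * (24 * q + 20) + 16) + 28 * n + 13) + 3)
    (\<lambda>s'. emitted inp (letter_steps inp w R) (ws @ w) s' \<and> frame ({6, 7, 19} \<union> {30..<56}) {1..5} s s')"
proof -
  let ?E = "{6, 7, 19} \<union> {30..<56} :: nat set" and ?T = "n * (n * (24 * q + 20) + 16) + 28 * n"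
  obtain \<rho> \<mu> where s: "s = (\<rho>, \<mu>)" by fastforce
  define I where "I = (\<lambda>k s'. emitted inp (letter_steps inp (take k w) R) (ws @ take k w) s' \<and> frame ?E {1..5} s s' \<and> fst s' 40 = k)"
  have "runs (WhileLess 40 12 (block [Read 30 6 40, emit_letter, Add 40 40 1])) (\<rho>(40 := 0), \<mu>) (length w * (?T + 12 + 1) + 1)
    (\<lambda>s'. emitted inp (letter_steps inp w R) (ws @ w) s' \<and> frame ?E {1..5} s s')"
  proof (rule runs_While[where N = "length w" and T = "?T + 12" and I = I])
    show "I 0 (\<rho>(40 := 0), \<mu>)" using e unfolding I_def s by (auto simp: emitted_def letter_steps_def frame_def)
  next
    fix k \<rho>' \<mu>' assume k: "k < length w" and I: "I k (\<rho>', \<mu>')"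
    have fr: "frame ?E {1..5} s (\<rho>', \<mu>')" and e': "emitted inp (letter_steps inp (take k w) R) (ws @ take k w) (\<rho>', \<mu>')" and k': "\<rho>' 40 = k"
      using I by (auto simp: I_def)
    have r: "\<rho>' 12 = length w" "\<mu>' 6 k = w ! k" using frame_reg[OF fr, of 12] frame_array[OF fr, of 6] w k by auto
    define \<rho>1 where "\<rho>1 = \<rho>'(30 := w ! k)"
    have e1: "emitted inp (letter_steps inp (take k w) R) (ws @ take k w) (\<rho>1, \<mu>')"
      using e' by (simp add: emitted_def \<rho>1_def)
    have el: "runs emit_letter (\<rho>1, \<mu>') (?T + 9) (\<lambda>s'. emitted inp (letter_step inp (w ! k) (letter_steps inp (take k w) R)) ((ws @ take k w) @ [w ! k]) s' \<and> frame emit_regs {1..5} (\<rho>1, \<mu>') s')"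
      by (rule runs_emit_letter[OF e1]) (use a k R in \<open>auto simp: \<rho>1_def intro!: letter_steps_closed dest: in_set_takeD simp del: mat2_simps(1)\<close>)
    have "runs (block [emit_letter, Add 40 40 1]) (\<rho>1, \<mu>') (?T + 11) (I (Suc k))"
    proof (rule runs_block_Cons[OF runs_mono[OF el order_refl]])
      fix s2 assume s2: "emitted inp (letter_step inp (w ! k) (letter_steps inp (take k w) R)) ((ws @ take k w) @ [w ! k]) s2 \<and> frame emit_regs {1..5} (\<rho>1, \<mu>') s2"
      obtain \<rho>2 \<mu>2 where ss: "s2 = (\<rho>2, \<mu>2)" by fastforce
      have e2: "emitted inp (letter_steps inp (take (Suc k) w) R) (ws @ take (Suc k) w) (\<rho>2, \<mu>2)"
        using s2 k unfolding ss by (simp add: take_Suc_conv_app_nth letter_steps_def)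
      have r2: "\<rho>2 40 = k" "\<rho>2 (Suc 0) = 1" using s2 k' e2 unfolding ss by (auto simp: frame_def \<rho>1_def emitted_def)
      have "frame ?E {1..5} s (\<rho>2, \<mu>2)"
      proof (rule frame_trans[OF fr])
        show "frame ?E {1..5} (\<rho>', \<mu>') (\<rho>2, \<mu>2)" using s2 unfolding ss by (auto simp: frame_def \<rho>1_def)
      qed
      then have "I (Suc k) (\<rho>2(40 := Suc k), \<mu>2)" using e2 unfolding I_def by (auto simp: emitted_def frame_def)
      then show "runs (block [Add 40 40 1]) s2 2 (I (Suc k))" unfolding ss using r2 by (simp add: block_runs)
    qed simp
    then show "\<rho>' 40 < \<rho>' 12 \<and> runs (block [Read 30 6 40, emit_letter, Add 40 40 1]) (\<rho>', \<mu>') (?T + 12) (I (Suc k))"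
      using k k' r by (simp add: block_runs \<rho>1_def) (erule runs_mono, simp_all)
  next
    fix \<rho>' \<mu>' assume I: "I (length w) (\<rho>', \<mu>')"
    then have "frame ?E {1..5} s (\<rho>', \<mu>')" by (simp add: I_def)
    then have "\<rho>' 12 = length w" using w(1) frame_reg[of ?E "{1..5}" s "(\<rho>', \<mu>')" 12] by simp
    then show "\<not> \<rho>' 40 < \<rho>' 12 \<and> emitted inp (letter_steps inp w R) (ws @ w) (\<rho>', \<mu>') \<and> frame ?E {1..5} s (\<rho>', \<mu>')"
      using I by (simp add: I_def)
  qed simp
  then show ?thesis unfolding emit_prog_def s
    by (simp add: block_runs) (erule runs_block_single, simp)
qed

end

text \<open>Codes start with the lowest coefficients, so a class modulo a power of \<open>t\<close>
  is a prefix of the code. Monotonicity of prefixes makes the generators of one class a contiguous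
  stretch of the sorted input, which binary search can locate.\<close>

lemma take_mono_list:
  fixes xs ys :: "nat list"
  shows "xs \<le> ys \<Longrightarrow> take k xs \<le> take k ys"
proof (induction xs arbitrary: ys k)
  case (Cons x xs)
  then obtain y ys' where y: "ys = y # ys'" by (cases ys) auto
  show ?case
  proof (cases k)
    case (Suc j)
    then show ?thesis using Cons.prems Cons.IH[of ys' j] unfolding y by auto
  qed simp
qed simp

section \<open>Finding generators by binary search\<close>

definition read_prog :: "nat \<Rightarrow> program" where
  "read_prog k = block (concat (map (\<lambda>e. [Read (84 + e) 0 82, Add 82 82 1]) [0..<k]))"

lemma runs_read_prog:
  assumes "\<rho> 82 = a" "\<rho> 1 = 1"
  shows "runs (read_prog k) (\<rho>, \<mu>) (3 * k + 1) (\<lambda>s'. \<exists>\<rho>'. s' = (\<rho>', \<mu>) \<and> \<rho>' 82 = a + k \<and> (\<forall>e<k. \<rho>' (84 + e) = \<mu> 0 (a + e)) \<and>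
    (\<forall>r. r \<notin> {82} \<union> {84..<84 + k} \<longrightarrow> \<rho>' r = \<rho> r))"
proof (induction k)
  case 0
  then show ?case using assms by (simp add: read_prog_def block_runs)
next
  case (Suc k)
  have "runs (block (concat (map (\<lambda>e. [Read (84 + e) 0 82, Add 82 82 1]) [0..<k]) @ [Read (84 + k) 0 82, Add 82 82 1])) (\<rho>, \<mu>) (3 * k + 1 + 3)
    (\<lambda>s'. \<exists>\<rho>'. s' = (\<rho>', \<mu>) \<and> \<rho>' 82 = a + Suc k \<and> (\<forall>e<Suc k. \<rho>' (84 + e) = \<mu> 0 (a + e)) \<and>
    (\<forall>r. r \<notin> {82} \<union> {84..<84 + Suc k} \<longrightarrow> \<rho>' r = \<rho> r))"
  proof (rule runs_block_append[OF runs_mono[OF Suc[unfolded read_prog_def] order_refl]])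
    fix s' assume "\<exists>\<rho>'. s' = (\<rho>', \<mu>) \<and> \<rho>' 82 = a + k \<and> (\<forall>e<k. \<rho>' (84 + e) = \<mu> 0 (a + e)) \<and> (\<forall>r. r \<notin> {82} \<union> {84..<84 + k} \<longrightarrow> \<rho>' r = \<rho> r)"
    then obtain \<rho>' where s': "s' = (\<rho>', \<mu>)" "\<rho>' 82 = a + k" "\<And>e. e < k \<Longrightarrow> \<rho>' (84 + e) = \<mu> 0 (a + e)" "\<And>r. r \<notin> {82} \<union> {84..<84 + k} \<Longrightarrow> \<rho>' r = \<rho> r" by blast
    have "\<rho>' (Suc 0) = 1" using s'(4)[of 1] assms by simp
    then show "runs (block [Read (84 + k) 0 82, Add 82 82 1]) s' 3 (\<lambda>s'. \<exists>\<rho>'. s' = (\<rho>', \<mu>) \<and> \<rho>' 82 = a + Suc k \<and> (\<forall>e<Suc k. \<rho>' (84 + e) = \<mu> 0 (a + e)) \<and>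
      (\<forall>r. r \<notin> {82} \<union> {84..<84 + Suc k} \<longrightarrow> \<rho>' r = \<rho> r))"
      unfolding s'(1) using s'(2-4) by (auto simp: block_runs less_Suc_eq)
  qed simp
  then show ?case by (simp add: read_prog_def)
qed

text \<open>The relation of each possible tuple to a fixed code \<open>c\<close> is decided when the
  program is written down; at run time only the branch for the tuple read is chosen.\<close>

definition test_prog :: "nat \<Rightarrow> nat \<Rightarrow> (nat list \<Rightarrow> program) \<Rightarrow> program" where
  "test_prog q k f = Seq (read_prog k) (dispatch q [84..<84 + k] f)"

lemma runs_test_prog:
  assumes a: "\<rho> 82 = a" "\<rho> 1 = 1" and v: "vs = map (\<lambda>e. \<mu> 0 (a + e)) [0..<k]" "set vs \<subseteq> {..<q}"
    and f: "\<And>\<rho>'. (\<And>r. r \<notin> {19, 82} \<union> {84..<84 + k} \<Longrightarrow> \<rho>' r = \<rho> r) \<Longrightarrow> runs (f vs) (\<rho>', \<mu>) t Q"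
  shows "runs (test_prog q k f) (\<rho>, \<mu>) (3 * k + 1 + (2 * q * k + t)) Q"
  unfolding test_prog_def
proof (rule runs_Seq[OF runs_mono[OF runs_read_prog[OF a] order_refl]])
  fix s' assume "\<exists>\<rho>'. s' = (\<rho>', \<mu>) \<and> \<rho>' 82 = a + k \<and> (\<forall>e<k. \<rho>' (84 + e) = \<mu> 0 (a + e)) \<and> (\<forall>r. r \<notin> {82} \<union> {84..<84 + k} \<longrightarrow> \<rho>' r = \<rho> r)"
  then obtain \<rho>' where s': "s' = (\<rho>', \<mu>)" "\<And>e. e < k \<Longrightarrow> \<rho>' (84 + e) = \<mu> 0 (a + e)" "\<And>r. r \<notin> {82} \<union> {84..<84 + k} \<Longrightarrow> \<rho>' r = \<rho> r" by blast
  have m: "map \<rho>' [84..<84 + k] = vs"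
    unfolding v(1) by (rule nth_equalityI) (use s'(2) in auto)
  have "runs (dispatch q [84..<84 + k] f) (\<rho>', \<mu>) (2 * q * length [84..<84 + k] + t) Q"
  proof (rule runs_dispatch)
    fix r assume r: "r \<in> set [84..<84 + k]"
    then have "\<rho>' r \<in> set (map \<rho>' [84..<84 + k])" by auto
    then show "\<rho>' r < q \<and> r \<noteq> 19" using v(2) r unfolding m by auto
  next
    fix x show "runs (f (map \<rho>' [84..<84 + k])) (\<rho>'(19 := x), \<mu>) t Q"
      unfolding m by (rule f) (use s'(3) in auto)
  qed
  then show "runs (dispatch q [84..<84 + k] f) s' (2 * q * k + t) Q" unfolding s'(1) by simp
qed simp

text \<open>Tables of \<open>2 ^ k\<close> and of \<open>d * 2 ^ k\<close>, made by doubling, give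
  the binary search both its steps and the matching address offsets without multiplication. Register
  74 holds the length plus 1, so the doubling stops at the first power exceeding the length.\<close>

definition powers_prog :: program where
  "powers_prog = block [Const 71 1, Add 72 3 0, Const 73 0, Add 74 4 1,
     WhileLess 71 74 (block [Write 11 73 71, Write 12 73 72, Add 71 71 71, Add 72 72 72, Add 73 73 1])]"

lemma runs_powers_prog:
  assumes r: "\<rho> 0 = 0" "\<rho> 1 = 1" "\<rho> 3 = d" "\<rho> 4 = len" and len: "len \<le> 2 ^ M"
  shows "runs powers_prog (\<rho>, \<mu>) (7 * M + 14) (\<lambda>s'. frame {71..<75} {11, 12} (\<rho>, \<mu>) s' \<and>
    (\<exists>K\<le>M + 1. fst s' 73 = K \<and> len < 2 ^ K \<and> (\<forall>k<K. snd s' 11 k = 2 ^ k \<and> snd s' 12 k = d * 2 ^ k)))"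
proof -
  define K where "K = (LEAST k. len < 2 ^ k)"
  have "len < 2 ^ (M + 1)" using len by (simp add: less_le_trans[of _ "2 ^ M + 1"])
  then have K: "len < 2 ^ K" "K \<le> M + 1" unfolding K_def by (rule LeastI, rule Least_le)
  have K': "2 ^ k \<le> len" if "k < K" for k using that not_less_Least[of k "\<lambda>k. len < 2 ^ k"] by (simp add: K_def)
  let ?Q = "\<lambda>s'. frame {71..<75} {11, 12} (\<rho>, \<mu>) s' \<and>
    (\<exists>K\<le>M + 1. fst s' 73 = K \<and> len < 2 ^ K \<and> (\<forall>k<K. snd s' 11 k = 2 ^ k \<and> snd s' 12 k = d * 2 ^ k))"
  define I where "I = (\<lambda>i s'. frame {71..<75} {11, 12} (\<rho>, \<mu>) s' \<and> fst s' 71 = 2 ^ i \<and> fst s' 72 = d * 2 ^ i \<and> fst s' 73 = i \<and> fst s' 74 = len + 1 \<and>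
     (\<forall>k<i. snd s' 11 k = 2 ^ k \<and> snd s' 12 k = d * 2 ^ k))"
  have "runs (WhileLess 71 74 (block [Write 11 73 71, Write 12 73 72, Add 71 71 71, Add 72 72 72, Add 73 73 1]))
    (\<rho>(71 := 1, 72 := d, 73 := 0, 74 := len + 1), \<mu>) (K * (6 + 1) + 1) ?Q"
  proof (rule runs_While[where N = K and T = 6 and I = I])
    show "I 0 (\<rho>(71 := 1, 72 := d, 73 := 0, 74 := len + 1), \<mu>)" by (auto simp: I_def frame_def)
  next
    fix i \<rho>' \<mu>' assume i: "i < K" and I: "I i (\<rho>', \<mu>')"
    have 1: "\<rho>' (Suc 0) = 1" using I r by (auto simp: I_def frame_def)
    show "\<rho>' 71 < \<rho>' 74 \<and> runs (block [Write 11 73 71, Write 12 73 72, Add 71 71 71, Add 72 72 72, Add 73 73 1]) (\<rho>', \<mu>') 6 (I (Suc i))"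
      using I 1 K'[OF i] by (auto simp: I_def block_runs frame_def less_Suc_eq)
  next
    fix \<rho>' \<mu>' assume I: "I K (\<rho>', \<mu>')"
    then show "\<not> \<rho>' 71 < \<rho>' 74 \<and> ?Q (\<rho>', \<mu>')" using K by (auto simp: I_def)
  qed simp
  then have "runs (block [WhileLess 71 74 (block [Write 11 73 71, Write 12 73 72, Add 71 71 71, Add 72 72 72, Add 73 73 1])])
    (\<rho>(71 := 1, 72 := d, 73 := 0, 74 := len + 1), \<mu>) (7 * M + 10) ?Q"
    by (rule runs_block_single) (use K(2) in simp)
  then show ?thesis unfolding powers_prog_def using r
    by (simp add: block_runs) (erule runs_mono, simp_all)
qed

text \<open>This register holds the position in the input of some generator with class \<open>c\<close>, and 0 if there is none.\<close>

definition class_reg :: "nat list \<Rightarrow> nat" where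
  "class_reg c = 100 + to_nat c"

text \<open>Binary search by descending powers of two for the number of codes whose prefix lies
  below \<open>c\<close>. Register 76 holds the part of this number found so far and register 77 the
  address belonging to it. A step of \<open>2 ^ h\<close> is accepted when the last code it would
  cover, the one of index \<open>i + 2 ^ h - 1\<close>, still lies below \<open>c\<close>.\<close>

definition search_prog :: "nat \<Rightarrow> nat \<Rightarrow> nat list \<Rightarrow> program" where
  "search_prog q k c = block [Const 76 0, Add 77 75 0, Add 78 73 0,
     WhileLess 0 78 (block [Sub 78 78 1, Read 79 11 78, Read 80 12 78, Add 81 76 79,
       IfLess 4 81 Skip (block [Add 82 77 80, Sub 82 82 3,
         test_prog q k (\<lambda>vs. if vs < c then block [Add 76 81 0, Add 77 77 80] else Skip)])]),
     Const (class_reg c) 0,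
     IfLess 76 4 (block [Add 82 77 0, test_prog q k (\<lambda>vs. if vs = c then Add (class_reg c) 77 0 else Skip)]) Skip]"

lemma filter_down_closed:
  assumes "\<And>i j. i \<le> j \<Longrightarrow> j < length xs \<Longrightarrow> P (xs ! j) \<Longrightarrow> P (xs ! i)" "i < length xs"
  shows "P (xs ! i) \<longleftrightarrow> i < length (filter P xs)"
  using assms
proof (induction xs arbitrary: i)
  case (Cons x xs)
  have "P (xs ! i)" if "i \<le> j" "j < length xs" "P (xs ! j)" for i j
    using Cons.prems(1)[of "Suc i" "Suc j"] that by simp
  note IH = Cons.IH[OF this]
  show ?case
  proof (cases "P x")
    case True
    then show ?thesis using IH Cons.prems(2) by (cases i) auto
  next
    case False
    then have n: "\<not> P (xs ! j)" if "j < length xs" for j using Cons.prems(1)[of 0 "Suc j"] that by auto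
    then have "filter P xs = []" by (auto simp: filter_empty_conv in_set_conv_nth)
    then show ?thesis using False n Cons.prems(2) by (cases i) auto
  qed
qed simp

lemma runs_search_prog:
  fixes L :: "nat list list"
  assumes r: "\<rho> 0 = 0" "\<rho> 1 = 1" "\<rho> 3 = d" "\<rho> 4 = length L" "\<rho> 73 = K" "\<rho> 75 = b" and K: "length L < 2 ^ K"
    and pw: "\<And>i. i < K \<Longrightarrow> \<mu> 11 i = 2 ^ i \<and> \<mu> 12 i = d * 2 ^ i"
    and L: "sorted L" "\<And>i. i < length L \<Longrightarrow> length (L ! i) = d" "\<And>i. i < length L \<Longrightarrow> set (L ! i) \<subseteq> {..<q}"
    and inp: "\<And>i e. i < length L \<Longrightarrow> e < d \<Longrightarrow> \<mu> 0 (b + d * i + e) = L ! i ! e" and k: "k \<le> d" "k \<le> 16"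
  shows "runs (search_prog q k c) (\<rho>, \<mu>) (K * (3 * k + 2 * q * k + 20) + 3 * k + 2 * q * k + 20)
    (\<lambda>s'. frame ({19} \<union> {76..<84 + k} \<union> {class_reg c}) {} (\<rho>, \<mu>) s' \<and>
      (if c \<in> take k ` set L then \<exists>i<length L. take k (L ! i) = c \<and> fst s' (class_reg c) = b + d * i else fst s' (class_reg c) = 0))"
proof -
  let ?F = "{19} \<union> {76..<84 + k} :: nat set"
  \<comment> \<open>By sortedness this count is also the first index at which the prefix
    \<open>c\<close> can occur.\<close>
  define n where "n = length (filter (\<lambda>l. take k l < c) L)"
  have less_iff: "take k (L ! i) < c \<longleftrightarrow> i < n" if "i < length L" for i
  proof -
    have "take k (L ! i) < c" if "i \<le> j" "j < length L" "take k (L ! j) < c" for i j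
      using take_mono_list[OF sorted_nth_mono[OF L(1) that(1,2)], of k] that(3) by simp
    then show ?thesis using that unfolding n_def by (intro filter_down_closed) auto
  qed
  have n_len: "n \<le> length L" by (simp add: n_def)
  have vs: "map (\<lambda>e. \<mu> 0 (b + d * i + e)) [0..<k] = take k (L ! i)" if "i < length L" for i
    by (rule nth_equalityI) (use L(2)[OF that] inp[OF that] k in auto)
  have vsq: "set (take k (L ! i)) \<subseteq> {..<q}" if "i < length L" for i
    using L(3)[OF that] set_take_subset[of k "L ! i"] by blast
  let ?test = "test_prog q k (\<lambda>vs. if vs < c then block [Add 76 81 0, Add 77 77 80] else Skip)"
  let ?body = "block [Sub 78 78 1, Read 79 11 78, Read 80 12 78, Add 81 76 79, IfLess 4 81 Skip (block [Add 82 77 80, Sub 82 82 3, ?test])]"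
  let ?rest = "block [Const (class_reg c) 0, IfLess 76 4 (block [Add 82 77 0, test_prog q k (\<lambda>vs. if vs = c then Add (class_reg c) 77 0 else Skip)]) Skip]"
  let ?Q = "\<lambda>s'. frame (?F \<union> {class_reg c}) {} (\<rho>, \<mu>) s' \<and>
      (if c \<in> take k ` set L then \<exists>i<length L. take k (L ! i) = c \<and> fst s' (class_reg c) = b + d * i else fst s' (class_reg c) = 0)"
  define I where "I = (\<lambda>j s'. \<exists>\<rho>' i. s' = (\<rho>', \<mu>) \<and> frame ?F {} (\<rho>, \<mu>) s' \<and> \<rho>' 78 = K - j \<and> \<rho>' 76 = i \<and> \<rho>' 77 = b + d * i \<and> i \<le> n \<and> n < i + 2 ^ (K - j))"
  have loop: "runs (WhileLess 0 78 ?body) (\<rho>(76 := 0, 77 := b, 78 := K), \<mu>) (K * (3 * k + 2 * q * k + 16 + 1) + 1)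
     (\<lambda>s'. \<exists>\<rho>'. s' = (\<rho>', \<mu>) \<and> frame ?F {} (\<rho>, \<mu>) s' \<and> \<rho>' 76 = n \<and> \<rho>' 77 = b + d * n)"
  proof (rule runs_While[where N = K and T = "3 * k + 2 * q * k + 16" and I = I])
    show "I 0 (\<rho>(76 := 0, 77 := b, 78 := K), \<mu>)"
      using n_len K by (auto simp: I_def frame_def)
  next
    fix j \<rho>' \<mu>' assume j: "j < K" and "I j (\<rho>', \<mu>')"
    then obtain i where m: "\<mu>' = \<mu>" and fr: "frame ?F {} (\<rho>, \<mu>) (\<rho>', \<mu>)" and i: "\<rho>' 78 = K - j" "\<rho>' 76 = i" "\<rho>' 77 = b + d * i" "i \<le> n" "n < i + 2 ^ (K - j)"
      by (auto simp: I_def)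
    define h where "h = K - Suc j"
    have h: "K - j = Suc h" "h < K" using j by (auto simp: h_def)
    have r': "\<rho>' 0 = 0" "\<rho>' 1 = 1" "\<rho>' (Suc 0) = 1" "\<rho>' 3 = d" "\<rho>' 4 = length L" using fr r by (auto simp: frame_def)
    define \<rho>1 where "\<rho>1 = \<rho>'(78 := h, 79 := 2 ^ h, 80 := d * 2 ^ h, 81 := i + 2 ^ h)"
    have f1: "frame ?F {} (\<rho>, \<mu>) (\<rho>1, \<mu>)" using fr by (auto simp: frame_def \<rho>1_def)
    have "runs (IfLess 4 81 Skip (block [Add 82 77 80, Sub 82 82 3, ?test])) (\<rho>1, \<mu>) (3 * k + 2 * q * k + 10) (I (Suc j))"
    proof (cases "length L < i + 2 ^ h")
      case True
      then have "I (Suc j) (\<rho>1, \<mu>)" unfolding I_def using f1 i n_len h by (auto simp: \<rho>1_def h_def[symmetric])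
      then show ?thesis using True r' by (simp add: runs_simps \<rho>1_def)
    next
      case False
      \<comment> \<open>The last index covered by the attempted step; subtracting 1 here corresponds
        to subtracting \<open>d\<close> from the address.\<close>
      define p where "p = i + 2 ^ h - 1"
      have "1 \<le> (2::nat) ^ h" by simp
      then have p: "p < length L" "Suc p = i + 2 ^ h" using False unfolding p_def by linarith+
      have addr: "b + d * i + d * 2 ^ h - d = b + d * p"
      proof -
        have "d * i + d * 2 ^ h = d * Suc p" unfolding p(2) by (simp add: distrib_left)
        then show ?thesis by simp
      qed
      define \<rho>2 where "\<rho>2 = \<rho>1(82 := b + d * p)"
      have f2: "frame ?F {} (\<rho>, \<mu>) (\<rho>2, \<mu>)" using f1 by (auto simp: frame_def \<rho>2_def)
      have "runs ?test (\<rho>2, \<mu>) (3 * k + 1 + (2 * q * k + 3)) (I (Suc j))"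
      proof (rule runs_test_prog[where vs = "take k (L ! p)" and a = "b + d * p"])
        show "\<rho>2 82 = b + d * p" by (simp add: \<rho>2_def)
        show "\<rho>2 1 = 1" using r' by (simp add: \<rho>2_def \<rho>1_def)
        show "take k (L ! p) = map (\<lambda>e. \<mu> 0 (b + d * p + e)) [0..<k]" using vs[OF p(1)] ..
        show "set (take k (L ! p)) \<subseteq> {..<q}" by (rule vsq[OF p(1)])
        fix \<rho>3 assume e: "\<And>r. r \<notin> {19, 82} \<union> {84..<84 + k} \<Longrightarrow> \<rho>3 r = \<rho>2 r"
        have r3: "\<rho>3 76 = i" "\<rho>3 77 = b + d * i" "\<rho>3 78 = h" "\<rho>3 80 = d * 2 ^ h" "\<rho>3 81 = i + 2 ^ h" "\<rho>3 0 = 0"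
          using e[of 76] e[of 77] e[of 78] e[of 80] e[of 81] e[of 0] i r' by (simp_all add: \<rho>2_def \<rho>1_def)
        have f3: "frame ?F {} (\<rho>, \<mu>) (\<rho>3, \<mu>)"
          using f2 e unfolding frame_def by auto
        show "runs (if take k (L ! p) < c then block [Add 76 81 0, Add 77 77 80] else Skip) (\<rho>3, \<mu>) 3 (I (Suc j))"
        proof (cases "take k (L ! p) < c")
          case True
          then have "p < n" using less_iff[OF p(1)] by simp
          then have ii: "i + 2 ^ h \<le> n" "n < i + 2 ^ h + 2 ^ h" using p i(5) unfolding h(1) by auto
          have "frame ?F {} (\<rho>, \<mu>) (\<rho>3(76 := i + 2 ^ h, 77 := b + d * i + d * 2 ^ h), \<mu>)" using f3 by (auto simp: frame_def)
          then have "I (Suc j) (\<rho>3(76 := i + 2 ^ h, 77 := b + d * i + d * 2 ^ h), \<mu>)"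
            unfolding I_def using ii r3 by (auto simp: h_def[symmetric] algebra_simps)
          then show ?thesis using True r3 by (simp add: block_runs)
        next
          case False
          then have "n \<le> p" using less_iff[OF p(1)] by simp
          then have "n < i + 2 ^ h" using p by simp
          then have "I (Suc j) (\<rho>3, \<mu>)" unfolding I_def using f3 r3 i(4) by (auto simp: h_def[symmetric])
          then show ?thesis using False by (simp add: runs_simps)
        qed
      qed
      then have "runs (block [?test]) (\<rho>2, \<mu>) (3 * k + 2 * q * k + 5) (I (Suc j))" by (rule runs_block_single) simp
      then have "runs (block [Add 82 77 80, Sub 82 82 3, ?test]) (\<rho>1, \<mu>) (3 * k + 2 * q * k + 7) (I (Suc j))"
        using i(3) r' addr unfolding \<rho>2_def by (simp add: block_runs \<rho>1_def) (erule runs_mono, simp_all)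
      then show ?thesis
        by (rule runs_IfFalse[rotated]) (use False r' in \<open>auto simp: \<rho>1_def\<close>)
    qed
    then have "runs (block [IfLess 4 81 Skip (block [Add 82 77 80, Sub 82 82 3, ?test])]) (\<rho>1, \<mu>) (3 * k + 2 * q * k + 12) (I (Suc j))"
      by (rule runs_block_single) simp
    then have "runs ?body (\<rho>', \<mu>) (3 * k + 2 * q * k + 16) (I (Suc j))"
      using i r' pw[OF h(2)] h(1) unfolding \<rho>1_def by (simp add: block_runs) (erule runs_mono, simp_all)
    then show "\<rho>' 0 < \<rho>' 78 \<and> runs ?body (\<rho>', \<mu>') (3 * k + 2 * q * k + 16) (I (Suc j))"
      using i(1) j r' m by simp
  next
    fix \<rho>' \<mu>' assume "I K (\<rho>', \<mu>')"
    then obtain i where i: "\<mu>' = \<mu>" "frame ?F {} (\<rho>, \<mu>) (\<rho>', \<mu>)" "\<rho>' 78 = 0" "\<rho>' 76 = i" "\<rho>' 77 = b + d * i" "i \<le> n" "n < i + 1"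
      by (auto simp: I_def)
    then have "i = n" "\<rho>' 0 = 0" using r by (auto simp: frame_def)
    then show "\<not> \<rho>' 0 < \<rho>' 78 \<and> (\<exists>\<rho>''. (\<rho>', \<mu>') = (\<rho>'', \<mu>) \<and> frame ?F {} (\<rho>, \<mu>) (\<rho>', \<mu>') \<and> \<rho>'' 76 = n \<and> \<rho>'' 77 = b + d * n)"
      using i by auto
  qed simp
  have cr: "class_reg c \<ge> 100" by (simp add: class_reg_def)
  \<comment> \<open>No prefix from index \<open>n\<close> on lies below \<open>c\<close>, so an
    occurrence of \<open>c\<close> anywhere squeezes the prefix at index \<open>n\<close> to
    equality with \<open>c\<close>.\<close>
  have ex: "c \<in> take k ` set L \<longleftrightarrow> n < length L \<and> take k (L ! n) = c"
  proof
    assume "c \<in> take k ` set L"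
    then obtain i where i: "i < length L" "take k (L ! i) = c" by (auto simp: in_set_conv_nth)
    then have "n \<le> i" using less_iff[OF i(1)] by auto
    then have nl: "n < length L" using i by simp
    have "take k (L ! n) \<le> c" using take_mono_list[OF sorted_nth_mono[OF L(1) \<open>n \<le> i\<close> i(1)], of k] i by simp
    moreover have "\<not> take k (L ! n) < c" using less_iff[OF nl] by simp
    ultimately show "n < length L \<and> take k (L ! n) = c" using nl by auto
  qed auto
  have rest: "runs ?rest s' (3 * k + 2 * q * k + 10) ?Q"
    if "\<exists>\<rho>'. s' = (\<rho>', \<mu>) \<and> frame ?F {} (\<rho>, \<mu>) s' \<and> \<rho>' 76 = n \<and> \<rho>' 77 = b + d * n" for s'
  proof -
    from that obtain \<rho>' where s': "s' = (\<rho>', \<mu>)" "frame ?F {} (\<rho>, \<mu>) (\<rho>', \<mu>)" "\<rho>' 76 = n" "\<rho>' 77 = b + d * n" by auto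
    have r': "\<rho>' 0 = 0" "\<rho>' 1 = 1" "\<rho>' 4 = length L" using s'(2) r by (auto simp: frame_def)
    define \<rho>1 where "\<rho>1 = \<rho>'(class_reg c := 0)"
    have f1: "frame (?F \<union> {class_reg c}) {} (\<rho>, \<mu>) (\<rho>1, \<mu>)" using s'(2) by (auto simp: frame_def \<rho>1_def)
    have "runs (IfLess 76 4 (block [Add 82 77 0, test_prog q k (\<lambda>vs. if vs = c then Add (class_reg c) 77 0 else Skip)]) Skip) (\<rho>1, \<mu>) (3 * k + 2 * q * k + 8) ?Q"
    proof (cases "n < length L")
      case False
      then have "?Q (\<rho>1, \<mu>)" using f1 ex by (simp add: \<rho>1_def)
      then show ?thesis by (intro runs_IfFalse[where t = 1]) (use False s'(3) r' cr in \<open>auto simp: runs_simps \<rho>1_def\<close>)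
    next
      case True
      define \<rho>2 where "\<rho>2 = \<rho>1(82 := b + d * n)"
      have f2: "frame (?F \<union> {class_reg c}) {} (\<rho>, \<mu>) (\<rho>2, \<mu>)" using f1 by (auto simp: frame_def \<rho>2_def)
      have "runs (test_prog q k (\<lambda>vs. if vs = c then Add (class_reg c) 77 0 else Skip)) (\<rho>2, \<mu>) (3 * k + 1 + (2 * q * k + 1)) ?Q"
      proof (rule runs_test_prog[where vs = "take k (L ! n)" and a = "b + d * n"])
        show "\<rho>2 82 = b + d * n" by (simp add: \<rho>2_def)
        show "\<rho>2 1 = 1" using r' cr by (simp add: \<rho>2_def \<rho>1_def)
        show "take k (L ! n) = map (\<lambda>e. \<mu> 0 (b + d * n + e)) [0..<k]" using vs[OF True] ..
        show "set (take k (L ! n)) \<subseteq> {..<q}" by (rule vsq[OF True])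
        fix \<rho>3 assume e: "\<And>r. r \<notin> {19, 82} \<union> {84..<84 + k} \<Longrightarrow> \<rho>3 r = \<rho>2 r"
        have r3: "\<rho>3 77 = b + d * n" "\<rho>3 0 = 0" using e[of 77] e[of 0] s'(4) r' cr by (simp_all add: \<rho>2_def \<rho>1_def)
        have f3: "frame (?F \<union> {class_reg c}) {} (\<rho>, \<mu>) (\<rho>3, \<mu>)"
          using f2 e unfolding frame_def by auto
        show "runs (if take k (L ! n) = c then Add (class_reg c) 77 0 else Skip) (\<rho>3, \<mu>) 1 ?Q"
        proof (cases "take k (L ! n) = c")
          case t: True
          have "frame (?F \<union> {class_reg c}) {} (\<rho>, \<mu>) (\<rho>3(class_reg c := b + d * n), \<mu>)" using f3 by (auto simp: frame_def)
          then have H: "?Q (\<rho>3(class_reg c := b + d * n), \<mu>)" using ex t True by auto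
          define P where "P = ?Q"
          have "P (\<rho>3(class_reg c := b + d * n), \<mu>)" unfolding P_def by (rule H)
          then have "runs (if take k (L ! n) = c then Add (class_reg c) 77 0 else Skip) (\<rho>3, \<mu>) 1 P" using t r3 by (simp add: runs_simps)
          then show ?thesis unfolding P_def .
        next
          case t: False
          have "\<rho>3 (class_reg c) = 0" using e[of "class_reg c"] cr k(2) by (simp add: \<rho>2_def \<rho>1_def)
          then have H: "?Q (\<rho>3, \<mu>)" using ex t f3 by simp
          show ?thesis unfolding if_not_P[OF t] runs_atomic[OF exec.Skip] by (intro conjI[OF order_refl H])
        qed
      qed
      then have "runs (block [test_prog q k (\<lambda>vs. if vs = c then Add (class_reg c) 77 0 else Skip)]) (\<rho>2, \<mu>) (3 * k + 2 * q * k + 4) ?Q" by (rule runs_block_single) simp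
      then have "runs (block [Add 82 77 0, test_prog q k (\<lambda>vs. if vs = c then Add (class_reg c) 77 0 else Skip)]) (\<rho>1, \<mu>) (3 * k + 2 * q * k + 5) ?Q"
        using s'(4) r' cr unfolding \<rho>2_def by (simp add: block_runs \<rho>1_def split del: if_split) (erule runs_mono, simp, assumption)
      then show ?thesis
        by (rule runs_IfTrue[rotated]) (use True s'(3) r' cr in \<open>auto simp: \<rho>1_def\<close>)
    qed
    then have "runs (block [IfLess 76 4 (block [Add 82 77 0, test_prog q k (\<lambda>vs. if vs = c then Add (class_reg c) 77 0 else Skip)]) Skip]) (\<rho>1, \<mu>) (3 * k + 2 * q * k + 9) ?Q"
      by (rule runs_block_single) simp
    then show ?thesis unfolding s'(1) \<rho>1_def by (simp add: block_runs split del: if_split) (erule runs_mono, simp, assumption)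
  qed
  have "runs (block [WhileLess 0 78 ?body, Const (class_reg c) 0, IfLess 76 4 (block [Add 82 77 0, test_prog q k (\<lambda>vs. if vs = c then Add (class_reg c) 77 0 else Skip)]) Skip])
     (\<rho>(76 := 0, 77 := b, 78 := K), \<mu>) (K * (3 * k + 2 * q * k + 16 + 1) + 1 + (3 * k + 2 * q * k + 10)) ?Q"
    by (rule runs_block_Cons[OF runs_mono[OF loop order_refl]]) (rule rest, assumption, rule order_refl)
  moreover define T where "T = K * (3 * k + 2 * q * k + 16 + 1) + 1 + (3 * k + 2 * q * k + 10)"
  moreover define P where "P = ?Q"
  ultimately have "runs (search_prog q k c) (\<rho>, \<mu>) (T + 3) P"
    unfolding search_prog_def using r by (simp add: block_runs)
  then show ?thesis unfolding P_def
  proof (rule runs_mono)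
    have "K * (3 * k + 2 * q * k + 16 + 1) \<le> K * (3 * k + 2 * q * k + 20)" by (rule mult_le_mono2) simp
    then show "T + 3 \<le> K * (3 * k + 2 * q * k + 20) + 3 * k + 2 * q * k + 20" unfolding T_def by linarith
  qed
qed

section \<open>The main loop\<close>

context coded_group
begin

definition dir_prog :: "nat list set \<Rightarrow> nat \<Rightarrow> nat \<Rightarrow> nat \<Rightarrow> program" where
  "dir_prog A d c p = Seq (build_prog (map class_reg (base_word 3 A (target_y 3 d c (Suc p))))
     (map class_reg (base_word 3 A (target_h 3 d)))) emit_prog"

definition level_prog :: "nat list set \<Rightarrow> nat list \<Rightarrow> program" where
  "level_prog A vs = Seq (dir_prog A 2 (vs ! 0) (vs ! 3)) (Seq (dir_prog A 0 (vs ! 1 \<oplus> vs ! 0) (vs ! 3))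
     (dir_prog A 1 (vs ! 2 \<oplus> vs ! 0) (vs ! 3)))"

text \<open>Register 8 holds the level \<open>Suc p + 2 * j\<close>, with \<open>p\<close> in
  register 9 and \<open>j\<close> in register 10. This decomposition is advanced together with the
  level, which avoids a division. Three entries of the coefficient determine it, since its trace is
  zero.\<close>

definition step_prog :: "nat list set \<Rightarrow> program" where
  "step_prog A = block [Read 41 2 8, Read 42 3 8, Read 43 4 8, dispatch q [41, 42, 43, 9] (level_prog A),
     Add 8 8 1, IfLess 9 1 (Const 9 1) (block [Const 9 0, Add 10 10 1])]"

text \<open>The first word makes the remainder trivial modulo the \<open>m\<close>-th power of the
  variable. For \<open>m = 3\<close> the loop starts at level \<open>3 = 1 + 2 * 1\<close>, hence
  with \<open>p = 0\<close> and \<open>j = 1\<close>. The code of the target begins at address 1,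
  and the number of letters goes to address 0 of the output.\<close>

definition main_prog :: "nat \<Rightarrow> nat list set \<Rightarrow> program" where
  "main_prog m A = block [Const 82 1, Const 12 0,
     test_prog q (4 * m) (\<lambda>vs. Seq (push_prog 6 (map class_reg (base_word m A vs))) emit_prog),
     Const 8 m, Const 9 0, Const 10 1, WhileLess 8 2 (step_prog A), Write 1 0 7]"

definition emit_time :: nat where
  "emit_time = n * (n * (24 * q + 20) + 16) + 28 * n + 13"

text \<open>The value of \<open>8 * k^2 * N * q ^ 12\<close> for the largest \<open>k = n\<close>
  and the largest \<open>N = 2 * n\<close>.\<close>

definition word_bound :: nat where
  "word_bound = 16 * n ^ 3 * q ^ 12"

definition dir_time :: nat where
  "dir_time = (n + 2) * (72 * word_bound + 4 * n + 100) + word_bound * emit_time + 3"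

definition main_time :: nat where
  "main_time = n * (3 * dir_time + 8 * q + 20) + 100 * q + word_bound * emit_time + 2 * word_bound + 100"

lemma emitted_bframe: "emitted inp R ws s \<Longrightarrow> bframe s s' \<Longrightarrow> emitted inp R ws s'"
  by (simp add: emitted_def frame_def)

context
  fixes S A g inp pos N K m and elt :: "nat \<Rightarrow> nat trunc_mat"
  assumes S: "S \<subseteq> carrier SLn" "generate SLn S = carrier SLn" and g: "g \<in> carrier SLn"
    and A: "A = tcode m ` S" and m: "1 \<le> m" "m \<le> n" "m \<le> 3" "m = n \<or> m = 3"
    and N: "N = 2 ^ K" "n \<le> N" "N \<le> 2 * n"
    and elt: "\<And>l. elt l \<in> carrier SLn" and pos: "\<And>x. x \<in> A \<Longrightarrow> tcode m (elt (pos x)) = x"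
    and inp: "\<And>x j. x \<in> A \<Longrightarrow> j < n \<Longrightarrow> smat inp (pos x) j = mcoeff (elt (pos x)) j"
    and inp_g: "\<And>i. i < 4 * n \<Longrightarrow> inp (1 + i) = tcode n g ! i"
begin

text \<open>The error still to be removed. With the inverse of the target on the left, appending a
  letter to the word is one multiplication on the right.\<close>

abbreviation rest :: "nat list \<Rightarrow> nat trunc_mat" where
  "rest ws \<equiv> inv\<^bsub>SLn\<^esub> g \<otimes>\<^bsub>MR\<^esub> wv (map elt ws)"

definition main_state :: "nat list \<Rightarrow> machine_state \<Rightarrow> bool" where
  "main_state ws s \<longleftrightarrow> emitted inp (mcoeff (rest ws)) ws s \<and> (\<exists>f. bufs f s) \<and> fst s 5 = N \<and>
     (\<forall>x\<in>A. fst s (class_reg x) = pos x) \<and> set ws \<subseteq> pos ` A"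

lemma wv_elt: "wv (map elt ws) \<in> carrier SLn"
  using elt by (intro SL.word_value_closed) auto

lemma rest_SLn: "rest ws \<in> carrier SLn"
  using SL.m_closed[OF SL.inv_closed[OF g] wv_elt] by simp

lemma rest_MR: "rest ws \<in> carrier MR"
  by (rule SLn_MR[OF rest_SLn])

lemma wv_elt_append: "wv (map elt (xs @ ys)) = wv (map elt xs) \<otimes>\<^bsub>MR\<^esub> wv (map elt ys)"
  unfolding map_append using elt SL.word_value_append[of "map elt xs" "map elt ys"] by auto

lemma rest_append: "rest (ws @ w) = rest ws \<otimes>\<^bsub>MR\<^esub> wv (map elt w)"
  unfolding wv_elt_append
  by (rule M.m_assoc[symmetric]) (rule SLn_MR[OF SL.inv_closed[OF g]] SLn_MR[OF wv_elt])+

lemma smat_closed: "x \<in> A \<Longrightarrow> j < n \<Longrightarrow> smat inp (pos x) j \<in> carrier (mat2 F)"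
  unfolding inp using mcoeff_closed[OF SLn_MR[OF elt]] by simp

lemma letter_step_mcoeff:
  assumes "a \<in> pos ` A" "i < n" "\<And>j. j < n \<Longrightarrow> R j = mcoeff r j" "r \<in> carrier MR"
  shows "letter_step inp a R i = mcoeff (r \<otimes>\<^bsub>MR\<^esub> elt a) i"
proof -
  have "mcoeff (r \<otimes>\<^bsub>MR\<^esub> elt a) i = mconv (mcoeff r) (mcoeff (elt a)) i (Suc i)"
    by (rule mcoeff_mult) (use assms SLn_MR[OF elt] in auto)
  also have "\<dots> = mconv R (smat inp a) i (Suc i)"
    by (rule mconv_cong) (use assms inp in auto)
  finally show ?thesis by (simp add: letter_step_def del: mconv.simps)
qed

lemma letter_steps_mcoeff:
  assumes "set w \<subseteq> pos ` A" "i < n" "\<And>j. j < n \<Longrightarrow> R j = mcoeff (rest ws) j"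
  shows "letter_steps inp w R i = mcoeff (rest (ws @ w)) i"
  using assms
proof (induction w arbitrary: R ws)
  case (Cons a w)
  have "letter_steps inp w (letter_step inp a R) i = mcoeff (rest ((ws @ [a]) @ w)) i"
  proof (rule Cons.IH)
    fix j assume "j < n"
    then have "letter_step inp a R j = mcoeff (rest ws \<otimes>\<^bsub>MR\<^esub> elt a) j"
      by (intro letter_step_mcoeff) (use Cons.prems rest_MR in auto)
    then show "letter_step inp a R j = mcoeff (rest (ws @ [a])) j"
      unfolding rest_append using M.r_one[OF SLn_MR[OF elt[of a]]] by simp
  qed (use Cons.prems in auto)
  then show ?case by (simp add: letter_steps_def)
qed (simp add: letter_steps_def)

lemma runs_emit_main:
  assumes s: "main_state ws s" and f: "bufs f s" "f 6 = w" and w: "set w \<subseteq> pos ` A"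
  shows "runs emit_prog s (length w * emit_time + 3)
    (\<lambda>s'. main_state (ws @ w) s' \<and> frame ({6, 7, 19} \<union> {30..<56}) {1..5} s s')"
proof -
  let ?E = "{6, 7, 19} \<union> {30..<56} :: nat set"
  have e: "emitted inp (mcoeff (rest ws)) ws s" using s by (simp add: main_state_def)
  have w6: "fst s 12 = length w" "\<And>i. i < length w \<Longrightarrow> snd s 6 i = w ! i"
    using f by (auto simp: bufs_def dest: bspec[of _ _ 6])
  have "runs emit_prog s (length w * (n * (n * (24 * q + 20) + 16) + 28 * n + 13) + 3)
    (\<lambda>s'. emitted inp (letter_steps inp w (mcoeff (rest ws))) (ws @ w) s' \<and> frame ?E {1..5} s s')"
    by (rule runs_emit_prog[OF e w6]) (use w smat_closed mcoeff_closed[OF rest_MR] in \<open>auto simp del: mat2_simps(1)\<close>)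
  then show ?thesis unfolding emit_time_def
  proof (rule runs_mono)
    fix s' assume s': "emitted inp (letter_steps inp w (mcoeff (rest ws))) (ws @ w) s' \<and> frame ?E {1..5} s s'"
    have "emitted inp (mcoeff (rest (ws @ w))) (ws @ w) s'"
      using s' letter_steps_mcoeff[OF w] by (simp add: emitted_def)
    moreover have "bufs f s'" by (rule bufs_frame[OF f(1) s'[THEN conjunct2]]) auto
    moreover have "fst s' 5 = N" "\<forall>x\<in>A. fst s' (class_reg x) = pos x"
      using s s' by (auto simp: frame_def main_state_def class_reg_def)
    ultimately show "main_state (ws @ w) s' \<and> frame ?E {1..5} s s'"
      using s s' w unfolding main_state_def by auto
  qed simp
qed

lemma word_bound_ge: "k \<le> n \<Longrightarrow> 8 * k\<^sup>2 * N * q ^ 12 \<le> word_bound"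
proof -
  assume "k \<le> n"
  then have "k\<^sup>2 * N \<le> n\<^sup>2 * (2 * n)" using N(3) by (intro mult_mono power_mono) auto
  then have "8 * (k\<^sup>2 * N) * q ^ 12 \<le> 8 * (n\<^sup>2 * (2 * n)) * q ^ 12" by (intro mult_le_mono1 mult_le_mono2)
  also have "\<dots> = word_bound" by (simp add: word_bound_def power2_eq_square power3_eq_cube)
  finally show ?thesis by (simp add: mult_ac)
qed

lemma target_y_tcode:
  assumes "c \<in> carrier F" "1 \<le> j" "3 \<le> n"
  shows "\<exists>y\<in>carrier SLn. target_y 3 d c j = tcode 3 y"
proof -
  obtain y where y: "y \<in> carrier SLn" "\<And>i. i < n \<Longrightarrow> mcoeff y i = (if i = 0 then \<one>\<^bsub>mat2 F\<^esub> else if i = j then dirX d c else \<zero>\<^bsub>mat2 F\<^esub>)"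
    using ex_leading[OF assms(1,2), of d] by blast
  have "target_y 3 d c j = tcode 3 y" unfolding target_y_def tcode_eq by (rule code_cong) (use y assms(3) in auto)
  then show ?thesis using y(1) by blast
qed

lemma target_h_tcode:
  assumes "3 \<le> n"
  shows "\<exists>y\<in>carrier SLn. target_h 3 d = tcode 3 y"
proof -
  obtain h where h: "h \<in> carrier SLn" "\<And>i. i < n \<Longrightarrow> i \<le> 2 \<Longrightarrow> mcoeff h i = (if i \<le> 1 then \<one>\<^bsub>mat2 F\<^esub> else dirE d)"
    using ex_almost_scalar[of d] by blast
  have "target_h 3 d = tcode 3 h" unfolding target_h_def tcode_eq by (rule code_cong) (use h assms in auto)
  then show ?thesis using h(1) by blast
qed

lemma dir_word_facts:
  assumes m3: "m = 3" and c: "c \<in> carrier F" and p: "p \<le> 1" and mm: "1 \<le> k" "k \<le> n"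
  shows "set (dir_word A N pos (Suc p) k d c) \<subseteq> pos ` A" "length (dir_word A N pos (Suc p) k d c) \<le> word_bound"
    "set (base_word 3 A (target_y 3 d c (Suc p))) \<subseteq> A" "length (base_word 3 A (target_y 3 d c (Suc p))) \<le> q ^ 12"
    "set (base_word 3 A (target_h 3 d)) \<subseteq> A" "length (base_word 3 A (target_h 3 d)) \<le> q ^ 12"
proof -
  have n3: "3 \<le> n" using m m3 by simp
  obtain y h where y: "y \<in> carrier SLn" "target_y 3 d c (Suc p) = tcode 3 y" "h \<in> carrier SLn" "target_h 3 d = tcode 3 h"
    using target_y_tcode[OF c _ n3, of "Suc p" d] target_h_tcode[OF n3, of d] by auto
  show b: "set (base_word 3 A (target_y 3 d c (Suc p))) \<subseteq> A" "length (base_word 3 A (target_y 3 d c (Suc p))) \<le> q ^ 12"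
    "set (base_word 3 A (target_h 3 d)) \<subseteq> A" "length (base_word 3 A (target_h 3 d)) \<le> q ^ 12"
    unfolding y(2,4) A m3 using base_word[OF S y(1) n3] base_word[OF S y(3) n3] by simp_all
  show "set (dir_word A N pos (Suc p) k d c) \<subseteq> pos ` A"
    unfolding dir_word_def Let_def
    by (rule order_trans[OF set_comm_word]) (use b(1,3) set_power_word in \<open>fastforce\<close>)
  have "length (dir_word A N pos (Suc p) k d c) \<le> 8 * k\<^sup>2 * N * q ^ 12"
    by (rule length_dir_word[where S = S and A = A and pos = pos and elt = elt and K = K])
      (use S n3 A N pos elt c p mm m3 in auto)
  then show "length (dir_word A N pos (Suc p) k d c) \<le> word_bound" using word_bound_ge[OF mm(2)] by simp
qed

lemma runs_dir_prog:
  assumes m3: "m = 3" and s: "main_state ws s" and k: "fst s 10 = k" "1 \<le> k" "k \<le> n" and c: "c \<in> carrier F" and p: "p \<le> 1"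
  shows "runs (dir_prog A d c p) s dir_time (\<lambda>s'. main_state (ws @ dir_word A N pos (Suc p) k d c) s' \<and>
    fst s' 8 = fst s 8 \<and> fst s' 9 = fst s 9 \<and> fst s' 10 = fst s 10)"
proof -
  let ?y = "base_word 3 A (target_y 3 d c (Suc p))" and ?h = "base_word 3 A (target_h 3 d)"
  note facts = dir_word_facts[OF m3 c p k(2,3), of d]
  obtain f where f: "bufs f s" using s by (auto simp: main_state_def)
  have pw: "map (fst s) (map class_reg w) = map pos w" if "set w \<subseteq> A" for w
    using s that by (auto simp: main_state_def subset_iff)
  have N1: "fst s 5 = N" "1 \<le> N" using s N(2) m by (auto simp: main_state_def)
  have B: "8 * k\<^sup>2 * N * q ^ 12 \<le> word_bound" by (rule word_bound_ge[OF k(3)])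
  have q1: "1 \<le> q ^ 12" using q_ge2 by simp
  have b: "runs (build_prog (map class_reg ?y) (map class_reg ?h)) s ((n + 2) * (72 * word_bound + 4 * n + 100))
    (\<lambda>s'. \<exists>f'. bufs f' s' \<and> bframe s s' \<and> f' 6 = comm_word k (map (fst s) (map class_reg ?y)) (power_word N (map (fst s) (map class_reg ?y)))
       (map (fst s) (map class_reg ?h)) (power_word N (map (fst s) (map class_reg ?h))))"
    by (rule runs_build_prog[OF f N1 k _ _ _ q1 B]) (use facts in \<open>auto simp: class_reg_def\<close>)
  show ?thesis unfolding dir_prog_def
  proof (rule runs_Seq[OF runs_mono[OF b order_refl]])
    fix s1 assume "\<exists>f'. bufs f' s1 \<and> bframe s s1 \<and> f' 6 = comm_word k (map (fst s) (map class_reg ?y)) (power_word N (map (fst s) (map class_reg ?y)))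
       (map (fst s) (map class_reg ?h)) (power_word N (map (fst s) (map class_reg ?h)))"
    then obtain f' where f': "bufs f' s1" "bframe s s1" "f' 6 = dir_word A N pos (Suc p) k d c"
      unfolding pw[OF facts(3)] pw[OF facts(5)] by (auto simp: dir_word_def Let_def)
    have s1: "main_state ws s1"
      using s f' emitted_bframe[OF _ f'(2)] unfolding main_state_def by (auto simp: frame_def class_reg_def)
    have "length (dir_word A N pos (Suc p) k d c) * emit_time + 3 \<le> word_bound * emit_time + 3"
      using mult_le_mono1[OF facts(2)] by simp
    then show "runs emit_prog s1 (word_bound * emit_time + 3) (\<lambda>s'. main_state (ws @ dir_word A N pos (Suc p) k d c) s' \<and>
      fst s' 8 = fst s 8 \<and> fst s' 9 = fst s 9 \<and> fst s' 10 = fst s 10)"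
      by (rule runs_mono[OF runs_emit_main[OF s1 f'(1,3) facts(1)]]) (use f'(2) in \<open>auto simp: frame_def\<close>)
  qed (simp add: dir_time_def)
qed

text \<open>If \<open>n < 3\<close> then \<open>m = n\<close> and the loop ends before its first
  pass; the decomposition of the level into \<open>p\<close> and \<open>j\<close> is therefore
  demanded for \<open>m = 3\<close> only.\<close>

definition loop_state :: "nat \<Rightarrow> machine_state \<Rightarrow> bool" where
  "loop_state k s \<longleftrightarrow> (\<exists>ws p j. main_state ws s \<and> M.cong_s k (rest ws) \<one>\<^bsub>MR\<^esub> \<and> fst s 8 = k \<and>
     (m = 3 \<longrightarrow> fst s 9 = p \<and> fst s 10 = j \<and> p \<le> 1 \<and> 1 \<le> j \<and> k = Suc p + 2 * j) \<and>
     length ws \<le> q ^ 12 + (k - m) * (3 * word_bound))"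

lemma runs_step_prog:
  assumes m3: "m = 3" and k: "k < n" "m \<le> k" and s: "loop_state k s"
  shows "runs (step_prog A) s (3 * dir_time + 8 * q + 12) (loop_state (Suc k))"
proof -
  have n3: "3 \<le> n" using m m3 by simp
  obtain ws p j where ms: "main_state ws s" and cong: "M.cong_s k (rest ws) \<one>\<^bsub>MR\<^esub>" and r: "fst s 8 = k" "fst s 9 = p" "fst s 10 = j" "p \<le> 1" "1 \<le> j" "k = Suc p + 2 * j"
    and len: "length ws \<le> q ^ 12 + (k - m) * (3 * word_bound)" using s m3 unfolding loop_state_def by blast
  have j: "j \<le> n" using r k by simp
  obtain \<rho> \<mu> where s': "s = (\<rho>, \<mu>)" by fastforce
  obtain u f g' u' where X: "mcoeff (rest ws) k = (u, f, g', u')" by (cases "mcoeff (rest ws) k")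
  have e: "emitted inp (mcoeff (rest ws)) ws s" using ms by (simp add: main_state_def)
  then have v: "\<mu> 2 k = u" "\<mu> 3 k = f" "\<mu> 4 k = g'" using X k(1) by (auto simp: emitted_def s')
  have uF: "u \<in> carrier F" "f \<in> carrier F" "g' \<in> carrier F"
    using mcoeff_closed[OF rest_MR k(1), of ws] unfolding X by auto
  define \<rho>1 where "\<rho>1 = \<rho>(41 := u, 42 := f, 43 := g')"
  have ms1: "main_state ws (\<rho>1(19 := x), \<mu>)" for x
    using ms unfolding main_state_def s' by (auto simp: emitted_def bufs_def \<rho>1_def class_reg_def)
  define w1 where "w1 = dir_word A N pos (Suc p) j 2 u"
  define w2 where "w2 = dir_word A N pos (Suc p) j 0 (f \<oplus> u)"
  define w3 where "w3 = dir_word A N pos (Suc p) j 1 (g' \<oplus> u)"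
  have fu: "f \<oplus> u \<in> carrier F" "g' \<oplus> u \<in> carrier F" using uF by auto
  have lw: "level_word A N pos (Suc p) j (mcoeff (rest ws) k) = w1 @ w2 @ w3"
    unfolding X level_word_def w1_def w2_def w3_def by simp
  have r1: "\<rho>1 8 = k" "\<rho>1 9 = p" "\<rho>1 10 = j" using r by (auto simp: \<rho>1_def s')
  have lv: "runs (level_prog A [u, f, g', p]) (\<rho>1(19 := x), \<mu>) (3 * dir_time)
    (\<lambda>s'. main_state (ws @ w1 @ w2 @ w3) s' \<and> fst s' 8 = k \<and> fst s' 9 = p \<and> fst s' 10 = j)" for x
  proof -
    have 3: "runs (dir_prog A 1 (g' \<oplus> u) p) s3 dir_time (\<lambda>s'. main_state (ws @ w1 @ w2 @ w3) s' \<and> fst s' 8 = k \<and> fst s' 9 = p \<and> fst s' 10 = j)"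
      if "main_state ((ws @ w1) @ w2) s3 \<and> fst s3 8 = k \<and> fst s3 9 = p \<and> fst s3 10 = j" for s3
      by (rule runs_mono[OF runs_dir_prog[OF m3 that[THEN conjunct1] _ r(5) j fu(2) r(4)]]) (use that in \<open>auto simp: w3_def\<close>)
    have 2: "runs (Seq (dir_prog A 0 (f \<oplus> u) p) (dir_prog A 1 (g' \<oplus> u) p)) s3 (dir_time + dir_time) (\<lambda>s'. main_state (ws @ w1 @ w2 @ w3) s' \<and> fst s' 8 = k \<and> fst s' 9 = p \<and> fst s' 10 = j)"
      if "main_state (ws @ w1) s3 \<and> fst s3 8 = k \<and> fst s3 9 = p \<and> fst s3 10 = j" for s3
      by (rule runs_Seq[OF runs_mono[OF runs_dir_prog[OF m3 that[THEN conjunct1] _ r(5) j fu(1) r(4)] order_refl 3]]) (use that in \<open>auto simp: w2_def\<close>)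
    have "runs (Seq (dir_prog A 2 u p) (Seq (dir_prog A 0 (f \<oplus> u) p) (dir_prog A 1 (g' \<oplus> u) p))) (\<rho>1(19 := x), \<mu>) (3 * dir_time) (\<lambda>s'. main_state (ws @ w1 @ w2 @ w3) s' \<and> fst s' 8 = k \<and> fst s' 9 = p \<and> fst s' 10 = j)"
      by (rule runs_Seq[OF runs_mono[OF runs_dir_prog[OF m3 ms1 _ r(5) j uF(1) r(4)] order_refl 2]]) (use r1 in \<open>auto simp: w1_def\<close>)
    then show ?thesis by (simp add: level_prog_def eval_nat_numeral)
  qed
  have disp: "runs (dispatch q [41, 42, 43, 9] (level_prog A)) (\<rho>1, \<mu>) (2 * q * length [41, 42, 43, 9::nat] + 3 * dir_time)
     (\<lambda>s'. main_state (ws @ w1 @ w2 @ w3) s' \<and> fst s' 8 = k \<and> fst s' 9 = p \<and> fst s' 10 = j)"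
  proof (rule runs_dispatch)
    fix x assume "x \<in> set [41, 42, 43, 9::nat]"
    then show "\<rho>1 x < q \<and> x \<noteq> 19" using uF r(4) r1(2) q_ge2 by (auto simp: \<rho>1_def F_less)
  next
    have "map \<rho>1 [41, 42, 43, 9] = [u, f, g', p]" using r1(2) by (simp add: \<rho>1_def)
    then show "runs (level_prog A (map \<rho>1 [41, 42, 43, 9])) (\<rho>1(19 := x), \<mu>) (3 * dir_time)
     (\<lambda>s'. main_state (ws @ w1 @ w2 @ w3) s' \<and> fst s' 8 = k \<and> fst s' 9 = p \<and> fst s' 10 = j)" for x using lv[of x] by simp
  qed
  have cong': "M.cong_s (Suc k) (rest (ws @ w1 @ w2 @ w3)) \<one>\<^bsub>MR\<^esub>"
    unfolding rest_append lw[symmetric]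
    by (rule level_word_reduces[where S = S and A = A and pos = pos and elt = elt and K = K])
      (use S n3 A N pos elt rest_SLn cong k(1) r m3 in \<open>auto simp del: SLn_mult\<close>)
  have len': "length (ws @ w1 @ w2 @ w3) \<le> q ^ 12 + (Suc k - m) * (3 * word_bound)"
  proof -
    have "length w1 \<le> word_bound" "length w2 \<le> word_bound" "length w3 \<le> word_bound"
      using dir_word_facts(2)[OF m3 uF(1) r(4,5) j] dir_word_facts(2)[OF m3 fu(1) r(4,5) j] dir_word_facts(2)[OF m3 fu(2) r(4,5) j]
      by (auto simp: w1_def w2_def w3_def)
    moreover have "Suc k - m = Suc (k - m)" using k(2) by simp
    ultimately show ?thesis using len by simp
  qed
  have tail: "runs (block [Add 8 8 1, IfLess 9 1 (Const 9 1) (block [Const 9 0, Add 10 10 1])]) s2 6 (loop_state (Suc k))"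
    if s2: "main_state (ws @ w1 @ w2 @ w3) s2 \<and> fst s2 8 = k \<and> fst s2 9 = p \<and> fst s2 10 = j" for s2
  proof -
    obtain \<rho>2 \<mu>2 where ss: "s2 = (\<rho>2, \<mu>2)" by fastforce
    have r2: "\<rho>2 (Suc 0) = 1" "\<rho>2 1 = 1" "\<rho>2 0 = 0" "\<rho>2 8 = k" "\<rho>2 9 = p" "\<rho>2 10 = j" using s2 by (auto simp: main_state_def emitted_def ss)
    have up: "main_state (ws @ w1 @ w2 @ w3) (\<rho>2(8 := a, 9 := b), \<mu>2)" "main_state (ws @ w1 @ w2 @ w3) (\<rho>2(8 := a, 9 := b, 10 := c), \<mu>2)" for a b c
      using s2 unfolding main_state_def ss by (auto simp: emitted_def bufs_def class_reg_def)
    have up': "\<rho>2(8 := Suc k, 9 := 0, 10 := Suc j) = \<rho>2(9 := 0, 8 := Suc k, 10 := Suc j)" by auto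
    show ?thesis
    proof (cases "p = 0")
      case True
      then have "loop_state (Suc k) (\<rho>2(8 := Suc k, 9 := 1), \<mu>2)"
        unfolding loop_state_def using up(1) cong' len' r2 r by (intro exI[of _ "ws @ w1 @ w2 @ w3"] exI[of _ 1] exI[of _ j]) auto
      then have "runs (block [IfLess 9 1 (Const 9 1) (block [Const 9 0, Add 10 10 1])]) (\<rho>2(8 := Suc k), \<mu>2) 5 (loop_state (Suc k))"
        using True r2 by (intro runs_block_single[where ?t1.0 = 4]) (simp_all add: runs_simps block_runs)
      then show ?thesis using r2 by (simp add: ss block_runs)
    next
      case False
      then have p1: "p = 1" using r(4) by simp
      then have "loop_state (Suc k) (\<rho>2(8 := Suc k, 9 := 0, 10 := Suc j), \<mu>2)"
        unfolding loop_state_def using up(2) cong' len' r2 r by (intro exI[of _ "ws @ w1 @ w2 @ w3"] exI[of _ 0] exI[of _ "Suc j"]) auto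
      then have "runs (block [IfLess 9 1 (Const 9 1) (block [Const 9 0, Add 10 10 1])]) (\<rho>2(8 := Suc k), \<mu>2) 5 (loop_state (Suc k))"
        using p1 r2 by (intro runs_block_single[where ?t1.0 = 4]) (simp_all add: runs_simps block_runs)
      then show ?thesis using r2 by (simp add: ss block_runs)
    qed
  qed
  define D where "D = dispatch q [41, 42, 43, 9] (level_prog A)"
  have "runs (block [D, Add 8 8 1, IfLess 9 1 (Const 9 1) (block [Const 9 0, Add 10 10 1])]) (\<rho>1, \<mu>) (3 * dir_time + 8 * q + 6) (loop_state (Suc k))"
    unfolding D_def by (rule runs_block_Cons[OF runs_mono[OF disp order_refl tail]]) auto
  then show ?thesis unfolding step_prog_def D_def[symmetric] using r(1) v
    by (simp add: block_runs s' \<rho>1_def) (erule runs_mono, simp_all)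
qed

lemma runs_main_prog:
  assumes s: "main_state [] s"
  shows "runs (main_prog m A) s main_time (\<lambda>s'. \<exists>ws. set ws \<subseteq> pos ` A \<and> length ws \<le> q ^ 12 + n * (3 * word_bound) \<and>
     wv (map elt ws) = g \<and> snd s' 1 0 = length ws \<and> (\<forall>k<length ws. \<forall>i<4 * n. snd s' 1 (1 + 4 * n * k + i) = inp (ws ! k + i)))"
    (is "runs _ _ _ ?Q")
proof -
  obtain \<rho> \<mu> where s': "s = (\<rho>, \<mu>)" by fastforce
  obtain f where f: "bufs f s" using s by (auto simp: main_state_def)
  have r: "\<rho> 0 = 0" "\<rho> 1 = 1" "\<mu> 0 = inp" using s by (auto simp: main_state_def emitted_def s')
  let ?c = "tcode m g"
  let ?b = "base_word m A ?c"
  note b = base_word[OF S g m(2), folded A]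
  have q12: "q ^ (4 * m) \<le> q ^ 12" using m(3) q_ge2 by (intro power_increasing) auto
  have blen: "length ?b \<le> q ^ 12" using b(3) q12 by simp
  have bpos: "set (map pos ?b) \<subseteq> pos ` A" using b(1) by auto
  \<comment> \<open>The first word has the same class as \<open>g\<close>, so multiplying by the
    inverse of \<open>g\<close> gives 1 modulo the \<open>m\<close>-th power of the
    variable.\<close>
  have cl: "M.cong_s m (rest (map pos ?b)) \<one>\<^bsub>MR\<^esub>"
  proof -
    have set: "set (map elt (map pos ?b)) \<subseteq> carrier SLn" using elt by auto
    have "map (tcode m) (map elt (map pos ?b)) = ?b" using pos b(1) by (simp add: map_idI subset_iff)
    then have t: "tcode m (wv (map elt (map pos ?b))) = tcode m g"
      using tcode_word[OF set m(2)] b(2) by simp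
    have gM: "g \<in> carrier MR" "inv\<^bsub>SLn\<^esub> g \<in> carrier MR" "wv (map elt (map pos ?b)) \<in> carrier MR"
      by (rule SLn_MR g SL.inv_closed wv_elt)+
    have "mcoeff (wv (map elt (map pos ?b))) i = mcoeff g i" if "i < m" for i
      using arg_cong[OF t, of "\<lambda>x. decode x i"] that unfolding tcode_eq by simp
    then have "M.cong_s m (wv (map elt (map pos ?b))) g" unfolding cong_iff_mcoeff[OF gM(3) gM(1)] by simp
    from M.cong_mult[OF M.cong_refl[OF gM(2)] this] show ?thesis using SL.l_inv[OF g] by simp
  qed
  define \<rho>1 where "\<rho>1 = \<rho>(82 := 1, 12 := 0)"
  have tk: "?c = take (4 * m) (tcode n g)" using take_tcode[OF m(2)] by simp
  \<comment> \<open>The first \<open>4 * m\<close> numbers of the code of \<open>g\<close> form the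
    code of its class.\<close>
  have dec: "vs = ?c" if "vs = map (\<lambda>e. inp (1 + e)) [0..<4 * m]" for vs
    unfolding that tk by (rule nth_equalityI) (use inp_g m(2) in auto)
  have fin: "runs (block [Const 8 m, Const 9 0, Const 10 1, WhileLess 8 2 (step_prog A), Write 1 0 7]) s2 (n * (3 * dir_time + 8 * q + 13) + 7) ?Q"
    if s2: "main_state (map pos ?b) s2" for s2
  proof -
    obtain \<rho>2 \<mu>2 where ss: "s2 = (\<rho>2, \<mu>2)" by fastforce
    define \<rho>3 where "\<rho>3 = \<rho>2(8 := m, 9 := 0, 10 := 1)"
    have "main_state (map pos ?b) (\<rho>3, \<mu>2)"
      using s2 unfolding main_state_def ss \<rho>3_def by (auto simp: emitted_def bufs_def class_reg_def)
    then have l0: "loop_state m (\<rho>3, \<mu>2)"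
      unfolding loop_state_def using cl blen by (intro exI[of _ "map pos ?b"] exI[of _ 0] exI[of _ 1]) (auto simp: \<rho>3_def)
    have l2: "fst s 2 = n" "fst s 8 = k" if "loop_state k s" for k s
      using that by (auto simp: loop_state_def main_state_def emitted_def)
    have loop: "runs (WhileLess 8 2 (step_prog A)) (\<rho>3, \<mu>2) (n * (3 * dir_time + 8 * q + 12 + 1) + 1) (loop_state n)"
    proof (rule runs_While[where I = "\<lambda>i. loop_state (m + i)" and N = "n - m" and T = "3 * dir_time + 8 * q + 12"])
      fix i \<rho>' \<mu>' assume i: "i < n - m" and I: "loop_state (m + i) (\<rho>', \<mu>')"
      then have "m = 3" using m(4) by auto
      then show "\<rho>' 8 < \<rho>' 2 \<and> runs (step_prog A) (\<rho>', \<mu>') (3 * dir_time + 8 * q + 12) (loop_state (m + Suc i))"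
        using runs_step_prog[of "m + i", OF _ _ _ I] i l2[OF I] by simp
    next
      fix \<rho>' \<mu>' assume I: "loop_state (m + (n - m)) (\<rho>', \<mu>')"
      then show "\<not> \<rho>' 8 < \<rho>' 2 \<and> loop_state n (\<rho>', \<mu>')" using l2[OF I] m(2) by simp
    next
      show "(n - m) * (3 * dir_time + 8 * q + 12 + 1) + 1 \<le> n * (3 * dir_time + 8 * q + 12 + 1) + 1"
        by (intro add_mono mult_le_mono1) auto
    qed (use l0 in auto)
    have wr: "runs (block [Write 1 0 7]) s4 2 ?Q" if s4: "loop_state n s4" for s4
    proof -
      obtain ws where ws: "main_state ws s4" "M.cong_s n (rest ws) \<one>\<^bsub>MR\<^esub>" "length ws \<le> q ^ 12 + (n - m) * (3 * word_bound)"
        using s4 by (auto simp: loop_state_def)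
      obtain \<rho>4 \<mu>4 where s4': "s4 = (\<rho>4, \<mu>4)" by fastforce
      \<comment> \<open>At level \<open>n\<close> the congruence covers all coefficients and becomes
        equality.\<close>
      have "rest ws = \<one>\<^bsub>MR\<^esub>"
        by (rule mcoeff_inject[OF rest_MR M.one_closed]) (use ws(2) cong_iff_mcoeff[OF rest_MR M.one_closed] in blast)
      then have "inv\<^bsub>SLn\<^esub> g \<otimes>\<^bsub>SLn\<^esub> wv (map elt ws) = \<one>\<^bsub>SLn\<^esub>" by simp
      then have wg: "wv (map elt ws) = g"
        using SL.inv_equality[OF _ wv_elt[of ws] SL.inv_closed[OF g]] SL.inv_inv[OF g] SL.inv_inv[OF wv_elt[of ws]] by metis
      have e: "emitted inp (mcoeff (rest ws)) ws s4" "set ws \<subseteq> pos ` A" using ws(1) by (auto simp: main_state_def)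
      have "(n - m) * (3 * word_bound) \<le> n * (3 * word_bound)" by (rule mult_le_mono1) simp
      then have len: "length ws \<le> q ^ 12 + n * (3 * word_bound)" using ws(3) by linarith
      have out: "\<forall>k<length ws. \<forall>i<4 * n. \<mu>4 1 (1 + 4 * n * k + i) = inp (ws ! k + i)"
        using e(1) unfolding s4' emitted_def by simp
      have "?Q (\<rho>4, \<mu>4(1 := (\<mu>4 1)(0 := length ws)))"
        using e(2) wg len out by (intro exI[of _ ws]) simp
      moreover define P where "P = ?Q"
      ultimately have "runs (block [Write 1 0 7]) s4 2 P"
        using e unfolding s4' by (simp add: block_runs emitted_def)
      then show ?thesis unfolding P_def .
    qed
    have "runs (block [WhileLess 8 2 (step_prog A), Write 1 0 7]) (\<rho>3, \<mu>2) (n * (3 * dir_time + 8 * q + 13) + 3) ?Q"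
      by (rule runs_block_Cons[OF runs_mono[OF loop order_refl wr]]) auto
    moreover define P where "P = ?Q"
    ultimately have "runs (block [Const 8 m, Const 9 0, Const 10 1, WhileLess 8 2 (step_prog A), Write 1 0 7]) s2 (n * (3 * dir_time + 8 * q + 13) + 7) P"
      unfolding ss \<rho>3_def by (simp add: block_runs) (erule runs_mono, simp_all)
    then show ?thesis unfolding P_def .
  qed
  have tst: "runs (test_prog q (4 * m) (\<lambda>vs. Seq (push_prog 6 (map class_reg (base_word m A vs))) emit_prog)) (\<rho>1, \<mu>)
     (3 * (4 * m) + 1 + (2 * q * (4 * m) + (2 * q ^ 12 + 1 + (q ^ 12 * emit_time + 3)))) (main_state (map pos ?b))"
  proof (rule runs_test_prog[where a = 1 and vs = ?c])
    show "\<rho>1 82 = 1" "\<rho>1 1 = 1" using r by (auto simp: \<rho>1_def)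
    show "?c = map (\<lambda>e. \<mu> 0 (1 + e)) [0..<4 * m]" using dec r(3) by simp
    show "set ?c \<subseteq> {..<q}" by (rule tcode_closed[OF SLn_MR[OF g] m(2)])
    fix \<rho>' assume "\<And>r. r \<notin> {19, 82} \<union> {84..<84 + 4 * m} \<Longrightarrow> \<rho>' r = \<rho>1 r"
    then have e: "\<And>r. r \<notin> {19, 82} \<union> {84..<96} \<Longrightarrow> \<rho>' r = \<rho>1 r" using m(3) by auto
    have ms: "main_state [] (\<rho>', \<mu>)"
    proof -
      have "\<rho>' x = \<rho> x" if "x \<in> {0, 1, 2, 3, 11, 5, 6, 7} \<or> x \<ge> 100" for x
        using that e[of x] by (auto simp: \<rho>1_def)
      moreover have "bufs (f(6 := [])) (\<rho>', \<mu>)"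
        using f e by (auto simp: bufs_def s' \<rho>1_def)
      ultimately show ?thesis using s unfolding main_state_def s' emitted_def by (auto simp: class_reg_def)
    qed
    have bf: "bufs (f(6 := [])) (\<rho>', \<mu>)" using f e by (auto simp: bufs_def s' \<rho>1_def)
    have mp: "map (fst (\<rho>', \<mu>)) (map class_reg ?b) = map pos ?b"
      using ms b(1) by (auto simp: main_state_def subset_iff)
    have push: "bruns {12..16} (push_prog 6 (map class_reg ?b)) (f(6 := [])) (\<rho>', \<mu>) (2 * q ^ 12 + 1) (f(6 := map pos ?b))"
      by (rule bruns_push'[OF bf]) (use blen mp in \<open>auto simp: class_reg_def\<close>)
    show "runs (Seq (push_prog 6 (map class_reg ?b)) emit_prog) (\<rho>', \<mu>) (2 * q ^ 12 + 1 + (q ^ 12 * emit_time + 3)) (main_state (map pos ?b))"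
    proof (rule runs_Seq[OF runs_mono[OF push[unfolded bruns_def] order_refl]])
      fix s5 assume s5: "bufs (f(6 := map pos ?b)) s5 \<and> frame {12..16} {6..10} (\<rho>', \<mu>) s5"
      have fr: "bframe (\<rho>', \<mu>) s5" using s5 by (auto intro: frame_mono)
      have ms5: "main_state [] s5"
        using ms s5 emitted_bframe[OF _ fr] fr unfolding main_state_def by (auto simp: frame_def class_reg_def)
      have le: "length (map pos ?b) * emit_time + 3 \<le> q ^ 12 * emit_time + 3" using mult_le_mono1[OF blen] by simp
      have "(f(6 := map pos ?b)) 6 = map pos ?b" by simp
      from runs_mono[OF runs_emit_main[OF ms5 s5[THEN conjunct1] this bpos] le]
      show "runs emit_prog s5 (q ^ 12 * emit_time + 3) (main_state (map pos ?b))" by simp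
    qed simp
  qed
  have "runs (block [test_prog q (4 * m) (\<lambda>vs. Seq (push_prog 6 (map class_reg (base_word m A vs))) emit_prog), Const 8 m, Const 9 0, Const 10 1, WhileLess 8 2 (step_prog A), Write 1 0 7]) (\<rho>1, \<mu>)
    ((3 * (4 * m) + 1 + (2 * q * (4 * m) + (2 * q ^ 12 + 1 + (q ^ 12 * emit_time + 3)))) + (n * (3 * dir_time + 8 * q + 13) + 7)) ?Q"
    by (rule runs_block_Cons[OF runs_mono[OF tst order_refl fin]]) auto
  moreover define P where "P = ?Q"
  moreover define T where "T = (3 * (4 * m) + 1 + (2 * q * (4 * m) + (2 * q ^ 12 + 1 + (q ^ 12 * emit_time + 3)))) + (n * (3 * dir_time + 8 * q + 13) + 7)"
  ultimately have "runs (main_prog m A) s (T + 2) P"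
    unfolding main_prog_def by (simp add: block_runs s' \<rho>1_def)
  then show ?thesis unfolding P_def
  proof (rule runs_mono)
    have "1 \<le> n ^ 3" using m by simp
    then have wb: "q ^ 12 \<le> word_bound" by (simp add: word_bound_def)
    then have 1: "q ^ 12 * emit_time \<le> word_bound * emit_time" by (rule mult_le_mono1)
    have 2: "2 * q * (4 * m) \<le> 2 * q * 12" using m(3) by (intro mult_le_mono2) simp
    have 3: "n * (3 * dir_time + 8 * q + 13) \<le> n * (3 * dir_time + 8 * q + 20)" by (rule mult_le_mono2) simp
    show "T + 2 \<le> main_time" unfolding T_def main_time_def using 1 2 3 wb m(3) by linarith
  qed
qed

end

end

section \<open>Navigation\<close>

lemma concat_nth_uniform:
  "(\<And>l. l \<in> set L \<Longrightarrow> length l = d) \<Longrightarrow> i < length L \<Longrightarrow> e < d \<Longrightarrow> concat L ! (d * i + e) = L ! i ! e"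
proof (induction L arbitrary: i)
  case (Cons l L)
  then show ?case by (cases i) (auto simp: nth_append)
qed simp

lemma length_concat_uniform: "(\<And>l. l \<in> set L \<Longrightarrow> length l = d) \<Longrightarrow> length (concat L) = d * length L"
  by (induction L) auto

text \<open>The least power of two that is at least \<open>n\<close>; it stays below
  \<open>2 * n\<close>, so inverses cost a factor linear in \<open>n\<close>.\<close>

definition double_loop :: program where
  "double_loop = WhileLess 5 2 (block [Add 5 5 5])"

lemma runs_double_loop:
  assumes "\<rho> 5 = 1" "\<rho> 2 = n" "1 \<le> n"
  shows "runs double_loop (\<rho>, \<mu>) (3 * n + 1) (\<lambda>s'. \<exists>K. s' = (\<rho>(5 := 2 ^ K), \<mu>) \<and> n \<le> 2 ^ K \<and> 2 ^ K \<le> 2 * n)"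
proof -
  define K where "K = (LEAST k. n \<le> 2 ^ k)"
  have "n \<le> 2 ^ n" by (simp add: less_imp_le)
  then have K: "n \<le> 2 ^ K" "K \<le> n" unfolding K_def by (rule LeastI, rule Least_le)
  have less: "2 ^ i < n" if "i < K" for i using that not_less_Least[of i "\<lambda>k. n \<le> 2 ^ k"] by (simp add: K_def)
  have K2: "2 ^ K \<le> 2 * n"
  proof (cases K)
    case (Suc k)
    then show ?thesis using less[of k] by simp
  qed (use assms in simp)
  show ?thesis unfolding double_loop_def
  proof (rule runs_While[where N = K and T = 2 and I = "\<lambda>i s'. s' = (\<rho>(5 := 2 ^ i), \<mu>)"])
    show "(\<rho>, \<mu>) = (\<rho>(5 := 2 ^ 0), \<mu>)" using assms by auto
    fix i \<rho>' \<mu>' assume "i < K" "(\<rho>', \<mu>') = (\<rho>(5 := 2 ^ i), \<mu>)"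
    then show "\<rho>' 5 < \<rho>' 2 \<and> runs (block [Add 5 5 5]) (\<rho>', \<mu>') 2 (\<lambda>s'. s' = (\<rho>(5 := 2 ^ Suc i), \<mu>))"
      using less assms by (auto simp: block_runs mult_2)
  next
    fix \<rho>' \<mu>' assume "(\<rho>', \<mu>') = (\<rho>(5 := 2 ^ K), \<mu>)"
    then show "\<not> \<rho>' 5 < \<rho>' 2 \<and> (\<exists>K. (\<rho>', \<mu>') = (\<rho>(5 := 2 ^ K), \<mu>) \<and> n \<le> 2 ^ K \<and> 2 ^ K \<le> 2 * n)"
      using K K2 assms by auto
  qed (use K(2) in simp)
qed

text \<open>The first entry of each coefficient goes to array 5 and the last to array 2. Exchanging
  the diagonal while loading inverts the target, since in characteristic 2 the adjugate has no
  signs.\<close>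

definition load_loop :: program where
  "load_loop = WhileLess 31 2 (block [Read 33 0 32, Write 5 31 33, Add 32 32 1, Read 33 0 32, Write 3 31 33, Add 32 32 1,
     Read 33 0 32, Write 4 31 33, Add 32 32 1, Read 33 0 32, Write 2 31 33, Add 32 32 1, Add 31 31 1])"

lemma runs_load_loop:
  assumes "\<rho> 1 = 1" "\<rho> 2 = n" "\<rho> 31 = 0" "\<rho> 32 = 1"
  shows "runs load_loop (\<rho>, \<mu>) (15 * n + 1) (\<lambda>s'. frame {31, 32, 33} {2, 3, 4, 5} (\<rho>, \<mu>) s' \<and>
    (\<forall>i<n. (snd s' 5 i, snd s' 3 i, snd s' 4 i, snd s' 2 i) = smat (\<mu> 0) 1 i))"
  unfolding load_loop_def
proof (rule runs_While[where N = n and T = 14 and I = "\<lambda>k s'. frame {31, 32, 33} {2, 3, 4, 5} (\<rho>, \<mu>) s' \<and> fst s' 31 = k \<and> fst s' 32 = 1 + 4 * k \<and>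
    (\<forall>i<k. (snd s' 5 i, snd s' 3 i, snd s' 4 i, snd s' 2 i) = smat (\<mu> 0) 1 i)"])
  fix k \<rho>' \<mu>'
  assume k: "k < n" and I: "frame {31, 32, 33} {2, 3, 4, 5} (\<rho>, \<mu>) (\<rho>', \<mu>') \<and> fst (\<rho>', \<mu>') 31 = k \<and> fst (\<rho>', \<mu>') 32 = 1 + 4 * k \<and>
    (\<forall>i<k. (snd (\<rho>', \<mu>') 5 i, snd (\<rho>', \<mu>') 3 i, snd (\<rho>', \<mu>') 4 i, snd (\<rho>', \<mu>') 2 i) = smat (\<mu> 0) 1 i)"
  have r: "\<rho>' (Suc 0) = 1" "\<rho>' 2 = n" "\<mu>' 0 = \<mu> 0" using I assms by (auto simp: frame_def)
  show "\<rho>' 31 < \<rho>' 2 \<and> runs (block [Read 33 0 32, Write 5 31 33, Add 32 32 1, Read 33 0 32, Write 3 31 33, Add 32 32 1,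
     Read 33 0 32, Write 4 31 33, Add 32 32 1, Read 33 0 32, Write 2 31 33, Add 32 32 1, Add 31 31 1]) (\<rho>', \<mu>') 14
    (\<lambda>s'. frame {31, 32, 33} {2, 3, 4, 5} (\<rho>, \<mu>) s' \<and> fst s' 31 = Suc k \<and> fst s' 32 = 1 + 4 * Suc k \<and>
    (\<forall>i<Suc k. (snd s' 5 i, snd s' 3 i, snd s' 4 i, snd s' 2 i) = smat (\<mu> 0) 1 i))"
    using I r k by (auto simp: block_runs frame_def less_Suc_eq smat_def eval_nat_numeral)
next
  fix \<rho>' \<mu>'
  assume I: "frame {31, 32, 33} {2, 3, 4, 5} (\<rho>, \<mu>) (\<rho>', \<mu>') \<and> fst (\<rho>', \<mu>') 31 = n \<and> fst (\<rho>', \<mu>') 32 = 1 + 4 * n \<and>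
    (\<forall>i<n. (snd (\<rho>', \<mu>') 5 i, snd (\<rho>', \<mu>') 3 i, snd (\<rho>', \<mu>') 4 i, snd (\<rho>', \<mu>') 2 i) = smat (\<mu> 0) 1 i)"
  then have "\<rho>' 2 = n" using assms by (auto simp: frame_def)
  then show "\<not> \<rho>' 31 < \<rho>' 2 \<and> frame {31, 32, 33} {2, 3, 4, 5} (\<rho>, \<mu>) (\<rho>', \<mu>') \<and>
    (\<forall>i<n. (snd (\<rho>', \<mu>') 5 i, snd (\<rho>', \<mu>') 3 i, snd (\<rho>', \<mu>') 4 i, snd (\<rho>', \<mu>') 2 i) = smat (\<mu> 0) 1 i)"
    using I by simp
qed (use assms in auto)

definition init_prog :: program where
  "init_prog = block [Const 1 1, Const 11 4, Read 2 0 0, Add 3 2 2, Add 3 3 3, Add 30 3 1, Read 4 0 30, Add 75 30 1,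
     Const 6 1, Const 5 1, double_loop, Const 31 0, Const 32 1, load_loop, powers_prog]"

section \<open>The complete program and its correctness\<close>

context coded_group
begin

text \<open>A decision tree over all subsets of the possible classes. Its leaves know the set of
  classes \<open>A\<close> and contain the words made for it. The tree is huge but depends on
  \<open>q\<close> and \<open>m\<close> only, and each path has one search per class.\<close>

fun search_all :: "nat \<Rightarrow> nat list list \<Rightarrow> nat list set \<Rightarrow> program" where
  "search_all m [] A = main_prog m A"
| "search_all m (c # cs) A = Seq (search_prog q (4 * m) c)
     (IfLess 0 (class_reg c) (search_all m cs (insert c A)) (search_all m cs A))"

definition classes_prog :: "nat \<Rightarrow> program" where
  "classes_prog m = search_all m (List.n_lists (4 * m) [0..<q]) {}"

text \<open>Here \<open>m\<close> is the minimum of \<open>n\<close> and 3. The cases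
  \<open>n = 1\<close> and \<open>n = 2\<close> have trees of their own, because their codes are too
  short to contain a class modulo \<open>t^3\<close>; the first word then already equals the
  target.\<close>

definition nav_prog :: program where
  "nav_prog = block [init_prog, Const 27 2, Const 28 3,
     IfLess 2 27 (classes_prog 1) (IfLess 2 28 (classes_prog 2) (classes_prog 3))]"

definition search_time :: nat where
  "search_time = (4 * n * q + 1) * (3 * 12 + 2 * q * 12 + 20) + 3 * 12 + 2 * q * 12 + 20"

definition nav_time :: nat where
  "nav_time = 18 * n + 7 * (4 * n * q) + 60 + q ^ 12 * (search_time + 1) + main_time"

context
  fixes S g
  assumes S: "generating_set SLn S" and g: "g \<in> carrier SLn"
begin

definition codes :: "nat list list" where
  "codes = sorted_list_of_set (tcode n ` S)"

definition input :: "nat \<Rightarrow> nat" where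
  "input i = (let xs = navigation_input (trunc_mat_code F) n S g in if i < length xs then xs ! i else 0)"

lemma S': "S \<subseteq> carrier SLn" "generate SLn S = carrier SLn"
  using S by (auto simp: generating_set_def)

lemma finite_S: "finite S"
  using S'(1) SLn_finite finite_subset carrier_F by auto

lemma codes: "set codes = tcode n ` S" "sorted codes" "\<And>l. l \<in> set codes \<Longrightarrow> length l = 4 * n"
  "\<And>l. l \<in> set codes \<Longrightarrow> set l \<subseteq> {..<q}" "length codes \<le> 2 ^ (4 * n * q)"
proof -
  show s: "set codes = tcode n ` S" "sorted codes" using finite_S by (simp_all add: codes_def)
  show "\<And>l. l \<in> set codes \<Longrightarrow> length l = 4 * n" using s by auto
  show sub: "\<And>l. l \<in> set codes \<Longrightarrow> set l \<subseteq> {..<q}"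
    unfolding s using tcode_closed[OF SLn_MR] S'(1) by (smt (verit, best) imageE order_refl subsetD)
  have "length codes = card (set codes)" using finite_S by (simp add: codes_def)
  also have "\<dots> \<le> card {xs. set xs \<subseteq> {..<q} \<and> length xs = 4 * n}"
    by (rule card_mono) (use sub s in \<open>auto intro: finite_lists_length_eq\<close>)
  also have "\<dots> = q ^ (4 * n)" using card_lists_length_eq[of "{..<q}" "4 * n"] by simp
  \<comment> \<open>From \<open>q < 2 ^ q\<close>. The exponent bounds the rounds of the binary
    search, so linear growth in \<open>n\<close> is what matters.\<close>
  also have "\<dots> \<le> (2 ^ q) ^ (4 * n)" by (intro power_mono) (simp_all add: less_imp_le)
  also have "\<dots> = 2 ^ (4 * n * q)" by (simp add: power_mult[symmetric] mult.commute)
  finally show "length codes \<le> 2 ^ (4 * n * q)" .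
qed

lemma input: "input 0 = n" "\<And>i. i < 4 * n \<Longrightarrow> input (1 + i) = tcode n g ! i" "input (4 * n + 1) = length codes"
  "\<And>i e. i < length codes \<Longrightarrow> e < 4 * n \<Longrightarrow> input (4 * n + 2 + 4 * n * i + e) = codes ! i ! e"
proof -
  have xs: "navigation_input (trunc_mat_code F) n S g = n # tcode n g @ length codes # concat codes"
    by (simp add: navigation_input_def list_code_def codes_def)
  have lc: "length (concat codes) = 4 * n * length codes" by (rule length_concat_uniform[OF codes(3)])
  show "input 0 = n" "\<And>i. i < 4 * n \<Longrightarrow> input (1 + i) = tcode n g ! i" "input (4 * n + 1) = length codes"
    unfolding input_def xs by (auto simp: nth_append)
  fix i e assume ie: "i < length codes" "e < 4 * n"
  have "4 * n * i + e < 4 * n * length codes"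
  proof -
    have "4 * n * Suc i \<le> 4 * n * length codes" using ie(1) by (intro mult_le_mono2) simp
    then show ?thesis using ie(2) by simp
  qed
  then have "input (4 * n + 2 + 4 * n * i + e) = concat codes ! (4 * n * i + e)"
    unfolding input_def xs using lc by (simp add: nth_append add.assoc)
  also have "\<dots> = codes ! i ! e" by (rule concat_nth_uniform[OF codes(3) ie])
  finally show "input (4 * n + 2 + 4 * n * i + e) = codes ! i ! e" .
qed

text \<open>Interprets an address as a generator whose code begins there. All other numbers are sent
  to 1, which makes the map total with values in the group.\<close>

definition letter :: "nat \<Rightarrow> nat trunc_mat" where
  "letter a = (if \<exists>x\<in>S. \<exists>i<length codes. a = 4 * n + 2 + 4 * n * i \<and> tcode n x = codes ! i
     then SOME x. x \<in> S \<and> (\<exists>i<length codes. a = 4 * n + 2 + 4 * n * i \<and> tcode n x = codes ! i) else \<one>\<^bsub>SLn\<^esub>)"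

lemma letter_code: "i < length codes \<Longrightarrow> letter (4 * n + 2 + 4 * n * i) \<in> S \<and> tcode n (letter (4 * n + 2 + 4 * n * i)) = codes ! i"
proof -
  assume i: "i < length codes"
  let ?a = "4 * n + 2 + 4 * n * i"
  have "codes ! i \<in> tcode n ` S" using i codes(1) nth_mem by blast
  then obtain x where "x \<in> S" "tcode n x = codes ! i" by auto
  then have ex: "\<exists>x. x \<in> S \<and> (\<exists>i<length codes. ?a = 4 * n + 2 + 4 * n * i \<and> tcode n x = codes ! i)" using i by blast
  then have "letter ?a = (SOME x. x \<in> S \<and> (\<exists>i<length codes. ?a = 4 * n + 2 + 4 * n * i \<and> tcode n x = codes ! i))"
    unfolding letter_def by (intro if_P) blast
  with someI_ex[OF ex] have "letter ?a \<in> S \<and> (\<exists>j<length codes. ?a = 4 * n + 2 + 4 * n * j \<and> tcode n (letter ?a) = codes ! j)" by metis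
  then show ?thesis using n_pos by auto
qed

lemma letter_closed: "letter a \<in> carrier SLn"
proof (cases "\<exists>x\<in>S. \<exists>i<length codes. a = 4 * n + 2 + 4 * n * i \<and> tcode n x = codes ! i")
  case True
  then show ?thesis using letter_code S'(1) by blast
next
  case False
  then have "letter a = \<one>\<^bsub>SLn\<^esub>" unfolding letter_def by (rule if_not_P)
  then show ?thesis by (simp only: SL.one_closed)
qed

definition ready :: "machine_state \<Rightarrow> bool" where
  "ready s \<longleftrightarrow> emitted input (mcoeff (inv\<^bsub>SLn\<^esub> g)) [] s \<and> bufs (\<lambda>_. []) s \<and> (\<exists>K. fst s 5 = 2 ^ K \<and> n \<le> 2 ^ K \<and> 2 ^ K \<le> 2 * n) \<and>
     fst s 4 = length codes \<and> fst s 75 = 4 * n + 2 \<and>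
     (\<exists>K\<le>4 * n * q + 1. fst s 73 = K \<and> length codes < 2 ^ K \<and> (\<forall>k<K. snd s 11 k = 2 ^ k \<and> snd s 12 k = 4 * n * 2 ^ k))"

lemma ready_frame: "ready s \<Longrightarrow> frame ({19, 27, 28} \<union> {76..}) {} s s' \<Longrightarrow> ready s'"
  unfolding ready_def emitted_def bufs_def frame_def by auto

definition solved :: "machine_state \<Rightarrow> bool" where
  "solved s \<longleftrightarrow> (\<exists>w. set w \<subseteq> S \<and> length w \<le> q ^ 12 + n * (3 * word_bound) \<and> wv w = g \<and> has_output s (list_code (map (tcode n) w)))"

lemma runs_main_ready:
  assumes m: "1 \<le> m" "m \<le> n" "m \<le> 3" "m = n \<or> m = 3" and s: "ready s"
    and pos: "\<And>x. x \<in> tcode m ` S \<Longrightarrow> \<exists>i<length codes. take (4 * m) (codes ! i) = x \<and> fst s (class_reg x) = 4 * n + 2 + 4 * n * i"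
  shows "runs (main_prog m (tcode m ` S)) s main_time solved"
proof -
  define pos where "pos = (\<lambda>x. fst s (class_reg x))"
  let ?A = "tcode m ` S"
  from s obtain K where K: "fst s 5 = 2 ^ K" "n \<le> 2 ^ K" "2 ^ K \<le> 2 * n" by (auto simp: ready_def)
  have p: "letter (pos x) \<in> S" "tcode m (letter (pos x)) = x" "\<And>i. i < 4 * n \<Longrightarrow> input (pos x + i) = tcode n (letter (pos x)) ! i" if "x \<in> ?A" for x
  proof -
    from assms(6)[OF that] obtain i where i: "i < length codes" "take (4 * m) (codes ! i) = x" "pos x = 4 * n + 2 + 4 * n * i"
      by (auto simp: pos_def)
    show "letter (pos x) \<in> S" using letter_code[OF i(1)] i(3) by simp
    have t: "tcode n (letter (pos x)) = codes ! i" using letter_code[OF i(1)] i(3) by simp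
    then show "tcode m (letter (pos x)) = x" using take_tcode[OF m(2), of "letter (pos x)"] i(2) by simp
    show "\<And>j. j < 4 * n \<Longrightarrow> input (pos x + j) = tcode n (letter (pos x)) ! j" unfolding t unfolding i(3) by (rule input(4)[OF i(1)])
  qed
  have sm: "smat input (pos x) j = mcoeff (letter (pos x)) j" if x: "x \<in> ?A" and j: "j < n" for x j
  proof -
    have "smat input (pos x) j = decode (tcode n (letter (pos x))) j"
      unfolding smat_def decode_def using p(3)[OF x, of "4 * j"] p(3)[OF x, of "4 * j + 1"] p(3)[OF x, of "4 * j + 2"] p(3)[OF x, of "4 * j + 3"] j
      by (simp add: add.assoc)
    then show ?thesis using j by (simp add: tcode_eq)
  qed
  have "inv\<^bsub>SLn\<^esub> g \<otimes>\<^bsub>SLn\<^esub> \<one>\<^bsub>SLn\<^esub> = inv\<^bsub>SLn\<^esub> g" by (rule SL.r_one[OF SL.inv_closed[OF g]])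
  then have ms: "main_state ?A g input pos (2 ^ K) letter [] s"
    apply (subst main_state_def[where elt = letter and pos = pos and S = S and m = m and K = K and inp = input and g = g])
    using S' g m K(2,3) letter_closed p(2) sm input(2) apply (simp_all del: mat2_simps)[15]
    using s K(1) by (auto simp: ready_def pos_def simp del: mat2_simps)
  have "runs (main_prog m ?A) s main_time (\<lambda>s'. \<exists>ws. set ws \<subseteq> pos ` ?A \<and> length ws \<le> q ^ 12 + n * (3 * word_bound) \<and>
     wv (map letter ws) = g \<and> snd s' 1 0 = length ws \<and> (\<forall>k<length ws. \<forall>i<4 * n. snd s' 1 (1 + 4 * n * k + i) = input (ws ! k + i)))"
    by (rule runs_main_prog[where elt = letter and pos = pos, OF S' g refl m refl K(2,3) letter_closed p(2) sm input(2) ms])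
  then show ?thesis
  proof (rule runs_mono)
    fix s' :: "(nat \<Rightarrow> nat) \<times> (nat \<Rightarrow> nat \<Rightarrow> nat)" assume "\<exists>ws. set ws \<subseteq> pos ` ?A \<and> length ws \<le> q ^ 12 + n * (3 * word_bound) \<and>
     wv (map letter ws) = g \<and> snd s' 1 0 = length ws \<and> (\<forall>k<length ws. \<forall>i<4 * n. snd s' 1 (1 + 4 * n * k + i) = input (ws ! k + i))"
    then obtain ws where ws: "set ws \<subseteq> pos ` ?A" "length ws \<le> q ^ 12 + n * (3 * word_bound)" "wv (map letter ws) = g" "snd s' 1 0 = length ws"
      "\<And>k i. k < length ws \<Longrightarrow> i < 4 * n \<Longrightarrow> snd s' 1 (1 + 4 * n * k + i) = input (ws ! k + i)" by blast
    let ?cs = "map (tcode n) (map letter ws)"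
    have cl: "\<And>l. l \<in> set ?cs \<Longrightarrow> length l = 4 * n" by auto
    have "has_output s' (list_code ?cs)"
      unfolding has_output_def list_code_def
    proof (intro allI impI)
      fix j assume j: "j < length (length ?cs # concat ?cs)"
      show "snd s' 1 j = (length ?cs # concat ?cs) ! j"
      proof (cases j)
        case (Suc i)
        define k e where "k = i div (4 * n)" and "e = i mod (4 * n)"
        have i: "i = 4 * n * k + e" "e < 4 * n" using n_pos by (auto simp: k_def e_def)
        have "i < 4 * n * length ws" using j Suc length_concat_uniform[of ?cs "4 * n", OF cl] by (simp del: map_map)
        then have k: "k < length ws" unfolding k_def by (simp only: less_mult_imp_div_less mult.commute[of "4 * n"])
        obtain x where x: "x \<in> ?A" "ws ! k = pos x" using subsetD[OF ws(1) nth_mem[OF k]] by (rule imageE) metis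
        have "input (ws ! k + e) = tcode n (letter (ws ! k)) ! e" unfolding x(2) by (rule p(3)[OF x(1) i(2)])
        then have "snd s' 1 (1 + 4 * n * k + e) = ?cs ! k ! e" using ws(5)[OF k i(2)] k by simp
        also have "\<dots> = concat ?cs ! (4 * n * k + e)" by (rule concat_nth_uniform[of ?cs "4 * n", OF cl, symmetric]) (use k i(2) in simp_all)
        finally show ?thesis using Suc i(1) by simp
      qed (use ws(4) in simp)
    qed
    moreover have "set (map letter ws) \<subseteq> S" using ws(1) p(1) by auto
    ultimately show "solved s'" unfolding solved_def using ws(2,3) by (intro exI[of _ "map letter ws"]) auto
  qed simp
qed

text \<open>\<open>A\<close> collects the classes found and \<open>cs\<close> lists those still to
  be searched. When \<open>cs\<close> is exhausted, \<open>A\<close> is the full set of classes of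
  the generators, the one for which the words at this leaf were made. Later searches leave the
  registers of earlier classes alone, since \<open>class_reg\<close> is injective.\<close>

lemma runs_search_all:
  assumes m: "1 \<le> m" "m \<le> n" "m \<le> 3" "m = n \<or> m = 3" and s: "ready s"
    and A: "A \<subseteq> tcode m ` S" "tcode m ` S \<subseteq> A \<union> set cs"
    and pos: "\<And>x. x \<in> A \<Longrightarrow> \<exists>i<length codes. take (4 * m) (codes ! i) = x \<and> fst s (class_reg x) = 4 * n + 2 + 4 * n * i"
  shows "runs (search_all m cs A) s (length cs * (search_time + 1) + main_time) solved"
  using s A pos
proof (induction cs arbitrary: s A)
  case Nil
  then have e: "A = tcode m ` S" by auto
  show ?case unfolding search_all.simps e
    by (rule runs_mono[OF runs_main_ready[OF m Nil(1)]]) (use Nil(4) e in auto)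
next
  case (Cons c cs)
  obtain \<rho> \<mu> where s: "s = (\<rho>, \<mu>)" by fastforce
  from Cons.prems(1) obtain K where K: "K \<le> 4 * n * q + 1" "\<rho> 73 = K" "length codes < 2 ^ K" "\<And>k. k < K \<Longrightarrow> \<mu> 11 k = 2 ^ k \<and> \<mu> 12 k = 4 * n * 2 ^ k"
    unfolding ready_def s by auto
  have r: "\<rho> 0 = 0" "\<rho> 1 = 1" "\<rho> 3 = 4 * n" "\<rho> 4 = length codes" "\<rho> 75 = 4 * n + 2" "\<mu> 0 = input"
    using Cons.prems(1) unfolding ready_def s by (auto simp: emitted_def)
  let ?k = "4 * m"
  have tk: "take ?k ` set codes = tcode m ` S" unfolding codes(1) image_image using take_tcode[OF m(2)] by simp
  have sp: "runs (search_prog q ?k c) (\<rho>, \<mu>) (K * (3 * ?k + 2 * q * ?k + 20) + 3 * ?k + 2 * q * ?k + 20)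
    (\<lambda>s'. frame ({19} \<union> {76..<84 + ?k} \<union> {class_reg c}) {} (\<rho>, \<mu>) s' \<and>
      (if c \<in> take ?k ` set codes then \<exists>i<length codes. take ?k (codes ! i) = c \<and> fst s' (class_reg c) = (4 * n + 2) + 4 * n * i else fst s' (class_reg c) = 0))"
    by (rule runs_search_prog[OF r(1-4) K(2) r(5) K(3)]) (use K(4) codes(2,3,4) input(4) r(6) m in auto)
  have le: "K * (3 * ?k + 2 * q * ?k + 20) + 3 * ?k + 2 * q * ?k + 20 \<le> search_time"
    unfolding search_time_def using m(3) K(1) by (intro add_mono mult_le_mono) auto
  show ?case unfolding search_all.simps s
  proof (rule runs_Seq[OF runs_mono[OF sp le]])
    fix s' assume s': "frame ({19} \<union> {76..<84 + ?k} \<union> {class_reg c}) {} (\<rho>, \<mu>) s' \<and>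
      (if c \<in> take ?k ` set codes then \<exists>i<length codes. take ?k (codes ! i) = c \<and> fst s' (class_reg c) = (4 * n + 2) + 4 * n * i else fst s' (class_reg c) = 0)"
    have fr: "frame ({19} \<union> {76..<84 + ?k} \<union> {class_reg c}) {} s s'" using s' s by simp
    have rd: "ready s'" by (rule ready_frame[OF Cons.prems(1) frame_mono[OF fr]]) (auto simp: class_reg_def)
    have 0: "fst s' 0 = 0" using rd by (auto simp: ready_def emitted_def)
    have old: "fst s' (class_reg x) = fst s (class_reg x)" if "x \<noteq> c" for x
    proof (rule frame_reg[OF fr])
      show "class_reg x \<notin> {19} \<union> {76..<84 + ?k} \<union> {class_reg c}" using that m(3) by (auto simp: class_reg_def)
    qed
    have posx: "\<exists>i<length codes. take ?k (codes ! i) = x \<and> fst s' (class_reg x) = 4 * n + 2 + 4 * n * i" if "x \<in> A \<or> x = c \<and> c \<in> tcode m ` S" for x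
    proof (cases "x = c")
      case True
      then have "c \<in> tcode m ` S" using that Cons.prems(2) by auto
      then show ?thesis using s' True unfolding tk by auto
    next
      case False
      then show ?thesis using old[OF False] Cons.prems(4)[of x] that by auto
    qed
    show "runs (IfLess 0 (class_reg c) (search_all m cs (insert c A)) (search_all m cs A)) s' (length cs * (search_time + 1) + main_time + 1) solved"
    proof (cases "c \<in> tcode m ` S")
      case True
      \<comment> \<open>Generators sit at addresses from \<open>4 * n + 2\<close> on, so 0 is free
        to signal an absent class.\<close>
      then have "0 < fst s' (class_reg c)" using posx[of c] by auto
      moreover have "runs (search_all m cs (insert c A)) s' (length cs * (search_time + 1) + main_time) solved"
        by (rule Cons.IH[OF rd]) (use True Cons.prems(2,3) posx in auto)
      ultimately show ?thesis using 0 by (intro runs_IfTrue) auto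
    next
      case False
      then have "fst s' (class_reg c) = 0" using s' unfolding tk by auto
      moreover have "runs (search_all m cs A) s' (length cs * (search_time + 1) + main_time) solved"
        by (rule Cons.IH[OF rd]) (use False Cons.prems(2,3) posx in auto)
      ultimately show ?thesis using 0 by (intro runs_IfFalse) auto
    qed
  qed simp
qed

lemma runs_classes_prog:
  assumes m: "1 \<le> m" "m \<le> n" "m \<le> 3" "m = n \<or> m = 3" and s: "ready s"
  shows "runs (classes_prog m) s (q ^ 12 * (search_time + 1) + main_time) solved"
proof -
  let ?cs = "List.n_lists (4 * m) [0..<q]"
  have set: "tcode m ` S \<subseteq> set ?cs"
  proof (rule image_subsetI)
    fix x assume "x \<in> S"
    then have "set (tcode m x) \<subseteq> {..<q}" using tcode_closed[OF SLn_MR m(2)] S'(1) by blast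
    then show "tcode m x \<in> set ?cs" by (auto simp: set_n_lists)
  qed
  have "length ?cs = q ^ (4 * m)" by (simp add: length_n_lists)
  also have "\<dots> \<le> q ^ 12" using m(3) q_ge2 by (intro power_increasing) auto
  finally have le: "length ?cs * (search_time + 1) + main_time \<le> q ^ 12 * (search_time + 1) + main_time"
    by (intro add_mono mult_le_mono1) auto
  have "runs (search_all m ?cs {}) s (length ?cs * (search_time + 1) + main_time) solved"
    by (rule runs_search_all[OF m s]) (use set in auto)
  then show ?thesis unfolding classes_prog_def by (rule runs_mono[OF _ le])
qed

lemma runs_init_prog: "runs init_prog (initial_state (navigation_input (trunc_mat_code F) n S g)) (18 * n + 7 * (4 * n * q) + 40) ready"
proof -
  define \<mu> :: "nat \<Rightarrow> nat \<Rightarrow> nat" where "\<mu> = (\<lambda>a i. if a = 0 then input i else 0)"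
  have init: "initial_state (navigation_input (trunc_mat_code F) n S g) = (\<lambda>_. 0, \<mu>)"
    by (auto simp: initial_state_def \<mu>_def input_def fun_eq_iff Let_def)
  define \<rho>1 where "\<rho>1 = (\<lambda>_. 0)(Suc 0 := Suc 0, 11 := 4, 2 := n, 3 := n + n, 3 := n + n + (n + n), 30 := Suc (n + n + (n + n)), 4 := length codes, 75 := Suc (Suc (n + n + (n + n))), 6 := Suc 0, 5 := (Suc 0 :: nat))"
  have "Suc (n + n + (n + n)) = 4 * n + 1" by simp
  then have in1: "input (Suc (n + n + (n + n))) = length codes" using input(3) by metis
  have load: "runs (block [load_loop, powers_prog]) (\<rho>1(5 := 2 ^ K, 31 := 0, 32 := Suc 0), \<mu>) (15 * n + 1 + (7 * (4 * n * q) + 14 + 1)) ready"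
    if K: "n \<le> 2 ^ K" "2 ^ K \<le> 2 * n" for K
  proof (rule runs_block_Cons[OF runs_mono[OF runs_load_loop order_refl]])
    show "(\<rho>1(5 := 2 ^ K, 31 := 0, 32 := Suc 0)) 1 = 1" "(\<rho>1(5 := 2 ^ K, 31 := 0, 32 := Suc 0)) 2 = n"
      "(\<rho>1(5 := 2 ^ K, 31 := 0, 32 := Suc 0)) 31 = 0" "(\<rho>1(5 := 2 ^ K, 31 := 0, 32 := Suc 0)) 32 = 1"
      by (simp_all add: \<rho>1_def)
    fix s2 assume s2: "frame {31, 32, 33} {2, 3, 4, 5} (\<rho>1(5 := 2 ^ K, 31 := 0, 32 := Suc 0), \<mu>) s2 \<and>
      (\<forall>i<n. (snd s2 5 i, snd s2 3 i, snd s2 4 i, snd s2 2 i) = smat (\<mu> 0) 1 i)"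
    obtain \<rho>2 \<mu>2 where ss: "s2 = (\<rho>2, \<mu>2)" by fastforce
    have r2: "\<rho>2 x = (\<rho>1(5 := 2 ^ K)) x" if "x \<notin> {31, 32, 33}" for x
      using s2 that unfolding ss by (auto simp: frame_def)
    have a2: "\<mu>2 0 = input" using s2 unfolding ss by (auto simp: frame_def \<mu>_def)
    have inv: "(\<mu>2 2 i, \<mu>2 3 i, \<mu>2 4 i, \<mu>2 5 i) = mcoeff (inv\<^bsub>SLn\<^esub> g) i" if i: "i < n" for i
    proof -
      obtain a b c d where gg: "g = (a, b, c, d)" by (cases g)
      have "smat input 1 i = decode (tcode n g) i"
        unfolding smat_def decode_def using input(2)[of "4 * i"] input(2)[of "4 * i + 1"] input(2)[of "4 * i + 2"] input(2)[of "4 * i + 3"] i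
        by (simp add: add.assoc)
      then have "smat input 1 i = (tc a i, tc b i, tc c i, tc d i)" using i by (simp add: tcode_eq mcoeff_def gg)
      moreover have "smat (\<mu> 0) 1 i = smat input 1 i" by (simp add: \<mu>_def)
      ultimately have "\<mu>2 5 i = tc a i" "\<mu>2 3 i = tc b i" "\<mu>2 4 i = tc c i" "\<mu>2 2 i = tc d i" using s2 i unfolding ss by auto
      moreover have "inv\<^bsub>SLn\<^esub> g = (d, b, c, a)" unfolding gg by (rule SLn_inverse) (use g gg in simp)
      ultimately show ?thesis by (simp add: mcoeff_def)
    qed
    have pw: "runs powers_prog (\<rho>2, \<mu>2) (7 * (4 * n * q) + 14) (\<lambda>s'. frame {71..<75} {11, 12} (\<rho>2, \<mu>2) s' \<and>
      (\<exists>K\<le>4 * n * q + 1. fst s' 73 = K \<and> length codes < 2 ^ K \<and> (\<forall>k<K. snd s' 11 k = 2 ^ k \<and> snd s' 12 k = 4 * n * 2 ^ k)))"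
      by (rule runs_powers_prog[OF _ _ _ _ codes(5)]) (simp_all add: r2 \<rho>1_def)
    have "runs powers_prog (\<rho>2, \<mu>2) (7 * (4 * n * q) + 14) ready"
    proof (rule runs_mono[OF pw order_refl])
      fix s3 assume s3: "frame {71..<75} {11, 12} (\<rho>2, \<mu>2) s3 \<and>
        (\<exists>K\<le>4 * n * q + 1. fst s3 73 = K \<and> length codes < 2 ^ K \<and> (\<forall>k<K. snd s3 11 k = 2 ^ k \<and> snd s3 12 k = 4 * n * 2 ^ k))"
      have r3: "fst s3 x = (\<rho>1(5 := 2 ^ K)) x" if "x \<notin> {31, 32, 33} \<union> {71..<75}" for x
        using s3 r2[of x] that by (auto simp: frame_def)
      have a3: "snd s3 x = \<mu>2 x" if "x \<notin> {11, 12}" for x using s3 that by (auto simp: frame_def)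
      show "ready s3"
        unfolding ready_def emitted_def bufs_def
        using s3 K inv by (auto simp: r3 a3 a2 \<rho>1_def)
    qed
    then show "runs (block [powers_prog]) s2 (7 * (4 * n * q) + 14 + 1) ready" unfolding ss by (rule runs_block_single) simp
  qed simp
  have "runs (block [double_loop, Const 31 0, Const 32 1, load_loop, powers_prog]) (\<rho>1, \<mu>) (3 * n + 1 + (2 + (15 * n + 1 + (7 * (4 * n * q) + 14 + 1)))) ready"
  proof (rule runs_block_Cons[OF runs_mono[OF runs_double_loop order_refl]])
    fix s' assume "\<exists>K. s' = (\<rho>1(5 := 2 ^ K), \<mu>) \<and> n \<le> 2 ^ K \<and> 2 ^ K \<le> 2 * n"
    then obtain K where K: "s' = (\<rho>1(5 := 2 ^ K), \<mu>)" "n \<le> 2 ^ K" "2 ^ K \<le> 2 * n" by blast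
    show "runs (block [Const 31 0, Const 32 1, load_loop, powers_prog]) s' (2 + (15 * n + 1 + (7 * (4 * n * q) + 14 + 1))) ready"
      unfolding K(1) using load[OF K(2,3)] by (simp add: block_runs)
  qed (use n_pos in \<open>simp_all add: \<rho>1_def\<close>)
  then show ?thesis
    unfolding init init_prog_def \<rho>1_def
    by (simp add: block_runs \<mu>_def input(1) in1) (erule runs_mono, simp_all)
qed

lemma runs_nav_prog: "runs nav_prog (initial_state (navigation_input (trunc_mat_code F) n S g)) nav_time solved"
  unfolding nav_prog_def
proof (rule runs_block_Cons[OF runs_mono[OF runs_init_prog order_refl]])
  fix s assume s: "ready s"
  obtain \<rho> \<mu> where ss: "s = (\<rho>, \<mu>)" by fastforce
  define s1 where "s1 = (\<rho>(27 := 2, 28 := 3), \<mu>)"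
  have r1: "ready s1" by (rule ready_frame[OF s]) (auto simp: frame_def s1_def ss)
  have n2: "fst s1 2 = n" "fst s1 27 = 2" "fst s1 28 = 3" using s by (auto simp: ready_def emitted_def s1_def ss)
  let ?T = "q ^ 12 * (search_time + 1) + main_time"
  have "runs (IfLess 2 27 (classes_prog 1) (IfLess 2 28 (classes_prog 2) (classes_prog 3))) s1 (?T + 2) solved"
  proof -
    consider "n = 1" | "n = 2" | "3 \<le> n" using n_pos by linarith
    then show ?thesis
    proof cases
      case 1
      then show ?thesis by (intro runs_IfTrue[OF _ runs_classes_prog[OF _ _ _ _ r1]]) (auto simp: n2)
    next
      case 2
      then show ?thesis by (intro runs_IfFalse[OF _ runs_IfTrue[OF _ runs_classes_prog[OF _ _ _ _ r1]]]) (auto simp: n2)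
    next
      case 3
      then show ?thesis by (intro runs_IfFalse[OF _ runs_IfFalse[OF _ runs_classes_prog[OF _ _ _ _ r1]]]) (auto simp: n2)
    qed
  qed
  then have "runs (block [IfLess 2 27 (classes_prog 1) (IfLess 2 28 (classes_prog 2) (classes_prog 3))]) s1 (?T + 3) solved"
    by (rule runs_block_single) simp
  then show "runs (block [Const 27 2, Const 28 3, IfLess 2 27 (classes_prog 1) (IfLess 2 28 (classes_prog 2) (classes_prog 3))]) s (?T + 5) solved"
    unfolding s1_def ss by (simp add: block_runs) (erule runs_mono, simp_all)
qed (simp add: nav_time_def)

end

section \<open>Numerical bounds\<close>

lemma emit_time_le: "emit_time \<le> 100 * (q * n\<^sup>2)"
proof -
  have 1: "n \<le> n\<^sup>2" "1 \<le> n\<^sup>2" using n_pos by (simp_all add: power2_eq_square)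
  have 2: "2 * n\<^sup>2 \<le> q * n\<^sup>2" using q_ge2 by (rule mult_le_mono1)
  have "emit_time = 24 * (q * n\<^sup>2) + 20 * n\<^sup>2 + 44 * n + 13"
    unfolding emit_time_def by (simp add: power2_eq_square algebra_simps)
  then show ?thesis using 1 2 by linarith
qed

lemma word_bound_pos: "16 \<le> word_bound" "n \<le> word_bound"
proof -
  have n3: "1 \<le> n ^ 3" "n \<le> n ^ 3" using n_pos by (simp_all add: power3_eq_cube)
  have q12: "1 \<le> q ^ 12" using q_ge2 by simp
  have *: "k \<le> n ^ 3 \<Longrightarrow> 16 * k * 1 \<le> word_bound" for k
    unfolding word_bound_def by (intro mult_le_mono q12) auto
  show "16 \<le> word_bound" "n \<le> word_bound" using *[OF n3(1)] *[OF n3(2)] by auto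
qed

lemma dir_time_le: "dir_time \<le> 400 * (q * n\<^sup>2 * word_bound)"
proof -
  let ?W = word_bound
  have 1: "n \<le> q * n\<^sup>2" "1 \<le> q * n\<^sup>2" using n_pos q_ge2 by (simp_all add: power2_eq_square)
  have "(n + 2) * (72 * ?W + 4 * n + 100) \<le> (3 * n) * (83 * ?W)"
    by (intro mult_le_mono) (use n_pos word_bound_pos in linarith)+
  also have "\<dots> = 249 * (n * ?W)" by simp
  also have "\<dots> \<le> 249 * (q * n\<^sup>2 * ?W)" by (intro mult_le_mono2 mult_le_mono1 1)
  finally have a: "(n + 2) * (72 * ?W + 4 * n + 100) \<le> 249 * (q * n\<^sup>2 * ?W)" .
  have "?W * emit_time \<le> ?W * (100 * (q * n\<^sup>2))" by (intro mult_le_mono2 emit_time_le)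
  also have "\<dots> = 100 * (q * n\<^sup>2 * ?W)" by simp
  finally have b: "?W * emit_time \<le> 100 * (q * n\<^sup>2 * ?W)" .
  have "1 * ?W \<le> q * n\<^sup>2 * ?W" by (intro mult_le_mono1 1)
  then show ?thesis unfolding dir_time_def using a b word_bound_pos by linarith
qed

text \<open>The dominating product consists of \<open>n\<close> levels, words of length up to
  \<open>word_bound\<close>, and a convolution of order \<open>q * n^2\<close> for each emitted
  letter.\<close>

lemma main_time_le: "main_time \<le> 2000 * (q * n ^ 3 * word_bound)"
proof -
  let ?W = word_bound
  let ?X = "q * n ^ 3 * ?W"
  have n3: "1 \<le> n ^ 3" "n \<le> n ^ 3" "n\<^sup>2 \<le> n ^ 3" using n_pos by (simp_all add: power3_eq_cube power2_eq_square)
  have W1: "1 \<le> ?W" using word_bound_pos by simp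
  have "n * (3 * dir_time) \<le> n * (3 * (400 * (q * n\<^sup>2 * ?W)))" by (intro mult_le_mono2 dir_time_le)
  also have "\<dots> = 1200 * ?X" by (simp add: power3_eq_cube power2_eq_square)
  finally have a: "n * (3 * dir_time) \<le> 1200 * ?X" .
  have "?W * emit_time \<le> ?W * (100 * (q * n\<^sup>2))" by (intro mult_le_mono2 emit_time_le)
  also have "\<dots> = 100 * (q * n\<^sup>2 * ?W)" by simp
  also have "\<dots> \<le> 100 * ?X" by (intro mult_le_mono2 mult_le_mono1 n3)
  finally have b: "?W * emit_time \<le> 100 * ?X" .
  have c: "q * n * 1 \<le> ?X" by (intro mult_le_mono mult_le_mono2 n3 W1) auto
  have d: "q * 1 * 1 \<le> ?X" by (intro mult_le_mono mult_le_mono2 n3 W1) auto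
  have e: "1 * 1 * ?W \<le> ?X" by (intro mult_le_mono n3) (use q_ge2 in auto)
  have f: "n \<le> q * n" "1 \<le> ?W" using q_ge2 W1 by auto
  have "n * (3 * dir_time + 8 * q + 20) = n * (3 * dir_time) + 8 * (q * n) + 20 * n" by (simp add: algebra_simps)
  then show ?thesis unfolding main_time_def using a b c d e f by linarith
qed

text \<open>With \<open>word_bound\<close> cubic in \<open>n\<close> the main loop is of order
  \<open>n ^ 6\<close>; the at most \<open>q ^ 12\<close> binary searches are linear in
  \<open>n\<close> and disappear in this bound.\<close>

lemma nav_time_le: "nav_time \<le> 100000 * (q ^ 14 * n ^ 6)"
proof -
  let ?X = "q ^ 14 * n ^ 6"
  have mono: "q ^ a * n ^ b \<le> ?X" if "a \<le> 14" "b \<le> 6" for a b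
    by (intro mult_le_mono power_increasing) (use that q_ge2 n_pos in auto)
  have "main_time \<le> 2000 * (q * n ^ 3 * (16 * n ^ 3 * q ^ 12))" using main_time_le by (simp add: word_bound_def)
  also have "\<dots> = 32000 * ((q * q ^ 12) * (n ^ 3 * n ^ 3))" by simp
  also have "\<dots> = 32000 * (q ^ 13 * n ^ 6)" by (simp flip: power_add power_Suc)
  also have "\<dots> \<le> 32000 * ?X" by (intro mult_le_mono2 mono) auto
  finally have a: "main_time \<le> 32000 * ?X" .
  have s: "search_time + 1 \<le> 400 * (n * q\<^sup>2)"
  proof -
    have q2: "2 * q \<le> q\<^sup>2" "2 \<le> q" using q_ge2 by (simp_all add: power2_eq_square)
    define X Y where "X = n * q" and "Y = n * q\<^sup>2"
    have "1 * q\<^sup>2 \<le> Y" "n * (2 * q) \<le> Y" using n_pos q2(1) unfolding Y_def by (intro mult_le_mono1 mult_le_mono2; simp)+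
    then have m: "q\<^sup>2 \<le> Y" "2 * X \<le> Y" by (simp_all add: X_def)
    have "search_time = 96 * Y + 224 * X + 48 * q + 112"
      unfolding search_time_def X_def Y_def by (simp add: power2_eq_square algebra_simps)
    then show ?thesis using q2 m unfolding Y_def[symmetric] by linarith
  qed
  have "q ^ 12 * (search_time + 1) \<le> q ^ 12 * (400 * (n * q\<^sup>2))" by (intro mult_le_mono2 s)
  also have "\<dots> = 400 * ((q ^ 12 * q\<^sup>2) * n ^ 1)" by simp
  also have "\<dots> = 400 * (q ^ 14 * n ^ 1)" by (simp flip: power_add)
  also have "\<dots> \<le> 400 * ?X" by (intro mult_le_mono2 mono) auto
  finally have b: "q ^ 12 * (search_time + 1) \<le> 400 * ?X" .
  have c: "n \<le> ?X" "n * q \<le> ?X" "1 \<le> ?X" using mono[of 0 1] mono[of 1 1] mono[of 0 0] by (simp_all add: mult.commute)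
  show ?thesis unfolding nav_time_def using a b c by linarith
qed

text \<open>The constant is 3 * 16 for three words per level, plus 1 for the first word.\<close>

lemma word_length_le: "q ^ 12 + n * (3 * word_bound) \<le> 49 * (q ^ 12 * n ^ 4)"
proof -
  have "1 \<le> n ^ 4" using n_pos by simp
  then have "q ^ 12 * 1 \<le> q ^ 12 * n ^ 4" by (rule mult_le_mono2)
  moreover have "n * n ^ 3 = n ^ 4" by (simp flip: power_Suc)
  then have "n * (3 * word_bound) = 48 * (q ^ 12 * n ^ 4)" by (simp add: word_bound_def)
  ultimately show ?thesis unfolding mult_1_right by (simp only:)
qed

end

text \<open>The Sylow theorem provides a subgroup of order 2 of the additive group, hence some
  nonzero \<open>y\<close> with \<open>y \<oplus> y = \<zero>\<close>. Cancelling \<open>y\<close>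
  in the field leaves \<open>\<one> \<oplus> \<one> = \<zero>\<close>.\<close>

lemma even_field_char2:
  fixes F (structure)
  assumes "field F" "finite (carrier F)" "even (card (carrier F))" "x \<in> carrier F"
  shows "x \<oplus> x = \<zero>"
proof -
  interpret field F by fact
  interpret A: comm_group "add_monoid F" by (rule a_comm_group)
  obtain k where "card (carrier F) = 2 * k" using assms(3) by (auto elim: evenE)
  then have "order (add_monoid F) = 2 ^ 1 * k" by (simp add: order_def)
  then obtain H where H: "subgroup H (add_monoid F)" "card H = 2 ^ 1"
    using sylow_thm[of 2 "add_monoid F" 1 k] comm_group.axioms(2)[OF a_comm_group] assms(2) by auto
  interpret H: subgroup H "add_monoid F" by (rule H)
  have z: "\<zero> \<in> H" using H.one_closed by simp
  have "card H = 2" using H(2) by simp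
  then obtain a b where ab: "H = {a, b}" "a \<noteq> b" unfolding card_2_iff by blast
  obtain y where y: "y \<in> H" "y \<noteq> \<zero>" "H = {\<zero>, y}"
  proof (cases "a = \<zero>")
    case True
    then show thesis using ab that[of b] by auto
  next
    case False
    then have "b = \<zero>" using ab z by auto
    then show thesis using ab that[of a] by auto
  qed
  have yc: "y \<in> carrier F" using y(1) H.subset by auto
  have "y \<oplus> y \<in> H" using H.m_closed[OF y(1) y(1)] by simp
  moreover have "y \<oplus> y \<noteq> y" using yc y(2) add.r_cancel_one' by metis
  ultimately have "y \<oplus> y = \<zero>" using y(3) by auto
  then have "(\<one> \<oplus> \<one>) \<otimes> y = \<zero>" using yc by (simp add: l_distr)
  then have "\<one> \<oplus> \<one> = \<zero>" using yc y(2) integral[of "\<one> \<oplus> \<one>" y] by auto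
  then have "(\<one> \<oplus> \<one>) \<otimes> x = \<zero>" using assms(4) by simp
  then show ?thesis using assms(4) by (simp add: l_distr)
qed

text \<open>The maximum is taken over a finite nonempty set, since the whole group generates itself;
  a uniform bound on word lengths therefore bounds it.\<close>

lemma diam_pos_le:
  fixes G (structure)
  assumes "group G" "finite (carrier G)"
    and words: "\<And>S g. generating_set G S \<Longrightarrow> g \<in> carrier G \<Longrightarrow> \<exists>w. set w \<subseteq> S \<and> length w \<le> l \<and> word_value G w = g"
  shows "diam_pos G \<le> l"
proof -
  interpret group G by fact
  have "diam_pos_wrt G S \<le> l" if S: "generating_set G S" for S
    unfolding diam_pos_wrt_def
  proof (rule Least_le)
    have "set w \<subseteq> S \<Longrightarrow> word_value G w \<in> carrier G" for w
      using S word_value_closed by (auto simp: generating_set_def)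
    then show "pos_ball G S l = carrier G" unfolding pos_ball_def using words[OF S] by fastforce
  qed
  moreover have "{diam_pos_wrt G S | S. generating_set G S} \<noteq> {}"
  proof -
    have "generate G (carrier G) = carrier G"
      using generate_incl[of "carrier G"] generate.incl[of _ "carrier G" G] by blast
    then have "generating_set G (carrier G)" by (simp add: generating_set_def)
    then show ?thesis by blast
  qed
  moreover have "finite {diam_pos_wrt G S | S. generating_set G S}"
  proof -
    have "{diam_pos_wrt G S | S. generating_set G S} \<subseteq> diam_pos_wrt G ` Pow (carrier G)"
      by (auto simp: generating_set_def)
    then show ?thesis using assms(2) finite_subset by blast
  qed
  ultimately show ?thesis unfolding diam_pos_def by (subst Max_le_iff) auto
qed

text \<open>From \<open>2 ^ n \<le> N\<close> follows \<open>n * ln 2 \<le> ln N\<close>, which is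
  where the power of \<open>ln 2\<close> in the constant comes from; \<open>1 \<le> n\<close> allows
  the exponent to grow from \<open>k\<close> to \<open>k + e\<close>.\<close>

lemma power_le_ln_powr:
  fixes c :: real
  assumes "1 \<le> n" "2 ^ n \<le> N" "0 \<le> c" "0 < e"
  shows "c * real n ^ k \<le> c / ln 2 powr (real k + e) * ln (real N) powr (real k + e)"
proof -
  have "real (2 ^ n) \<le> real N" using assms(2) by (rule of_nat_mono)
  then have "real n * ln 2 \<le> ln (real N)"
    by (metis ln_realpow ln_mono of_nat_numeral of_nat_power zero_less_numeral zero_less_power order_less_le_trans)
  then have "(real n * ln 2) powr (real k + e) \<le> ln (real N) powr (real k + e)"
    using assms by (intro powr_mono2) auto
  moreover have "(real n * ln 2) powr (real k + e) = real n powr (real k + e) * ln 2 powr (real k + e)"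
    by (intro powr_mult)
  moreover have "real n ^ k \<le> real n powr (real k + e)"
    using assms powr_mono[of "real k" "real k + e" "real n"] by (simp add: powr_realpow)
  ultimately have "real n ^ k * ln 2 powr (real k + e) \<le> ln (real N) powr (real k + e)"
    by (smt (verit) mult_right_mono powr_ge_zero)
  then have "real n ^ k \<le> ln (real N) powr (real k + e) / ln 2 powr (real k + e)"
    by (simp add: pos_le_divide_eq)
  then have "c * real n ^ k \<le> c * (ln (real N) powr (real k + e) / ln 2 powr (real k + e))"
    using assms(3) by (rule mult_left_mono)
  then show ?thesis by simp
qed

text \<open>Exponent 4 combines \<open>n\<close> levels, words quadratic in the level, and a factor
  linear in \<open>n\<close> for inverses; exponent 6 adds the quadratic cost of multiplying by each
  letter. The bound on the diameter is read off from the words that the navigation program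
  outputs.\<close>

theorem theorem1p2:
  shows "\<exists>C>0::real. \<exists>C'>0::real. \<forall>(q::nat) (\<epsilon>::real). even q \<and> \<epsilon> > 0 \<longrightarrow>
    (\<exists>K>0::real. \<exists>K'>0::real. \<forall>F :: nat ring. field F \<and> carrier F = {..<q} \<longrightarrow>
       (\<forall>n\<ge>1. real (diam_pos (SL2_trunc F n))
                 \<le> K * ln (real (order (SL2_trunc F n))) powr (C + \<epsilon>)) \<and>
       directed_navigation_solvable (SL2_trunc F) (trunc_mat_code F)
         (\<lambda>n. nat \<lfloor>K * ln (real (order (SL2_trunc F n))) powr (C + \<epsilon>)\<rfloor>)
         (\<lambda>n. nat \<lfloor>K' * ln (real (order (SL2_trunc F n))) powr (C' + \<epsilon>)\<rfloor>))"
proof (rule exI[of _ 4], rule conjI, simp, rule exI[of _ 6], rule conjI, simp, intro allI impI)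
  fix q :: nat and \<epsilon> :: real
  assume q\<epsilon>: "even q \<and> \<epsilon> > 0"
  \<comment> \<open>The constant of \<open>word_length_le\<close>. The summand 1 keeps it positive
    for \<open>q = 0\<close> too, a value that the quantifier over even \<open>q\<close> includes
    although no field has this order.\<close>
  define c where "c = real (49 * q ^ 12 + 1)"
  define c' where "c' = real (100000 * q ^ 14 + 1)"
  define K where "K = c / ln 2 powr (4 + \<epsilon>)"
  define K' where "K' = c' / ln 2 powr (6 + \<epsilon>)"
  have pos: "0 < c" "0 < c'" "0 < K" "0 < K'" by (auto simp: c_def c'_def K_def K'_def intro!: divide_pos_pos add_pos_nonneg)
  show "\<exists>K>0::real. \<exists>K'>0::real. \<forall>F :: nat ring. field F \<and> carrier F = {..<q} \<longrightarrow>
       (\<forall>n\<ge>1. real (diam_pos (SL2_trunc F n))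
                 \<le> K * ln (real (order (SL2_trunc F n))) powr (4 + \<epsilon>)) \<and>
       directed_navigation_solvable (SL2_trunc F) (trunc_mat_code F)
         (\<lambda>n. nat \<lfloor>K * ln (real (order (SL2_trunc F n))) powr (4 + \<epsilon>)\<rfloor>)
         (\<lambda>n. nat \<lfloor>K' * ln (real (order (SL2_trunc F n))) powr (6 + \<epsilon>)\<rfloor>)"
  proof (rule exI[of _ K], rule conjI, rule pos(3), rule exI[of _ K'], rule conjI, rule pos(4), intro allI impI)
    fix F :: "nat ring"
    assume F: "field F \<and> carrier F = {..<q}"
    let ?l = "\<lambda>n. nat \<lfloor>K * ln (real (order (SL2_trunc F n))) powr (4 + \<epsilon>)\<rfloor>"
    let ?T = "\<lambda>n. nat \<lfloor>K' * ln (real (order (SL2_trunc F n))) powr (6 + \<epsilon>)\<rfloor>"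
    have cg: "coded_group F n q" if "1 \<le> n" for n
    proof -
      have "x \<oplus>\<^bsub>F\<^esub> x = \<zero>\<^bsub>F\<^esub>" if "x \<in> carrier F" for x
        by (rule even_field_char2) (use F q\<epsilon> that in auto)
      then show ?thesis using F that
        by (simp add: coded_group_def coded_group_axioms_def trunc_field_def trunc_field_axioms_def)
    qed
    \<comment> \<open>The program \<open>coded_group.nav_prog F q\<close> depends on
      \<open>F\<close> and \<open>q\<close> but not on \<open>n\<close>, \<open>S\<close> or
      \<open>g\<close>, so a single program answers all queries for the given field.\<close>
    have nav: "\<exists>k s w. exec (coded_group.nav_prog F q) (initial_state (navigation_input (trunc_mat_code F) n S g)) k s \<and> k \<le> ?T n \<and>
        set w \<subseteq> S \<and> length w \<le> ?l n \<and> word_value (SL2_trunc F n) w = g \<and> has_output s (list_code (map (trunc_mat_code F n) w))"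
      if n: "1 \<le> n" and S: "generating_set (SL2_trunc F n) S" and g: "g \<in> carrier (SL2_trunc F n)" for n S g
    proof -
      interpret coded_group F n q by (rule cg[OF n])
      have ord: "2 ^ n \<le> order SLn" by (rule SLn_order) (simp add: carrier_F)
      obtain k s where k: "exec nav_prog (initial_state (navigation_input (trunc_mat_code F) n S g)) k s" "k \<le> nav_time" "solved S g s"
        using runs_nav_prog[OF S g] by (rule runsE)
      from k(3) obtain w where w: "set w \<subseteq> S" "length w \<le> q ^ 12 + n * (3 * word_bound)" "wv w = g" "has_output s (list_code (map (tcode n) w))"
        unfolding solved_def[OF S g] by blast
      have "real (length w) \<le> real (49 * (q ^ 12 * n ^ 4))" using w(2) word_length_le by linarith
      also have "\<dots> \<le> c * real n ^ 4" by (simp add: c_def algebra_simps)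
      also have "\<dots> \<le> K * ln (real (order SLn)) powr (4 + \<epsilon>)"
        unfolding K_def using power_le_ln_powr[OF n ord, of c \<epsilon> 4] pos(1) q\<epsilon> by simp
      finally have "length w \<le> ?l n" by (simp add: le_nat_floor)
      have "real k \<le> real (100000 * (q ^ 14 * n ^ 6))" using k(2) nav_time_le by linarith
      also have "\<dots> \<le> c' * real n ^ 6" by (simp add: c'_def algebra_simps)
      also have "\<dots> \<le> K' * ln (real (order SLn)) powr (6 + \<epsilon>)"
        unfolding K'_def using power_le_ln_powr[OF n ord, of c' \<epsilon> 6] pos(2) q\<epsilon> by simp
      finally have "k \<le> ?T n" by (simp add: le_nat_floor)
      then show ?thesis using k(1) w \<open>length w \<le> ?l n\<close> by blast
    qed
    have "real (diam_pos (SL2_trunc F n)) \<le> K * ln (real (order (SL2_trunc F n))) powr (4 + \<epsilon>)" if n: "1 \<le> n" for n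
    proof -
      interpret coded_group F n q by (rule cg[OF n])
      have "diam_pos SLn \<le> ?l n"
      proof (rule diam_pos_le[OF SLn_group SLn_finite])
        fix S g assume "generating_set SLn S" "g \<in> carrier SLn"
        from nav[OF n this] show "\<exists>w. set w \<subseteq> S \<and> length w \<le> ?l n \<and> wv w = g" by blast
      qed (simp add: carrier_F)
      moreover have "0 \<le> K * ln (real (order SLn)) powr (4 + \<epsilon>)" using pos(3) by simp
      ultimately show ?thesis by (simp add: le_nat_iff le_floor_iff)
    qed
    moreover have "directed_navigation_solvable (SL2_trunc F) (trunc_mat_code F) ?l ?T"
      unfolding directed_navigation_solvable_def using nav by blast
    ultimately show "(\<forall>n\<ge>1. real (diam_pos (SL2_trunc F n)) \<le> K * ln (real (order (SL2_trunc F n))) powr (4 + \<epsilon>)) \<and>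
       directed_navigation_solvable (SL2_trunc F) (trunc_mat_code F) ?l ?T" by blast
  qed
qed

end
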